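(* Let $(G,\Gamma)$ be a matched pair of groups. Then any $(G,\Gamma)$-crossed monoidal category is $(G,\Gamma)$-crossed monoidally equivalent to a strictly $(G,\Gamma)$-crossed strict monoidal category.
   Context: A matched pair of groups $(G,\Gamma)=(G,\Gamma,\rhd_1,\rhd_2)$ consists of groups $G,\Gamma$, a left action $\rhd_1:G\times\Gamma\to\Gamma$ of $G$ on the set $\Gamma$ and a left action $\rhd_2:\Gamma\times G\to G$ of $\Gamma$ on the set $G$ such that $g\rhd_1e=e$, $s\rhd_2e=e$, $g\rhd_1(st)=((t\rhd_2g)\rhd_1s)(g\rhd_1t)$ and $s\rhd_2(gh)=((h\rhd_1s)\rhd_2g)(s\rhd_2h)$. A $\Gamma$-grading of an additive category $\mathcal C$ is a family of full additive subcategories $\{\mathcal C_s\}_{s\in\Gamma}$ (closed under isomorphism) such that every object is a finite direct sum of objects of the $\mathcal C_s$'s and $\mathrm{Hom}(\lambda,\mu)=0$ for $\lambda\in\mathcal C_s,\mu\in\mathcal C_t$, $s\ne t$. Write $\partial\lambda=s$ if $\lambda\in\mathrm{Obj}(\mathcal C_s)$ (well defined for nonzero $\lambda$) and $\mathrm{Homog}(\mathcal C)=\bigcup_s\mathrm{Obj}(\mathcal C_s)$. A $\Gamma$-graded monoidal category is an additive monoidal category (biadditive product) with a $\Gamma$-grading such that $\mathrm{Obj}(\mathcal C_s)\otimes\mathrm{Obj}(\mathcal C_t)\subset\mathrm{Obj}(\mathcal C_{st})$. A $\Gamma$-graded monoidal functor is an additive monoidal functor $F$ with $F(\mathrm{Obj}(\mathcal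 C_s))\subset\mathrm{Obj}(\mathcal D_s)$. Tensor products are also written by juxtaposition. An action $\gamma$ of $G$ on an additive category consists of additive endofunctors $\gamma(g)$, written ${}^g(-)$, and natural isomorphisms $\chi^\gamma_{g,h}:\gamma(g)\gamma(h)\cong\gamma(gh)$, $\iota^\gamma:\mathrm{id}\cong\gamma(e)$ making $g\mapsto\gamma(g)$ a monoidal functor from the discrete monoidal category $\underline G$; it is strict if all $\chi^\gamma_{g,h}$ and $\iota^\gamma$ are identities. A $(G,\Gamma)$-crossed monoidal category is a $\Gamma$-graded monoidal category $\mathcal C$ with an action $\gamma=\gamma^{\mathcal C}$ of $G$ on the category $\mathcal C$, isomorphisms $J^{\gamma(g)}_{\lambda,\mu}:{}^{\partial\mu\rhd_2g}\lambda\,{}^g\mu\cong{}^g(\lambda\mu)$ ($\lambda\in\mathrm{Obj}(\mathcal C)$, $\mu\in\mathrm{Homog}(\mathcal C)$, $g\in G$), natural in $\lambda,\mu$, and isomorphisms $\varphi^{\gamma(g)}:\mathbf 1\cong{}^g\mathbf 1$ such that (with $a$ the associator and unit constraints suppressed), for all $g,h\in G$, $\lambda\in\mathrm{Obj}(\mathcal C)$, $\mu,\nu\in\mathrm{Homog}(\mathcal C)$: 1. $\gamma(g)(\mathrm{Obj}(\mathcal C_s))\subset\mathrm{Obj}(\mathcal C_{g\rhd_1s})$ for $s\in\Gamma$. 2. ${}^ga_{\lambda,\mu,\nu}J^{\gamma(g)}_{\lambda\mu,\nu}(J^{\gamma(\partial\nu\rhd_2g)}_{\lambda,\mu}\otimes\mathrm{id})=J^{\gamma(g)}_{\lambda,\mu\nu}(\mathrm{id}\otimes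 J^{\gamma(g)}_{\mu,\nu})a$; $J^{\gamma(g)}_{\mathbf 1,\mu}(\varphi^{\gamma(\partial\mu\rhd_2g)}\otimes\mathrm{id})=\mathrm{id}_{{}^g\mu}=J^{\gamma(g)}_{\mu,\mathbf 1}(\mathrm{id}\otimes\varphi^{\gamma(g)})$. 3. $(\chi_{g,h})_{\lambda\mu}\,{}^gJ^{\gamma(h)}_{\lambda,\mu}J^{\gamma(g)}_{{}^{\partial\mu\rhd_2h}\lambda,{}^h\mu}=J^{\gamma(gh)}_{\lambda,\mu}((\chi_{(h\rhd_1\partial\mu)\rhd_2g,\,\partial\mu\rhd_2h})_\lambda\otimes(\chi_{g,h})_\mu)$; $(\chi_{g,h})_{\mathbf 1}\,{}^g\varphi^{\gamma(h)}\varphi^{\gamma(g)}=\varphi^{\gamma(gh)}$; $\iota_{\lambda\mu}=J^{\gamma(e)}_{\lambda,\mu}(\iota_\lambda\otimes\iota_\mu)$; $\iota_{\mathbf 1}=\varphi^{\gamma(e)}$. It is strictly $(G,\Gamma)$-crossed if the action $\gamma$ is strict and all $J^{\gamma(g)}_{\lambda,\mu}$ and $\varphi^{\gamma(g)}$ are identity maps. A $(G,\Gamma)$-crossed monoidal functor $\mathcal C\to\mathcal D$ is a pair $(F,\eta^F)$ of a $\Gamma$-graded monoidal functor $F$ (with structure $J^F_{\lambda,\mu}:F(\lambda)F(\mu)\cong F(\lambda\mu)$) and natural isomorphisms $\eta^F_g:F\gamma^{\mathcal C}(g)\cong\gamma^{\mathcal D}(g)F$ ($g\in G$) such that (1) $\eta^F_{gh}(\mathrm{id}_F*\chi^{\gamma^{\mathcal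 C}}_{g,h})=(\chi^{\gamma^{\mathcal D}}_{g,h}*\mathrm{id}_F)(\mathrm{id}_{\gamma^{\mathcal D}(g)}*\eta^F_h)(\eta^F_g*\mathrm{id}_{\gamma^{\mathcal C}(h)})$; (2) $(\eta^F_g)_{\lambda\mu}F(J^{\gamma^{\mathcal C}(g)}_{\lambda,\mu})J^F_{{}^{\partial\mu\rhd_2g}\lambda,{}^g\mu}={}^gJ^F_{\lambda,\mu}J^{\gamma^{\mathcal D}(g)}_{F(\lambda),F(\mu)}((\eta^F_{\partial\mu\rhd_2g})_\lambda\otimes(\eta^F_g)_\mu)$ for $\lambda\in\mathrm{Obj}(\mathcal C)$, $\mu\in\mathrm{Homog}(\mathcal C)$. Composites are formed with $\eta^{F_2F_1}_g=(\eta^{F_2}_g*\mathrm{id}_{F_1})(\mathrm{id}_{F_2}*\eta^{F_1}_g)$, and identity functors carry $\eta=\mathrm{id}$. A $(G,\Gamma)$-crossed monoidal natural transformation $\tau:F\to F'$ is a monoidal natural transformation with $(\mathrm{id}_{\gamma^{\mathcal D}(g)}*\tau)\eta^F_g=\eta^{F'}_g(\tau*\mathrm{id}_{\gamma^{\mathcal C}(g)})$ for all $g$. A $(G,\Gamma)$-crossed monoidal functor $F:\mathcal C\to\mathcal D$ is a $(G,\Gamma)$-crossed monoidal equivalence if there is a $(G,\Gamma)$-crossed monoidal functor $F^{-1}:\mathcal D\to\mathcal C$ with $(G,\Gamma)$-crossed monoidal natural isomorphisms $F^{-1}F\cong\mathrm{id}_{\mathcal C}$, $FF^{-1}\cong\mathrm{id}_{\mathcal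 D}$. Here $*$ is horizontal composition. *)

theory Defs
  imports "HOL-Algebra.FiniteProduct" "HOL-Algebra.Group_Action"
begin

section \<open>Matched pairs of groups\<close>

locale matched_pair =
  fixes G :: "('g, 'x) monoid_scheme" and \<Gamma> :: "('s, 'y) monoid_scheme"
    and act1 :: "'g \<Rightarrow> 's \<Rightarrow> 's" (infixr "\<rhd>\<^sub>1" 75)
    and act2 :: "'s \<Rightarrow> 'g \<Rightarrow> 'g" (infixr "\<rhd>\<^sub>2" 75)
  assumes group_G: "group G"
    and group_Gamma: "group \<Gamma>"
    and action1: "group_action G (carrier \<Gamma>) act1"
    and action2: "group_action \<Gamma> (carrier G) act2"
    and act1_one: "g \<in> carrier G \<Longrightarrow> g \<rhd>\<^sub>1 \<one>\<^bsub>\<Gamma>\<^esub> = \<one>\<^bsub>\<Gamma>\<^esub>"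
    and act2_one: "s \<in> carrier \<Gamma> \<Longrightarrow> s \<rhd>\<^sub>2 \<one>\<^bsub>G\<^esub> = \<one>\<^bsub>G\<^esub>"
    and act1_mult: "\<lbrakk>g \<in> carrier G; s \<in> carrier \<Gamma>; t \<in> carrier \<Gamma>\<rbrakk>
      \<Longrightarrow> g \<rhd>\<^sub>1 (s \<otimes>\<^bsub>\<Gamma>\<^esub> t) = ((t \<rhd>\<^sub>2 g) \<rhd>\<^sub>1 s) \<otimes>\<^bsub>\<Gamma>\<^esub> (g \<rhd>\<^sub>1 t)"
    and act2_mult: "\<lbrakk>s \<in> carrier \<Gamma>; g \<in> carrier G; h \<in> carrier G\<rbrakk>
      \<Longrightarrow> s \<rhd>\<^sub>2 (g \<otimes>\<^bsub>G\<^esub> h) = ((h \<rhd>\<^sub>1 s) \<rhd>\<^sub>2 g) \<otimes>\<^bsub>G\<^esub> (s \<rhd>\<^sub>2 h)"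


section \<open>Categories, functors, natural isomorphisms\<close>

record ('o, 'm) category =
  Obj :: "'o set"
  Arr :: "'m set"
  Dom :: "'m \<Rightarrow> 'o"
  Cod :: "'m \<Rightarrow> 'o"
  Ident :: "'o \<Rightarrow> 'm"
  Comp :: "'m \<Rightarrow> 'm \<Rightarrow> 'm" (infixr "\<cdot>\<index>" 60)

definition Hom :: "('o, 'm, 'z) category_scheme \<Rightarrow> 'o \<Rightarrow> 'o \<Rightarrow> 'm set" where
  "Hom C a b = {f \<in> Arr C. Dom C f = a \<and> Cod C f = b}"

locale category =
  fixes C :: "('o, 'm, 'z) category_scheme" (structure)
  assumes Dom_in: "f \<in> Arr C \<Longrightarrow> Dom C f \<in> Obj C"
    and Cod_in: "f \<in> Arr C \<Longrightarrow> Cod C f \<in> Obj C"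
    and Ident_in: "a \<in> Obj C \<Longrightarrow> Ident C a \<in> Hom C a a"
    and Comp_in: "\<lbrakk>f \<in> Hom C a b; g \<in> Hom C b c\<rbrakk> \<Longrightarrow> g \<cdot> f \<in> Hom C a c"
    and Comp_assoc: "\<lbrakk>f \<in> Hom C a b; g \<in> Hom C b c; h \<in> Hom C c d\<rbrakk>
      \<Longrightarrow> (h \<cdot> g) \<cdot> f = h \<cdot> (g \<cdot> f)"
    and Ident_left: "f \<in> Hom C a b \<Longrightarrow> Ident C b \<cdot> f = f"
    and Ident_right: "f \<in> Hom C a b \<Longrightarrow> f \<cdot> Ident C a = f"

definition Isos :: "('o, 'm, 'z) category_scheme \<Rightarrow> 'o \<Rightarrow> 'o \<Rightarrow> 'm set" where
  "Isos C a b = {f \<in> Hom C a b. \<exists>g \<in> Hom C b a.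
     g \<cdot>\<^bsub>C\<^esub> f = Ident C a \<and> f \<cdot>\<^bsub>C\<^esub> g = Ident C b}"

record ('o, 'm, 'p, 'n) cfunctor =
  fobj :: "'o \<Rightarrow> 'p"
  fmor :: "'m \<Rightarrow> 'n"

locale cfunctor = C: category C + D: category D
  for C :: "('o, 'm, 'z) category_scheme" and D :: "('p, 'n, 'w) category_scheme" +
  fixes F :: "('o, 'm, 'p, 'n, 'f) cfunctor_scheme"
  assumes fobj_in: "a \<in> Obj C \<Longrightarrow> fobj F a \<in> Obj D"
    and fmor_in: "f \<in> Hom C a b \<Longrightarrow> fmor F f \<in> Hom D (fobj F a) (fobj F b)"
    and fmor_Ident: "a \<in> Obj C \<Longrightarrow> fmor F (Ident C a) = Ident D (fobj F a)"
    and fmor_Comp: "\<lbrakk>f \<in> Hom C a b; g \<in> Hom C b c\<rbrakk>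
      \<Longrightarrow> fmor F (g \<cdot>\<^bsub>C\<^esub> f) = fmor F g \<cdot>\<^bsub>D\<^esub> fmor F f"

definition id_functor :: "('o, 'm, 'o, 'm) cfunctor" where
  "id_functor = \<lparr>fobj = (\<lambda>a. a), fmor = (\<lambda>f. f)\<rparr>"

definition comp_functor ::
  "('p, 'n, 'q, 'k, 'e) cfunctor_scheme \<Rightarrow> ('o, 'm, 'p, 'n, 'f) cfunctor_scheme
    \<Rightarrow> ('o, 'm, 'q, 'k) cfunctor" where
  "comp_functor F2 F1 =
    \<lparr>fobj = (\<lambda>a. fobj F2 (fobj F1 a)), fmor = (\<lambda>f. fmor F2 (fmor F1 f))\<rparr>"

definition natural_trans ::
  "('o, 'm, 'z) category_scheme \<Rightarrow> ('p, 'n, 'w) category_scheme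
    \<Rightarrow> ('o, 'm, 'p, 'n, 'e) cfunctor_scheme \<Rightarrow> ('o, 'm, 'p, 'n, 'f) cfunctor_scheme
    \<Rightarrow> ('o \<Rightarrow> 'n) \<Rightarrow> bool" where
  "natural_trans C D F F' \<tau> \<longleftrightarrow>
    (\<forall>a \<in> Obj C. \<tau> a \<in> Hom D (fobj F a) (fobj F' a)) \<and>
    (\<forall>a b. \<forall>f \<in> Hom C a b. \<tau> b \<cdot>\<^bsub>D\<^esub> fmor F f = fmor F' f \<cdot>\<^bsub>D\<^esub> \<tau> a)"

definition natural_iso ::
  "('o, 'm, 'z) category_scheme \<Rightarrow> ('p, 'n, 'w) category_scheme
    \<Rightarrow> ('o, 'm, 'p, 'n, 'e) cfunctor_scheme \<Rightarrow> ('o, 'm, 'p, 'n, 'f) cfunctor_scheme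
    \<Rightarrow> ('o \<Rightarrow> 'n) \<Rightarrow> bool" where
  "natural_iso C D F F' \<tau> \<longleftrightarrow> natural_trans C D F F' \<tau> \<and>
    (\<forall>a \<in> Obj C. \<tau> a \<in> Isos D (fobj F a) (fobj F' a))"


section \<open>Additive categories and gradings\<close>

record ('o, 'm) additive_category = "('o, 'm) category" +
  Add :: "'m \<Rightarrow> 'm \<Rightarrow> 'm" (infixl "\<boxplus>\<index>" 55)
  ZeroArr :: "'o \<Rightarrow> 'o \<Rightarrow> 'm"

definition Hom_group ::
  "('o, 'm, 'z) additive_category_scheme \<Rightarrow> 'o \<Rightarrow> 'o \<Rightarrow> 'm monoid" where
  "Hom_group C a b = \<lparr>carrier = Hom C a b, monoid.mult = Add C, one = ZeroArr C a b\<rparr>"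

text \<open>The object y is a direct sum of x 0, ..., x (n - 1). The \<^const>\<open>finprod\<close> below is taken
  in the additive group of endomorphisms of y, so it is a sum of morphisms. For n = 0 the
  condition says that y is a zero object.\<close>

definition direct_sum ::
  "('o, 'm, 'z) additive_category_scheme \<Rightarrow> nat \<Rightarrow> (nat \<Rightarrow> 'o) \<Rightarrow> 'o \<Rightarrow> bool" where
  "direct_sum C n x y \<longleftrightarrow> y \<in> Obj C \<and> (\<forall>k<n. x k \<in> Obj C) \<and>
    (\<exists>i p. (\<forall>k<n. i k \<in> Hom C (x k) y \<and> p k \<in> Hom C y (x k)) \<and>
      (\<forall>k<n. \<forall>l<n. p k \<cdot>\<^bsub>C\<^esub> i l = (if k = l then Ident C (x k) else ZeroArr C (x l) (x k))) \<and>
      finprod (Hom_group C y y) (\<lambda>k. i k \<cdot>\<^bsub>C\<^esub> p k) {..<n} = Ident C y)"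

locale additive_category = category C
  for C :: "('o, 'm, 'z) additive_category_scheme" (structure) +
  assumes Hom_comm_group: "\<lbrakk>a \<in> Obj C; b \<in> Obj C\<rbrakk> \<Longrightarrow> comm_group (Hom_group C a b)"
    and Comp_Add_left: "\<lbrakk>f \<in> Hom C a b; g \<in> Hom C b c; h \<in> Hom C b c\<rbrakk>
      \<Longrightarrow> (g \<boxplus> h) \<cdot> f = (g \<cdot> f) \<boxplus> (h \<cdot> f)"
    and Comp_Add_right: "\<lbrakk>f \<in> Hom C a b; g \<in> Hom C a b; h \<in> Hom C b c\<rbrakk>
      \<Longrightarrow> h \<cdot> (f \<boxplus> g) = (h \<cdot> f) \<boxplus> (h \<cdot> g)"
    and direct_sum_exists: "(\<And>k. k < n \<Longrightarrow> x k \<in> Obj C) \<Longrightarrow> \<exists>y. direct_sum C n x y"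

locale additive_functor = cfunctor C D F + C: additive_category C + D: additive_category D
  for C :: "('o, 'm, 'z) additive_category_scheme"
    and D :: "('p, 'n, 'w) additive_category_scheme"
    and F :: "('o, 'm, 'p, 'n, 'f) cfunctor_scheme" +
  assumes fmor_Add: "\<lbrakk>f \<in> Hom C a b; g \<in> Hom C a b\<rbrakk>
      \<Longrightarrow> fmor F (f \<boxplus>\<^bsub>C\<^esub> g) = fmor F f \<boxplus>\<^bsub>D\<^esub> fmor F g"

text \<open>A full subcategory is given by its set of objects.\<close>

definition full_additive_subcategory ::
  "('o, 'm, 'z) additive_category_scheme \<Rightarrow> 'o set \<Rightarrow> bool" where
  "full_additive_subcategory C S \<longleftrightarrow> S \<subseteq> Obj C \<and>
    (\<forall>n x. (\<forall>k<n. x k \<in> S) \<longrightarrow> (\<exists>y \<in> S. direct_sum C n x y))"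

locale grading = additive_category C
  for \<Gamma> :: "('s, 'y) monoid_scheme"
    and C :: "('o, 'm, 'z) additive_category_scheme" (structure) +
  fixes gr :: "'s \<Rightarrow> 'o set"
  assumes gr_subcategory: "s \<in> carrier \<Gamma> \<Longrightarrow> full_additive_subcategory C (gr s)"
    and gr_iso_closed: "\<lbrakk>s \<in> carrier \<Gamma>; a \<in> gr s; b \<in> Obj C; Isos C a b \<noteq> {}\<rbrakk> \<Longrightarrow> b \<in> gr s"
    and gr_decomposition: "y \<in> Obj C
      \<Longrightarrow> \<exists>n x. (\<forall>k<n. \<exists>s \<in> carrier \<Gamma>. x k \<in> gr s) \<and> direct_sum C n x y"
    and gr_orthogonal: "\<lbrakk>s \<in> carrier \<Gamma>; t \<in> carrier \<Gamma>; s \<noteq> t; a \<in> gr s; b \<in> gr t\<rbrakk>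
      \<Longrightarrow> Hom C a b = {ZeroArr C a b}"


section \<open>Graded monoidal categories and functors\<close>

record ('o, 'm) monoidal_category = "('o, 'm) additive_category" +
  TObj :: "'o \<Rightarrow> 'o \<Rightarrow> 'o" (infixl "\<boxtimes>\<index>" 70)
  TArr :: "'m \<Rightarrow> 'm \<Rightarrow> 'm" (infixl "\<boxtimes>\<^sub>m\<index>" 70)
  UnitObj :: 'o
  Assoc :: "'o \<Rightarrow> 'o \<Rightarrow> 'o \<Rightarrow> 'm"
  LUnit :: "'o \<Rightarrow> 'm"
  RUnit :: "'o \<Rightarrow> 'm"

locale additive_monoidal_category = additive_category C
  for C :: "('o, 'm, 'z) monoidal_category_scheme" (structure) +
  assumes TObj_in: "\<lbrakk>a \<in> Obj C; b \<in> Obj C\<rbrakk> \<Longrightarrow> a \<boxtimes> b \<in> Obj C"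
    and TArr_in: "\<lbrakk>f \<in> Hom C a b; k \<in> Hom C a' b'\<rbrakk>
      \<Longrightarrow> f \<boxtimes>\<^sub>m k \<in> Hom C (a \<boxtimes> a') (b \<boxtimes> b')"
    and TArr_Ident: "\<lbrakk>a \<in> Obj C; b \<in> Obj C\<rbrakk>
      \<Longrightarrow> Ident C a \<boxtimes>\<^sub>m Ident C b = Ident C (a \<boxtimes> b)"
    and TArr_Comp: "\<lbrakk>f \<in> Hom C a b; g \<in> Hom C b c; f' \<in> Hom C a' b'; g' \<in> Hom C b' c'\<rbrakk>
      \<Longrightarrow> (g \<cdot> f) \<boxtimes>\<^sub>m (g' \<cdot> f') = (g \<boxtimes>\<^sub>m g') \<cdot> (f \<boxtimes>\<^sub>m f')"
    and TArr_Add_left: "\<lbrakk>f \<in> Hom C a b; g \<in> Hom C a b; k \<in> Hom C a' b'\<rbrakk>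
      \<Longrightarrow> (f \<boxplus> g) \<boxtimes>\<^sub>m k = (f \<boxtimes>\<^sub>m k) \<boxplus> (g \<boxtimes>\<^sub>m k)"
    and TArr_Add_right: "\<lbrakk>k \<in> Hom C a' b'; f \<in> Hom C a b; g \<in> Hom C a b\<rbrakk>
      \<Longrightarrow> k \<boxtimes>\<^sub>m (f \<boxplus> g) = (k \<boxtimes>\<^sub>m f) \<boxplus> (k \<boxtimes>\<^sub>m g)"
    and UnitObj_in: "UnitObj C \<in> Obj C"
    and Assoc_iso: "\<lbrakk>a \<in> Obj C; b \<in> Obj C; c \<in> Obj C\<rbrakk>
      \<Longrightarrow> Assoc C a b c \<in> Isos C ((a \<boxtimes> b) \<boxtimes> c) (a \<boxtimes> (b \<boxtimes> c))"
    and Assoc_natural: "\<lbrakk>f \<in> Hom C a a'; g \<in> Hom C b b'; h \<in> Hom C c c'\<rbrakk>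
      \<Longrightarrow> Assoc C a' b' c' \<cdot> ((f \<boxtimes>\<^sub>m g) \<boxtimes>\<^sub>m h) = (f \<boxtimes>\<^sub>m (g \<boxtimes>\<^sub>m h)) \<cdot> Assoc C a b c"
    and LUnit_iso: "a \<in> Obj C \<Longrightarrow> LUnit C a \<in> Isos C (UnitObj C \<boxtimes> a) a"
    and LUnit_natural: "f \<in> Hom C a b
      \<Longrightarrow> LUnit C b \<cdot> (Ident C (UnitObj C) \<boxtimes>\<^sub>m f) = f \<cdot> LUnit C a"
    and RUnit_iso: "a \<in> Obj C \<Longrightarrow> RUnit C a \<in> Isos C (a \<boxtimes> UnitObj C) a"
    and RUnit_natural: "f \<in> Hom C a b
      \<Longrightarrow> RUnit C b \<cdot> (f \<boxtimes>\<^sub>m Ident C (UnitObj C)) = f \<cdot> RUnit C a"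
    and pentagon: "\<lbrakk>a \<in> Obj C; b \<in> Obj C; c \<in> Obj C; d \<in> Obj C\<rbrakk>
      \<Longrightarrow> Assoc C a b (c \<boxtimes> d) \<cdot> Assoc C (a \<boxtimes> b) c d =
        (Ident C a \<boxtimes>\<^sub>m Assoc C b c d) \<cdot> Assoc C a (b \<boxtimes> c) d \<cdot> (Assoc C a b c \<boxtimes>\<^sub>m Ident C d)"
    and triangle: "\<lbrakk>a \<in> Obj C; b \<in> Obj C\<rbrakk>
      \<Longrightarrow> (Ident C a \<boxtimes>\<^sub>m LUnit C b) \<cdot> Assoc C a (UnitObj C) b = RUnit C a \<boxtimes>\<^sub>m Ident C b"

text \<open>The typing axioms above turn the following equations between morphisms into strict
  associativity and unitality of the product of objects (hence, by naturality, of morphisms).\<close>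

definition strict_monoidal :: "('o, 'm, 'z) monoidal_category_scheme \<Rightarrow> bool" where
  "strict_monoidal C \<longleftrightarrow>
    (\<forall>a \<in> Obj C. \<forall>b \<in> Obj C. \<forall>c \<in> Obj C. Assoc C a b c = Ident C (a \<boxtimes>\<^bsub>C\<^esub> (b \<boxtimes>\<^bsub>C\<^esub> c))) \<and>
    (\<forall>a \<in> Obj C. LUnit C a = Ident C a) \<and>
    (\<forall>a \<in> Obj C. RUnit C a = Ident C a)"

record ('o, 'm, 's) graded_category = "('o, 'm) monoidal_category" +
  Gr :: "'s \<Rightarrow> 'o set"

locale graded_monoidal_category = additive_monoidal_category C + grading \<Gamma> C "Gr C"
  for \<Gamma> :: "('s, 'y) monoid_scheme"
    and C :: "('o, 'm, 's, 'z) graded_category_scheme" (structure) +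
  assumes Gr_TObj: "\<lbrakk>s \<in> carrier \<Gamma>; t \<in> carrier \<Gamma>; a \<in> Gr C s; b \<in> Gr C t\<rbrakk>
      \<Longrightarrow> a \<boxtimes> b \<in> Gr C (s \<otimes>\<^bsub>\<Gamma>\<^esub> t)"

record ('o, 'm, 'p, 'n) monoidal_functor = "('o, 'm, 'p, 'n) cfunctor" +
  fmult :: "'o \<Rightarrow> 'o \<Rightarrow> 'n"
  funit :: 'n

locale additive_monoidal_functor =
  additive_functor C D F + C: additive_monoidal_category C + D: additive_monoidal_category D
  for C :: "('o, 'm, 'z) monoidal_category_scheme"
    and D :: "('p, 'n, 'w) monoidal_category_scheme"
    and F :: "('o, 'm, 'p, 'n, 'f) monoidal_functor_scheme" +
  assumes fmult_iso: "\<lbrakk>a \<in> Obj C; b \<in> Obj C\<rbrakk>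
      \<Longrightarrow> fmult F a b \<in> Isos D (fobj F a \<boxtimes>\<^bsub>D\<^esub> fobj F b) (fobj F (a \<boxtimes>\<^bsub>C\<^esub> b))"
    and fmult_natural: "\<lbrakk>f \<in> Hom C a a'; k \<in> Hom C b b'\<rbrakk>
      \<Longrightarrow> fmult F a' b' \<cdot>\<^bsub>D\<^esub> (fmor F f \<boxtimes>\<^sub>m\<^bsub>D\<^esub> fmor F k) = fmor F (f \<boxtimes>\<^sub>m\<^bsub>C\<^esub> k) \<cdot>\<^bsub>D\<^esub> fmult F a b"
    and funit_iso: "funit F \<in> Isos D (UnitObj D) (fobj F (UnitObj C))"
    and fmult_assoc: "\<lbrakk>a \<in> Obj C; b \<in> Obj C; c \<in> Obj C\<rbrakk>
      \<Longrightarrow> fmor F (Assoc C a b c) \<cdot>\<^bsub>D\<^esub> fmult F (a \<boxtimes>\<^bsub>C\<^esub> b) c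
            \<cdot>\<^bsub>D\<^esub> (fmult F a b \<boxtimes>\<^sub>m\<^bsub>D\<^esub> Ident D (fobj F c)) =
          fmult F a (b \<boxtimes>\<^bsub>C\<^esub> c) \<cdot>\<^bsub>D\<^esub> (Ident D (fobj F a) \<boxtimes>\<^sub>m\<^bsub>D\<^esub> fmult F b c)
            \<cdot>\<^bsub>D\<^esub> Assoc D (fobj F a) (fobj F b) (fobj F c)"
    and funit_left: "a \<in> Obj C
      \<Longrightarrow> fmor F (LUnit C a) \<cdot>\<^bsub>D\<^esub> fmult F (UnitObj C) a
            \<cdot>\<^bsub>D\<^esub> (funit F \<boxtimes>\<^sub>m\<^bsub>D\<^esub> Ident D (fobj F a)) = LUnit D (fobj F a)"
    and funit_right: "a \<in> Obj C
      \<Longrightarrow> fmor F (RUnit C a) \<cdot>\<^bsub>D\<^esub> fmult F a (UnitObj C)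
            \<cdot>\<^bsub>D\<^esub> (Ident D (fobj F a) \<boxtimes>\<^sub>m\<^bsub>D\<^esub> funit F) = RUnit D (fobj F a)"

locale graded_monoidal_functor =
  additive_monoidal_functor C D F
    + C: graded_monoidal_category \<Gamma> C + D: graded_monoidal_category \<Gamma> D
  for \<Gamma> :: "('s, 'y) monoid_scheme"
    and C :: "('o, 'm, 's, 'z) graded_category_scheme"
    and D :: "('p, 'n, 's, 'w) graded_category_scheme"
    and F :: "('o, 'm, 'p, 'n, 'f) monoidal_functor_scheme" +
  assumes fobj_Gr: "\<lbrakk>s \<in> carrier \<Gamma>; a \<in> Gr C s\<rbrakk> \<Longrightarrow> fobj F a \<in> Gr D s"

definition monoidal_natural_trans ::
  "('o, 'm, 'z) monoidal_category_scheme \<Rightarrow> ('p, 'n, 'w) monoidal_category_scheme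
    \<Rightarrow> ('o, 'm, 'p, 'n, 'e) monoidal_functor_scheme
    \<Rightarrow> ('o, 'm, 'p, 'n, 'f) monoidal_functor_scheme \<Rightarrow> ('o \<Rightarrow> 'n) \<Rightarrow> bool" where
  "monoidal_natural_trans C D F F' \<tau> \<longleftrightarrow> natural_trans C D F F' \<tau> \<and>
    (\<forall>a \<in> Obj C. \<forall>b \<in> Obj C.
      \<tau> (a \<boxtimes>\<^bsub>C\<^esub> b) \<cdot>\<^bsub>D\<^esub> fmult F a b = fmult F' a b \<cdot>\<^bsub>D\<^esub> (\<tau> a \<boxtimes>\<^sub>m\<^bsub>D\<^esub> \<tau> b)) \<and>
    \<tau> (UnitObj C) \<cdot>\<^bsub>D\<^esub> funit F = funit F'"


section \<open>Group actions on additive categories\<close>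

text \<open>The associativity and unit axioms are those of a monoidal functor from the discrete
  monoidal category of G to the strict monoidal category of additive endofunctors of C,
  written out at each object.\<close>

locale category_action = additive_category C + G: group G
  for G :: "('g, 'x) monoid_scheme"
    and C :: "('o, 'm, 'z) additive_category_scheme" (structure) +
  fixes \<gamma> :: "'g \<Rightarrow> ('o, 'm, 'o, 'm) cfunctor"
    and \<chi> :: "'g \<Rightarrow> 'g \<Rightarrow> 'o \<Rightarrow> 'm"
    and \<iota> :: "'o \<Rightarrow> 'm"
  assumes act_functor: "g \<in> carrier G \<Longrightarrow> additive_functor C C (\<gamma> g)"
    and chi_iso: "\<lbrakk>g \<in> carrier G; h \<in> carrier G\<rbrakk>
      \<Longrightarrow> natural_iso C C (comp_functor (\<gamma> g) (\<gamma> h)) (\<gamma> (g \<otimes>\<^bsub>G\<^esub> h)) (\<chi> g h)"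
    and iota_iso: "natural_iso C C id_functor (\<gamma> \<one>\<^bsub>G\<^esub>) \<iota>"
    and chi_assoc: "\<lbrakk>g \<in> carrier G; h \<in> carrier G; k \<in> carrier G; a \<in> Obj C\<rbrakk>
      \<Longrightarrow> \<chi> g (h \<otimes>\<^bsub>G\<^esub> k) a \<cdot> fmor (\<gamma> g) (\<chi> h k a) = \<chi> (g \<otimes>\<^bsub>G\<^esub> h) k a \<cdot> \<chi> g h (fobj (\<gamma> k) a)"
    and chi_iota_left: "\<lbrakk>g \<in> carrier G; a \<in> Obj C\<rbrakk>
      \<Longrightarrow> \<chi> \<one>\<^bsub>G\<^esub> g a \<cdot> \<iota> (fobj (\<gamma> g) a) = Ident C (fobj (\<gamma> g) a)"
    and chi_iota_right: "\<lbrakk>g \<in> carrier G; a \<in> Obj C\<rbrakk>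
      \<Longrightarrow> \<chi> g \<one>\<^bsub>G\<^esub> a \<cdot> fmor (\<gamma> g) (\<iota> a) = Ident C (fobj (\<gamma> g) a)"


section \<open>Crossed monoidal categories\<close>

record ('o, 'm, 'g, 's) crossed_category = "('o, 'm, 's) graded_category" +
  Act :: "'g \<Rightarrow> ('o, 'm, 'o, 'm) cfunctor"
  Chi :: "'g \<Rightarrow> 'g \<Rightarrow> 'o \<Rightarrow> 'm"
  Iota :: "'o \<Rightarrow> 'm"
  ActMult :: "'g \<Rightarrow> 's \<Rightarrow> 'o \<Rightarrow> 'o \<Rightarrow> 'm"
  ActUnit :: "'g \<Rightarrow> 'm"

abbreviation act_obj ::
  "('o, 'm, 'g, 's, 'z) crossed_category_scheme \<Rightarrow> 'g \<Rightarrow> 'o \<Rightarrow> 'o" (infixr "\<star>\<index>" 80) where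
  "g \<star>\<^bsub>C\<^esub> a \<equiv> fobj (Act C g) a"

abbreviation act_arr ::
  "('o, 'm, 'g, 's, 'z) crossed_category_scheme \<Rightarrow> 'g \<Rightarrow> 'm \<Rightarrow> 'm" (infixr "\<star>\<^sub>m\<index>" 80) where
  "g \<star>\<^sub>m\<^bsub>C\<^esub> f \<equiv> fmor (Act C g) f"

text \<open>The degree of a zero object is not unique, and already the domain of the isomorphism J
  at (a, b) depends on the degree of b. Hence \<^term>\<open>ActMult C g s a b\<close> carries the degree s of b
  as an argument and is constrained for every s with \<^term>\<open>b \<in> Gr C s\<close>. For nonzero b this
  is exactly one morphism, and for zero b it is forced to be the zero morphism, so the
  additional index carries no additional data.

  No naturality is required between homogeneous objects of different degrees, since all
  morphisms between them are zero.\<close>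

locale crossed_monoidal_category =
  matched_pair G \<Gamma> act1 act2 + graded_monoidal_category \<Gamma> C
    + category_action G C "Act C" "Chi C" "Iota C"
  for G :: "('g, 'x) monoid_scheme" and \<Gamma> :: "('s, 'y) monoid_scheme"
    and act1 :: "'g \<Rightarrow> 's \<Rightarrow> 's" (infixr "\<rhd>\<^sub>1" 75)
    and act2 :: "'s \<Rightarrow> 'g \<Rightarrow> 'g" (infixr "\<rhd>\<^sub>2" 75)
    and C :: "('o, 'm, 'g, 's, 'z) crossed_category_scheme" (structure) +
  assumes ActMult_iso: "\<lbrakk>g \<in> carrier G; s \<in> carrier \<Gamma>; a \<in> Obj C; b \<in> Gr C s\<rbrakk>
      \<Longrightarrow> ActMult C g s a b \<in> Isos C ((s \<rhd>\<^sub>2 g) \<star> a \<boxtimes> g \<star> b) (g \<star> (a \<boxtimes> b))"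
    and ActMult_natural:
      "\<lbrakk>g \<in> carrier G; s \<in> carrier \<Gamma>; f \<in> Hom C a a'; k \<in> Hom C b b'; b \<in> Gr C s; b' \<in> Gr C s\<rbrakk>
      \<Longrightarrow> ActMult C g s a' b' \<cdot> ((s \<rhd>\<^sub>2 g) \<star>\<^sub>m f \<boxtimes>\<^sub>m g \<star>\<^sub>m k) = g \<star>\<^sub>m (f \<boxtimes>\<^sub>m k) \<cdot> ActMult C g s a b"
    and ActUnit_iso: "g \<in> carrier G \<Longrightarrow> ActUnit C g \<in> Isos C (UnitObj C) (g \<star> UnitObj C)"
    and act_Gr: "\<lbrakk>g \<in> carrier G; s \<in> carrier \<Gamma>; a \<in> Gr C s\<rbrakk> \<Longrightarrow> g \<star> a \<in> Gr C (g \<rhd>\<^sub>1 s)"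
    and ActMult_assoc:
      "\<lbrakk>g \<in> carrier G; s \<in> carrier \<Gamma>; t \<in> carrier \<Gamma>; a \<in> Obj C; b \<in> Gr C s; c \<in> Gr C t\<rbrakk>
      \<Longrightarrow> g \<star>\<^sub>m Assoc C a b c \<cdot> ActMult C g t (a \<boxtimes> b) c
            \<cdot> (ActMult C (t \<rhd>\<^sub>2 g) s a b \<boxtimes>\<^sub>m Ident C (g \<star> c)) =
          ActMult C g (s \<otimes>\<^bsub>\<Gamma>\<^esub> t) a (b \<boxtimes> c)
            \<cdot> (Ident C (((s \<otimes>\<^bsub>\<Gamma>\<^esub> t) \<rhd>\<^sub>2 g) \<star> a) \<boxtimes>\<^sub>m ActMult C g t b c)
            \<cdot> Assoc C (((s \<otimes>\<^bsub>\<Gamma>\<^esub> t) \<rhd>\<^sub>2 g) \<star> a) ((t \<rhd>\<^sub>2 g) \<star> b) (g \<star> c)"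
    and ActMult_unit_left: "\<lbrakk>g \<in> carrier G; s \<in> carrier \<Gamma>; b \<in> Gr C s\<rbrakk>
      \<Longrightarrow> g \<star>\<^sub>m LUnit C b \<cdot> ActMult C g s (UnitObj C) b
            \<cdot> (ActUnit C (s \<rhd>\<^sub>2 g) \<boxtimes>\<^sub>m Ident C (g \<star> b)) = LUnit C (g \<star> b)"
    \<comment> \<open>The unit object always has degree \<open>\<one>\<close>: this follows from the other axioms.\<close>
    and ActMult_unit_right: "\<lbrakk>g \<in> carrier G; s \<in> carrier \<Gamma>; b \<in> Gr C s\<rbrakk>
      \<Longrightarrow> g \<star>\<^sub>m RUnit C b \<cdot> ActMult C g \<one>\<^bsub>\<Gamma>\<^esub> b (UnitObj C)
            \<cdot> (Ident C (g \<star> b) \<boxtimes>\<^sub>m ActUnit C g) = RUnit C (g \<star> b)"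
    and Chi_ActMult:
      "\<lbrakk>g \<in> carrier G; h \<in> carrier G; s \<in> carrier \<Gamma>; a \<in> Obj C; b \<in> Gr C s\<rbrakk>
      \<Longrightarrow> Chi C g h (a \<boxtimes> b) \<cdot> g \<star>\<^sub>m ActMult C h s a b
            \<cdot> ActMult C g (h \<rhd>\<^sub>1 s) ((s \<rhd>\<^sub>2 h) \<star> a) (h \<star> b) =
          ActMult C (g \<otimes>\<^bsub>G\<^esub> h) s a b
            \<cdot> (Chi C ((h \<rhd>\<^sub>1 s) \<rhd>\<^sub>2 g) (s \<rhd>\<^sub>2 h) a \<boxtimes>\<^sub>m Chi C g h b)"
    and Chi_ActUnit: "\<lbrakk>g \<in> carrier G; h \<in> carrier G\<rbrakk>
      \<Longrightarrow> Chi C g h (UnitObj C) \<cdot> g \<star>\<^sub>m ActUnit C h \<cdot> ActUnit C g = ActUnit C (g \<otimes>\<^bsub>G\<^esub> h)"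
    and Iota_ActMult: "\<lbrakk>s \<in> carrier \<Gamma>; a \<in> Obj C; b \<in> Gr C s\<rbrakk>
      \<Longrightarrow> Iota C (a \<boxtimes> b) = ActMult C \<one>\<^bsub>G\<^esub> s a b \<cdot> (Iota C a \<boxtimes>\<^sub>m Iota C b)"
    and Iota_ActUnit: "Iota C (UnitObj C) = ActUnit C \<one>\<^bsub>G\<^esub>"

text \<open>As for \<open>strict_monoidal\<close>, these equations include the equality of the domains and
  codomains of the morphisms in question.\<close>

definition strictly_crossed ::
  "('g, 'x) monoid_scheme \<Rightarrow> ('s, 'y) monoid_scheme
    \<Rightarrow> ('o, 'm, 'g, 's, 'z) crossed_category_scheme \<Rightarrow> bool" where
  "strictly_crossed G \<Gamma> C \<longleftrightarrow>
    (\<forall>g \<in> carrier G. \<forall>h \<in> carrier G. \<forall>a \<in> Obj C. Chi C g h a = Ident C ((g \<otimes>\<^bsub>G\<^esub> h) \<star>\<^bsub>C\<^esub> a)) \<and>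
    (\<forall>a \<in> Obj C. Iota C a = Ident C a) \<and>
    (\<forall>g \<in> carrier G. \<forall>s \<in> carrier \<Gamma>. \<forall>a \<in> Obj C. \<forall>b \<in> Gr C s.
      ActMult C g s a b = Ident C (g \<star>\<^bsub>C\<^esub> (a \<boxtimes>\<^bsub>C\<^esub> b))) \<and>
    (\<forall>g \<in> carrier G. ActUnit C g = Ident C (UnitObj C))"


section \<open>Crossed monoidal functors and equivalences\<close>

record ('o, 'm, 'p, 'n, 'g) crossed_functor = "('o, 'm, 'p, 'n) monoidal_functor" +
  feta :: "'g \<Rightarrow> 'o \<Rightarrow> 'n"

locale crossed_monoidal_functor =
  graded_monoidal_functor \<Gamma> C D F
    + C: crossed_monoidal_category G \<Gamma> act1 act2 C
    + D: crossed_monoidal_category G \<Gamma> act1 act2 D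
  for G :: "('g, 'x) monoid_scheme" and \<Gamma> :: "('s, 'y) monoid_scheme"
    and act1 :: "'g \<Rightarrow> 's \<Rightarrow> 's" (infixr "\<rhd>\<^sub>1" 75)
    and act2 :: "'s \<Rightarrow> 'g \<Rightarrow> 'g" (infixr "\<rhd>\<^sub>2" 75)
    and C :: "('o, 'm, 'g, 's, 'z) crossed_category_scheme"
    and D :: "('p, 'n, 'g, 's, 'w) crossed_category_scheme"
    and F :: "('o, 'm, 'p, 'n, 'g, 'f) crossed_functor_scheme" +
  assumes feta_iso: "g \<in> carrier G
      \<Longrightarrow> natural_iso C D (comp_functor F (Act C g)) (comp_functor (Act D g) F) (feta F g)"
    and feta_Chi: "\<lbrakk>g \<in> carrier G; h \<in> carrier G; a \<in> Obj C\<rbrakk>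
      \<Longrightarrow> feta F (g \<otimes>\<^bsub>G\<^esub> h) a \<cdot>\<^bsub>D\<^esub> fmor F (Chi C g h a) =
          Chi D g h (fobj F a) \<cdot>\<^bsub>D\<^esub> g \<star>\<^sub>m\<^bsub>D\<^esub> feta F h a \<cdot>\<^bsub>D\<^esub> feta F g (h \<star>\<^bsub>C\<^esub> a)"
    and feta_ActMult: "\<lbrakk>g \<in> carrier G; s \<in> carrier \<Gamma>; a \<in> Obj C; b \<in> Gr C s\<rbrakk>
      \<Longrightarrow> feta F g (a \<boxtimes>\<^bsub>C\<^esub> b) \<cdot>\<^bsub>D\<^esub> fmor F (ActMult C g s a b)
            \<cdot>\<^bsub>D\<^esub> fmult F ((s \<rhd>\<^sub>2 g) \<star>\<^bsub>C\<^esub> a) (g \<star>\<^bsub>C\<^esub> b) =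
          g \<star>\<^sub>m\<^bsub>D\<^esub> fmult F a b \<cdot>\<^bsub>D\<^esub> ActMult D g s (fobj F a) (fobj F b)
            \<cdot>\<^bsub>D\<^esub> (feta F (s \<rhd>\<^sub>2 g) a \<boxtimes>\<^sub>m\<^bsub>D\<^esub> feta F g b)"

definition id_crossed ::
  "('o, 'm, 'g, 's, 'z) crossed_category_scheme \<Rightarrow> ('o, 'm, 'o, 'm, 'g) crossed_functor" where
  "id_crossed C =
    \<lparr>fobj = (\<lambda>a. a), fmor = (\<lambda>f. f),
     fmult = (\<lambda>a b. Ident C (a \<boxtimes>\<^bsub>C\<^esub> b)), funit = Ident C (UnitObj C),
     feta = (\<lambda>g a. Ident C (g \<star>\<^bsub>C\<^esub> a))\<rparr>"

text \<open>E is the codomain of F2, where the structure morphisms of the composite are composed.\<close>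

definition comp_crossed ::
  "('q, 'k, 'g, 's, 'z) crossed_category_scheme
    \<Rightarrow> ('p, 'n, 'q, 'k, 'g, 'e) crossed_functor_scheme
    \<Rightarrow> ('o, 'm, 'p, 'n, 'g, 'f) crossed_functor_scheme
    \<Rightarrow> ('o, 'm, 'q, 'k, 'g) crossed_functor" where
  "comp_crossed E F2 F1 =
    \<lparr>fobj = (\<lambda>a. fobj F2 (fobj F1 a)), fmor = (\<lambda>f. fmor F2 (fmor F1 f)),
     fmult = (\<lambda>a b. fmor F2 (fmult F1 a b) \<cdot>\<^bsub>E\<^esub> fmult F2 (fobj F1 a) (fobj F1 b)),
     funit = fmor F2 (funit F1) \<cdot>\<^bsub>E\<^esub> funit F2,
     feta = (\<lambda>g a. feta F2 g (fobj F1 a) \<cdot>\<^bsub>E\<^esub> fmor F2 (feta F1 g a))\<rparr>"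

definition crossed_monoidal_natural_trans ::
  "('g, 'x) monoid_scheme
    \<Rightarrow> ('o, 'm, 'g, 's, 'z) crossed_category_scheme
    \<Rightarrow> ('p, 'n, 'g, 's, 'w) crossed_category_scheme
    \<Rightarrow> ('o, 'm, 'p, 'n, 'g, 'e) crossed_functor_scheme
    \<Rightarrow> ('o, 'm, 'p, 'n, 'g, 'f) crossed_functor_scheme \<Rightarrow> ('o \<Rightarrow> 'n) \<Rightarrow> bool" where
  "crossed_monoidal_natural_trans G C D F F' \<tau> \<longleftrightarrow> monoidal_natural_trans C D F F' \<tau> \<and>
    (\<forall>g \<in> carrier G. \<forall>a \<in> Obj C.
      g \<star>\<^sub>m\<^bsub>D\<^esub> \<tau> a \<cdot>\<^bsub>D\<^esub> feta F g a = feta F' g a \<cdot>\<^bsub>D\<^esub> \<tau> (g \<star>\<^bsub>C\<^esub> a))"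

definition crossed_monoidal_natural_iso ::
  "('g, 'x) monoid_scheme
    \<Rightarrow> ('o, 'm, 'g, 's, 'z) crossed_category_scheme
    \<Rightarrow> ('p, 'n, 'g, 's, 'w) crossed_category_scheme
    \<Rightarrow> ('o, 'm, 'p, 'n, 'g, 'e) crossed_functor_scheme
    \<Rightarrow> ('o, 'm, 'p, 'n, 'g, 'f) crossed_functor_scheme \<Rightarrow> ('o \<Rightarrow> 'n) \<Rightarrow> bool" where
  "crossed_monoidal_natural_iso G C D F F' \<tau> \<longleftrightarrow>
    crossed_monoidal_natural_trans G C D F F' \<tau> \<and> natural_iso C D F F' \<tau>"

definition crossed_monoidal_equivalence ::
  "('g, 'x) monoid_scheme \<Rightarrow> ('s, 'y) monoid_scheme
    \<Rightarrow> ('g \<Rightarrow> 's \<Rightarrow> 's) \<Rightarrow> ('s \<Rightarrow> 'g \<Rightarrow> 'g)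
    \<Rightarrow> ('o, 'm, 'g, 's, 'z) crossed_category_scheme
    \<Rightarrow> ('p, 'n, 'g, 's, 'w) crossed_category_scheme
    \<Rightarrow> ('o, 'm, 'p, 'n, 'g) crossed_functor \<Rightarrow> bool" where
  "crossed_monoidal_equivalence G \<Gamma> act1 act2 C D F \<longleftrightarrow>
    crossed_monoidal_functor G \<Gamma> act1 act2 C D F \<and>
    (\<exists>F' :: ('p, 'n, 'o, 'm, 'g) crossed_functor.
      crossed_monoidal_functor G \<Gamma> act1 act2 D C F' \<and>
      (\<exists>\<sigma>. crossed_monoidal_natural_iso G C C (comp_crossed C F' F) (id_crossed C) \<sigma>) \<and>
      (\<exists>\<tau>. crossed_monoidal_natural_iso G D D (comp_crossed D F F') (id_crossed D) \<tau>))"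

text \<open>HOL cannot quantify existentially over types, so the types of the objects and morphisms
  of a strictification have to be fixed in terms of those of the given category. Objects: lists
  of words (formal direct sums of formal products) in letters (g, a), each standing for the
  formal action of g on a. Morphisms: a morphism of the given category tagged with its domain
  and codomain. Only the types are prescribed here, not the structure on them.\<close>

type_synonym ('o, 'g) strict_obj = "('g \<times> 'o) list list"
type_synonym ('o, 'm, 'g) strict_arr = "('o, 'g) strict_obj \<times> ('o, 'g) strict_obj \<times> 'm"
type_synonym ('o, 'm, 'g, 's) strict_category =
  "(('o, 'g) strict_obj, ('o, 'm, 'g) strict_arr, 'g, 's) crossed_category"

end

theory Submission
  imports Defs
begin

text \<open>Objects of the strictification D are formal finite sums of formal words in letters (g, a), with a
  homogeneous in C and g acting formally. Words are multiplied by concatenation, and g acts on a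
  word letter by letter through the rule for the action on a product, which is unambiguous because
  every letter has a degree. Sums are multiplied by distributivity, dropping the words whose
  realization in C is zero. The dropping makes the equation g(xy) = (s |> g)(x) g(y) hold strictly
  even when y is a zero object, which has every degree s. A sum is realized by a chosen direct sum
  in C of the realizations of its words, and the morphisms of D are the morphisms of C between
  realizations. The realization is an essentially surjective functor carrying coherent isomorphisms
  M (product), U (unit) and B (action); conjugating by these makes all structure morphisms of D
  identities. M and B are determined on the summands, so their coherence reduces to that of words,
  where it is proved by induction on the length.\<close>

section \<open>Isomorphisms\<close>

text \<open>Direct sums must be formed formally because an inhomogeneous object cannot be a letter:
  without a degree it gives no definite element \<open>s \<rhd>\<^sub>2 g\<close> to act on the
  factors to its left. The difficulty is then to keep sums strict. Distributing in lexicographic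
  order makes the product of lists associative on the nose, and dropping zero words does not disturb
  this, since every factor of a nonzero word is nonzero. Equality of lists is still too weak for the
  coherence of M: equal positions must also come from the same triple of summands. Compatibility
  with the action rests on retracts: a nonzero word occurring in a sum of degree s has degree s, so
  one twisted element acts on all left factors. If the unit of C is zero, the formal unit is the
  empty sum. The locale \<open>strict_model\<close> separates the transport of structure from these
  choices. As morphisms are transported by conjugation, M and B are natural by construction; what
  must be supplied are the strict laws on objects and the coherence identities.\<close>

lemma Hom_iff [simp]: "f \<in> Hom C a b \<longleftrightarrow> f \<in> Arr C \<and> Dom C f = a \<and> Cod C f = b"
  by (simp add: Hom_def)

definition iso_arr :: "('o, 'm, 'z) category_scheme \<Rightarrow> 'm \<Rightarrow> bool" where
  "iso_arr C f \<longleftrightarrow> f \<in> Isos C (Dom C f) (Cod C f)"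

definition inv_arr :: "('o, 'm, 'z) category_scheme \<Rightarrow> 'm \<Rightarrow> 'm" where
  "inv_arr C f = (SOME g. g \<in> Hom C (Cod C f) (Dom C f) \<and>
     g \<cdot>\<^bsub>C\<^esub> f = Ident C (Dom C f) \<and> f \<cdot>\<^bsub>C\<^esub> g = Ident C (Cod C f))"

lemma Isos_iff: "f \<in> Isos C a b \<longleftrightarrow> iso_arr C f \<and> Dom C f = a \<and> Cod C f = b"
  by (auto simp: iso_arr_def Isos_def)

lemma iso_arrI:
  assumes "f \<in> Arr C" "g \<in> Arr C" "Dom C g = Cod C f" "Cod C g = Dom C f"
    "g \<cdot>\<^bsub>C\<^esub> f = Ident C (Dom C f)" "f \<cdot>\<^bsub>C\<^esub> g = Ident C (Cod C f)"
  shows "iso_arr C f"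
  using assms by (auto simp: iso_arr_def Isos_def)

lemma iso_arr_in: "iso_arr C f \<Longrightarrow> f \<in> Arr C"
  by (auto simp: iso_arr_def Isos_def)

lemma inv_arr:
  assumes "iso_arr C f"
  shows "inv_arr C f \<in> Arr C" "Dom C (inv_arr C f) = Cod C f" "Cod C (inv_arr C f) = Dom C f"
    "inv_arr C f \<cdot>\<^bsub>C\<^esub> f = Ident C (Dom C f)" "f \<cdot>\<^bsub>C\<^esub> inv_arr C f = Ident C (Cod C f)"
proof -
  have "\<exists>g. g \<in> Hom C (Cod C f) (Dom C f) \<and>
     g \<cdot>\<^bsub>C\<^esub> f = Ident C (Dom C f) \<and> f \<cdot>\<^bsub>C\<^esub> g = Ident C (Cod C f)"
    using assms by (auto simp: iso_arr_def Isos_def)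
  from someI_ex[OF this, folded inv_arr_def]
  show "inv_arr C f \<in> Arr C" "Dom C (inv_arr C f) = Cod C f" "Cod C (inv_arr C f) = Dom C f"
    "inv_arr C f \<cdot>\<^bsub>C\<^esub> f = Ident C (Dom C f)" "f \<cdot>\<^bsub>C\<^esub> inv_arr C f = Ident C (Cod C f)"
    by auto
qed

context category
begin

lemma Dom_Obj [simp]: "f \<in> Arr C \<Longrightarrow> Dom C f \<in> Obj C"
  and Cod_Obj [simp]: "f \<in> Arr C \<Longrightarrow> Cod C f \<in> Obj C"
  by (simp_all add: Dom_in Cod_in)

lemma Ident_Arr [simp]: "a \<in> Obj C \<Longrightarrow> Ident C a \<in> Arr C"
  and Dom_Ident [simp]: "a \<in> Obj C \<Longrightarrow> Dom C (Ident C a) = a"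
  and Cod_Ident [simp]: "a \<in> Obj C \<Longrightarrow> Cod C (Ident C a) = a"
  using Ident_in by auto

lemma comp_Arr [simp]:
  assumes "f \<in> Arr C" "g \<in> Arr C" "Cod C f = Dom C g"
  shows "g \<cdot> f \<in> Arr C" "Dom C (g \<cdot> f) = Dom C f" "Cod C (g \<cdot> f) = Cod C g"
  using Comp_in[of f "Dom C f" "Dom C g" g "Cod C g"] assms by auto

lemma comp_assoc [simp]:
  assumes "f \<in> Arr C" "g \<in> Arr C" "h \<in> Arr C" "Cod C f = Dom C g" "Cod C g = Dom C h"
  shows "(h \<cdot> g) \<cdot> f = h \<cdot> g \<cdot> f"
  using assms by (intro Comp_assoc) auto

lemma comp_Ident [simp]:
  "f \<in> Arr C \<Longrightarrow> Cod C f = b \<Longrightarrow> Ident C b \<cdot> f = f"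
  "f \<in> Arr C \<Longrightarrow> Dom C f = a \<Longrightarrow> f \<cdot> Ident C a = f"
  using Ident_left Ident_right by auto

text \<open>Composites are normalised to right-nested form, where an equation
  \<open>g \<cdot> f = h\<close> no longer matches inside a longer chain. The version with a tail k
  applies it there.\<close>

lemma comp_assoc_eq:
  assumes "g \<cdot> f = h" "f \<in> Arr C" "g \<in> Arr C" "Cod C f = Dom C g" "k \<in> Arr C" "Cod C k = Dom C f"
  shows "g \<cdot> f \<cdot> k = h \<cdot> k"
  using assms by (metis comp_assoc)

lemma inv_arr_Arr [simp]: "iso_arr C f \<Longrightarrow> inv_arr C f \<in> Arr C"
  "iso_arr C f \<Longrightarrow> Dom C (inv_arr C f) = Cod C f"
  "iso_arr C f \<Longrightarrow> Cod C (inv_arr C f) = Dom C f"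
  by (simp_all add: inv_arr)

lemma inv_arr_comp [simp]:
  assumes "iso_arr C f"
  shows "inv_arr C f \<cdot> f = Ident C (Dom C f)" "f \<cdot> inv_arr C f = Ident C (Cod C f)"
    "k \<in> Arr C \<Longrightarrow> Cod C k = Dom C f \<Longrightarrow> inv_arr C f \<cdot> f \<cdot> k = k"
    "k \<in> Arr C \<Longrightarrow> Cod C k = Cod C f \<Longrightarrow> f \<cdot> inv_arr C f \<cdot> k = k"
proof -
  show 1: "inv_arr C f \<cdot> f = Ident C (Dom C f)" and 2: "f \<cdot> inv_arr C f = Ident C (Cod C f)"
    using assms by (simp_all add: inv_arr)
  have "f \<in> Arr C" using assms by (rule iso_arr_in)
  then show "k \<in> Arr C \<Longrightarrow> Cod C k = Dom C f \<Longrightarrow> inv_arr C f \<cdot> f \<cdot> k = k"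
    "k \<in> Arr C \<Longrightarrow> Cod C k = Cod C f \<Longrightarrow> f \<cdot> inv_arr C f \<cdot> k = k"
    using comp_assoc_eq[OF 1] comp_assoc_eq[OF 2] assms by auto
qed

lemma iso_Ident [simp]: "a \<in> Obj C \<Longrightarrow> iso_arr C (Ident C a)"
  by (rule iso_arrI[of _ _ "Ident C a"]) auto

lemma iso_inv [simp]: "iso_arr C f \<Longrightarrow> iso_arr C (inv_arr C f)"
  by (rule iso_arrI[of _ _ f]) (auto dest: iso_arr_in)

lemma iso_comp [simp]:
  assumes "iso_arr C f" "iso_arr C g" "Cod C f = Dom C g"
  shows "iso_arr C (g \<cdot> f)"
proof -
  have "f \<in> Arr C" "g \<in> Arr C" using assms by (auto dest: iso_arr_in)
  then show ?thesis
    by (intro iso_arrI[of _ _ "inv_arr C f \<cdot> inv_arr C g"]) (use assms in simp_all)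
qed

lemma iso_cancel_right:
  assumes "g \<cdot> f = h \<cdot> f" "iso_arr C f" "g \<in> Arr C" "h \<in> Arr C" "Dom C g = Cod C f" "Dom C h = Cod C f"
  shows "g = h"
proof -
  have "f \<in> Arr C" using assms by (auto dest: iso_arr_in)
  then have "(g \<cdot> f) \<cdot> inv_arr C f = g" "(h \<cdot> f) \<cdot> inv_arr C f = h" using assms(2-) by simp_all
  then show ?thesis using assms(1) by metis
qed

lemma iso_cancel_left:
  assumes "f \<cdot> g = f \<cdot> h" "iso_arr C f" "g \<in> Arr C" "h \<in> Arr C" "Cod C g = Dom C f" "Cod C h = Dom C f"
  shows "g = h"
proof -
  have "f \<in> Arr C" using assms by (auto dest: iso_arr_in)
  then have "inv_arr C f \<cdot> (f \<cdot> g) = g" "inv_arr C f \<cdot> (f \<cdot> h) = h" using assms(2-) by simp_all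
  then show ?thesis using assms(1) by metis
qed

lemma inv_arr_eqI:
  assumes "iso_arr C f" "f \<cdot> g = Ident C (Cod C f)" "g \<in> Arr C" "Cod C g = Dom C f" 
  shows "inv_arr C f = g"
proof -
  have f: "f \<in> Arr C" using assms by (auto dest: iso_arr_in)
  \<comment> \<open>The domain of g is read off from the identity that the composite equals.\<close>
  then have d: "Dom C g = Cod C f" using assms comp_Arr(2)[of g f] by simp
  show ?thesis by (rule iso_cancel_left[of f]) (use assms d in auto)
qed

end

context cfunctor
begin

lemma fobj_Obj [simp]: "a \<in> Obj C \<Longrightarrow> fobj F a \<in> Obj D"
  by (rule fobj_in)

lemma fmor_Arr [simp]:
  assumes "f \<in> Arr C"
  shows "fmor F f \<in> Arr D" "Dom D (fmor F f) = fobj F (Dom C f)" "Cod D (fmor F f) = fobj F (Cod C f)"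
  using fmor_in[of f "Dom C f" "Cod C f"] assms by auto

lemma fmor_id [simp]: "a \<in> Obj C \<Longrightarrow> fmor F (Ident C a) = Ident D (fobj F a)"
  by (rule fmor_Ident)

lemma fmor_comp:
  assumes "f \<in> Arr C" "g \<in> Arr C" "Cod C f = Dom C g"
  shows "fmor F (g \<cdot>\<^bsub>C\<^esub> f) = fmor F g \<cdot>\<^bsub>D\<^esub> fmor F f"
  using fmor_Comp[of f "Dom C f" "Dom C g" g "Cod C g"] assms by auto

lemma fmor_iso:
  assumes "iso_arr C f"
  shows "iso_arr D (fmor F f)" "inv_arr D (fmor F f) = fmor F (inv_arr C f)"
proof -
  have f: "f \<in> Arr C" using assms by (auto dest: iso_arr_in)
  have 1: "fmor F (inv_arr C f) \<cdot>\<^bsub>D\<^esub> fmor F f = Ident D (fobj F (Dom C f))"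
    "fmor F f \<cdot>\<^bsub>D\<^esub> fmor F (inv_arr C f) = Ident D (fobj F (Cod C f))"
    using assms f by (simp_all flip: fmor_comp)
  show 2: "iso_arr D (fmor F f)" by (rule iso_arrI[of _ _ "fmor F (inv_arr C f)"]) (use 1 assms f in auto)
  show "inv_arr D (fmor F f) = fmor F (inv_arr C f)"
    by (rule D.inv_arr_eqI[OF 2]) (use 1 assms f in auto)
qed

end

section \<open>Direct sums\<close>

abbreviation hom_sum ::
  "('o, 'm, 'z) additive_category_scheme \<Rightarrow> 'o \<Rightarrow> 'o \<Rightarrow> nat \<Rightarrow> (nat \<Rightarrow> 'm) \<Rightarrow> 'm" where
  "hom_sum C a b n f \<equiv> finprod (Hom_group C a b) f {..<n}"

text \<open>Used for additive functors, for composition with a fixed morphism on either side and for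
  tagging morphisms with their endpoints, each of which is a homomorphism of Hom groups.\<close>

lemma hom_finprod:
  assumes "comm_group A" "comm_group B" "h \<in> hom A B" "finite S" "\<And>k. k \<in> S \<Longrightarrow> f k \<in> carrier A"
  shows "h (finprod A f S) = finprod B (\<lambda>k. h (f k)) S"
proof -
  interpret A: comm_group A by fact
  interpret B: comm_group B by fact
  interpret group_hom A B h by unfold_locales fact
  show ?thesis using assms(4,5)
    by (induction S rule: finite_induct) (simp_all add: Pi_iff)
qed

definition zero_obj :: "('o, 'm, 'z) additive_category_scheme \<Rightarrow> 'o \<Rightarrow> bool" where
  "zero_obj C a \<longleftrightarrow> Ident C a = ZeroArr C a a"

text \<open>The body of \<open>direct_sum\<close> with injections and projections as parameters, so
  that functors can be applied to them and restrictions to summands can be stated.\<close>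

definition biproduct :: "('o, 'm, 'z) additive_category_scheme \<Rightarrow> nat \<Rightarrow> (nat \<Rightarrow> 'o) \<Rightarrow> 'o
    \<Rightarrow> (nat \<Rightarrow> 'm) \<Rightarrow> (nat \<Rightarrow> 'm) \<Rightarrow> bool" where
  "biproduct C n x y i p \<longleftrightarrow> y \<in> Obj C \<and> (\<forall>k<n. x k \<in> Obj C) \<and>
    (\<forall>k<n. i k \<in> Hom C (x k) y \<and> p k \<in> Hom C y (x k)) \<and>
    (\<forall>k<n. \<forall>l<n. p k \<cdot>\<^bsub>C\<^esub> i l = (if k = l then Ident C (x k) else ZeroArr C (x l) (x k))) \<and>
    hom_sum C y y n (\<lambda>k. i k \<cdot>\<^bsub>C\<^esub> p k) = Ident C y"

lemma direct_sum_iff: "direct_sum C n x y \<longleftrightarrow> (\<exists>i p. biproduct C n x y i p)"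
  unfolding direct_sum_def biproduct_def by blast

text \<open>Comparison maps need only the universal property. The index set is arbitrary so that
  pairs of positions can index the summands of a tensor product of two sums.\<close>

definition coproduct :: "('o, 'm, 'z) category_scheme \<Rightarrow> 'i set \<Rightarrow> ('i \<Rightarrow> 'o) \<Rightarrow> 'o
    \<Rightarrow> ('i \<Rightarrow> 'm) \<Rightarrow> bool" where
  "coproduct C I x y e \<longleftrightarrow> y \<in> Obj C \<and> (\<forall>k\<in>I. e k \<in> Hom C (x k) y) \<and>
    (\<forall>c \<in> Obj C. \<forall>f. (\<forall>k\<in>I. f k \<in> Hom C (x k) c) \<longrightarrow>
      (\<exists>!h. h \<in> Hom C y c \<and> (\<forall>k\<in>I. h \<cdot>\<^bsub>C\<^esub> e k = f k)))"

lemma coproductD: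
  assumes "coproduct C I x y e"
  shows "y \<in> Obj C" "k \<in> I \<Longrightarrow> e k \<in> Arr C" "k \<in> I \<Longrightarrow> Dom C (e k) = x k"
    "k \<in> I \<Longrightarrow> Cod C (e k) = y"
  using assms by (auto simp: coproduct_def)

lemma coproduct_ex:
  assumes "coproduct C I x y e" "c \<in> Obj C" "\<And>k. k \<in> I \<Longrightarrow> f k \<in> Hom C (x k) c"
  obtains h where "h \<in> Arr C" "Dom C h = y" "Cod C h = c" "\<And>k. k \<in> I \<Longrightarrow> h \<cdot>\<^bsub>C\<^esub> e k = f k"
  using assms unfolding coproduct_def by (metis Hom_iff)

lemma (in category) coproduct_eqI:
  assumes "coproduct C I x y e" "\<And>k. k \<in> I \<Longrightarrow> f \<cdot> e k = g \<cdot> e k"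
    "f \<in> Arr C" "g \<in> Arr C" "Dom C f = y" "Dom C g = y" "Cod C f = Cod C g"
  shows "f = g"
proof -
  have e: "\<forall>k\<in>I. e k \<in> Arr C \<and> Dom C (e k) = x k \<and> Cod C (e k) = y"
    using assms(1) by (simp add: coproduct_def)
  have *: "\<exists>!h. h \<in> Hom C y (Cod C f) \<and> (\<forall>k\<in>I. h \<cdot> e k = f \<cdot> e k)"
    by (rule assms(1)[unfolded coproduct_def, THEN conjunct2, THEN conjunct2, rule_format])
      (use e assms(3-) in simp_all)
  moreover have "f \<in> Hom C y (Cod C f) \<and> (\<forall>k\<in>I. f \<cdot> e k = f \<cdot> e k)" using assms(3,5) by simp
  moreover have "g \<in> Hom C y (Cod C f) \<and> (\<forall>k\<in>I. g \<cdot> e k = f \<cdot> e k)"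
    using assms(4,6,7) by (simp add: assms(2))
  ultimately show ?thesis by blast
qed

context additive_category
begin

lemma ZeroArr_Arr [simp]:
  assumes "a \<in> Obj C" "b \<in> Obj C"
  shows "ZeroArr C a b \<in> Arr C" "Dom C (ZeroArr C a b) = a" "Cod C (ZeroArr C a b) = b"
proof -
  interpret comm_group "Hom_group C a b" using assms by (rule Hom_comm_group)
  show "ZeroArr C a b \<in> Arr C" "Dom C (ZeroArr C a b) = a" "Cod C (ZeroArr C a b) = b"
    using one_closed by (auto simp: Hom_group_def)
qed

lemma Add_Arr [simp]:
  assumes "f \<in> Arr C" "g \<in> Arr C" "Dom C f = Dom C g" "Cod C f = Cod C g"
  shows "f \<boxplus> g \<in> Arr C" "Dom C (f \<boxplus> g) = Dom C g" "Cod C (f \<boxplus> g) = Cod C g"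
proof -
  interpret comm_group "Hom_group C (Dom C g) (Cod C g)" using assms by (intro Hom_comm_group) auto
  show "f \<boxplus> g \<in> Arr C" "Dom C (f \<boxplus> g) = Dom C g" "Cod C (f \<boxplus> g) = Cod C g"
    using m_closed[of f g] assms by (auto simp: Hom_group_def)
qed

lemma Add_comp:
  assumes "f \<in> Arr C" "g \<in> Arr C" "h \<in> Arr C" "Dom C g = Cod C f" "Dom C h = Cod C f" "Cod C g = Cod C h"
  shows "(g \<boxplus> h) \<cdot> f = (g \<cdot> f) \<boxplus> (h \<cdot> f)"
  using assms by (intro Comp_Add_left) auto

lemma comp_Add:
  assumes "f \<in> Arr C" "g \<in> Arr C" "h \<in> Arr C" "Dom C f = Dom C g" "Cod C f = Dom C h" "Cod C g = Dom C h"
  shows "h \<cdot> (f \<boxplus> g) = (h \<cdot> f) \<boxplus> (h \<cdot> g)"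
  using assms by (intro Comp_Add_right) auto

text \<open>Cancellation in the Hom group. An additive map sends the zero morphism to some f with f
  + f = f, so this yields preservation of zero by composition and by additive functors.\<close>

lemma Add_idem_zero:
  assumes "f \<in> Arr C" "f \<boxplus> f = f"
  shows "f = ZeroArr C (Dom C f) (Cod C f)"
proof -
  interpret comm_group "Hom_group C (Dom C f) (Cod C f)" using assms by (intro Hom_comm_group) auto
  show ?thesis using assms l_cancel_one[of f f] by (auto simp: Hom_group_def)
qed

lemma Add_zero [simp]:
  assumes "a \<in> Obj C" "b \<in> Obj C"
  shows "ZeroArr C a b \<boxplus> ZeroArr C a b = ZeroArr C a b"
proof -
  interpret comm_group "Hom_group C a b" using assms by (rule Hom_comm_group)
  show ?thesis using l_one[OF one_closed] by (simp add: Hom_group_def)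
qed

lemma zero_comp [simp]:
  assumes "f \<in> Arr C" "b = Cod C f" "c \<in> Obj C"
  shows "ZeroArr C b c \<cdot> f = ZeroArr C (Dom C f) c"
proof -
  have "ZeroArr C b c \<cdot> f \<boxplus> ZeroArr C b c \<cdot> f = (ZeroArr C b c \<boxplus> ZeroArr C b c) \<cdot> f"
    using assms by (simp only: Add_comp ZeroArr_Arr Cod_Obj)
  then show ?thesis using assms Add_idem_zero[of "ZeroArr C b c \<cdot> f"] by simp
qed

lemma comp_zero [simp]:
  assumes "f \<in> Arr C" "b = Dom C f" "a \<in> Obj C"
  shows "f \<cdot> ZeroArr C a b = ZeroArr C a (Cod C f)"
proof -
  have "f \<cdot> ZeroArr C a b \<boxplus> f \<cdot> ZeroArr C a b = f \<cdot> (ZeroArr C a b \<boxplus> ZeroArr C a b)"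
    using assms by (simp only: comp_Add ZeroArr_Arr Dom_Obj)
  then show ?thesis using assms Add_idem_zero[of "f \<cdot> ZeroArr C a b"] by simp
qed

lemma zero_obj_eq:
  assumes "zero_obj C (Dom C f) \<or> zero_obj C (Cod C f)" "f \<in> Arr C"
  shows "f = ZeroArr C (Dom C f) (Cod C f)"
  using assms(1)
proof
  assume "zero_obj C (Dom C f)"
  then have "f = f \<cdot> ZeroArr C (Dom C f) (Dom C f)" using assms by (metis comp_Ident(2) zero_obj_def)
  then show ?thesis using assms by (metis Dom_Obj comp_zero)
next
  assume "zero_obj C (Cod C f)"
  then have "f = ZeroArr C (Cod C f) (Cod C f) \<cdot> f" using assms by (metis comp_Ident(1) zero_obj_def)
  then show ?thesis using assms by (metis Cod_Obj zero_comp)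
qed

lemma zero_obj_arr_eq:
  assumes "zero_obj C a" "f \<in> Arr C" "g \<in> Arr C" "Dom C f = a" "Dom C g = a" "Cod C f = Cod C g"
  shows "f = g"
  using zero_obj_eq[of f] zero_obj_eq[of g] assms by metis

lemma zero_obj_retract:
  assumes "zero_obj C (Cod C f)" "f \<in> Arr C" "g \<in> Arr C" "Dom C g = Cod C f" "Cod C g = Dom C f"
    "g \<cdot> f = Ident C (Dom C f)"
  shows "zero_obj C (Dom C f)"
proof -
  have "f = ZeroArr C (Dom C f) (Cod C f)" using assms zero_obj_eq by blast
  then have "g \<cdot> ZeroArr C (Dom C f) (Cod C f) = Ident C (Dom C f)" using assms by metis
  then show ?thesis using assms by (simp add: zero_obj_def)
qed

lemma zero_obj_iso: "iso_arr C f \<Longrightarrow> zero_obj C (Dom C f) \<longleftrightarrow> zero_obj C (Cod C f)"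
  using zero_obj_retract[of f "inv_arr C f"] zero_obj_retract[of "inv_arr C f" f] iso_arr_in[of C f]
  by (metis inv_arr_Arr inv_arr_comp(1,2))

lemma hom_sum_empty [simp]:
  assumes "a \<in> Obj C" "b \<in> Obj C"
  shows "finprod (Hom_group C a b) f {} = ZeroArr C a b"
proof -
  interpret comm_group "Hom_group C a b" using assms by (intro Hom_comm_group)
  have "\<one>\<^bsub>Hom_group C a b\<^esub> = ZeroArr C a b" by (simp add: Hom_group_def)
  then show ?thesis by (simp only: finprod_empty)
qed

lemma hom_sum_Arr:
  assumes "a \<in> Obj C" "b \<in> Obj C" "\<And>k. k < n \<Longrightarrow> f k \<in> Hom C a b"
  shows "hom_sum C a b n f \<in> Arr C" "Dom C (hom_sum C a b n f) = a" "Cod C (hom_sum C a b n f) = b"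
proof -
  interpret comm_group "Hom_group C a b" using assms by (intro Hom_comm_group)
  have "hom_sum C a b n f \<in> carrier (Hom_group C a b)"
    using assms by (intro finprod_closed) (auto simp: Hom_group_def)
  then show "hom_sum C a b n f \<in> Arr C" "Dom C (hom_sum C a b n f) = a"
    "Cod C (hom_sum C a b n f) = b" by (auto simp: Hom_group_def)
qed

lemma hom_sum_cong:
  assumes "a \<in> Obj C" "b \<in> Obj C" "\<And>k. k < n \<Longrightarrow> g k \<in> Hom C a b" "\<And>k. k < n \<Longrightarrow> f k = g k"
  shows "hom_sum C a b n f = hom_sum C a b n g"
proof -
  interpret comm_group "Hom_group C a b" using assms by (intro Hom_comm_group)
  show ?thesis by (rule finprod_cong') (use assms in \<open>auto simp: Hom_group_def\<close>)
qed

lemma hom_sum_delta: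
  assumes "a \<in> Obj C" "b \<in> Obj C" "\<And>k. k < n \<Longrightarrow> f k \<in> Hom C a b" "l < n"
    "\<And>k. k < n \<Longrightarrow> k \<noteq> l \<Longrightarrow> f k = ZeroArr C a b"
  shows "hom_sum C a b n f = f l"
proof -
  interpret comm_group "Hom_group C a b" using assms by (intro Hom_comm_group)
  have "hom_sum C a b n f = hom_sum C a b n (\<lambda>k. if l = k then f k else \<one>\<^bsub>Hom_group C a b\<^esub>)"
    by (rule finprod_cong') (use assms in \<open>auto simp: Hom_group_def\<close>)
  also have "\<dots> = f l"
    by (rule finprod_singleton) (use assms in \<open>auto simp: Hom_group_def\<close>)
  finally show ?thesis .
qed

end

lemma (in additive_functor) fmor_zero [simp]:
  assumes "a \<in> Obj C" "b \<in> Obj C"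
  shows "fmor F (ZeroArr C a b) = ZeroArr D (fobj F a) (fobj F b)"
  using fmor_Add[of "ZeroArr C a b" a b "ZeroArr C a b"]
    D.Add_idem_zero[of "fmor F (ZeroArr C a b)"] assms by simp

lemma (in additive_functor) fmor_hom_sum:
  assumes "a \<in> Obj C" "b \<in> Obj C" "\<And>k. k < n \<Longrightarrow> f k \<in> Hom C a b"
  shows "fmor F (hom_sum C a b n f) = hom_sum D (fobj F a) (fobj F b) n (\<lambda>k. fmor F (f k))"
  by (rule hom_finprod) (use assms C.Hom_comm_group D.Hom_comm_group fmor_Add in
    \<open>auto simp: Hom_group_def hom_def\<close>)

text \<open>A biproduct is defined by equations alone, so additive functors preserve it. Tensoring
  with a fixed object and the action of a group element are the instances needed.\<close>

lemma (in additive_functor) fmor_biproduct: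
  assumes "biproduct C n x y i p"
  shows "biproduct D n (\<lambda>k. fobj F (x k)) (fobj F y) (\<lambda>k. fmor F (i k)) (\<lambda>k. fmor F (p k))"
proof -
  note b = assms[unfolded biproduct_def]
  have "hom_sum D (fobj F y) (fobj F y) n (\<lambda>k. fmor F (i k) \<cdot>\<^bsub>D\<^esub> fmor F (p k)) =
    hom_sum D (fobj F y) (fobj F y) n (\<lambda>k. fmor F (i k \<cdot>\<^bsub>C\<^esub> p k))"
    by (rule D.hom_sum_cong) (use b in \<open>auto simp: fmor_comp\<close>)
  also have "\<dots> = fmor F (hom_sum C y y n (\<lambda>k. i k \<cdot>\<^bsub>C\<^esub> p k))"
    by (rule fmor_hom_sum[symmetric]) (use b in auto)
  also have "\<dots> = Ident D (fobj F y)" using b by simp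
  finally show ?thesis using b unfolding biproduct_def by (auto simp flip: fmor_comp)
qed

context additive_category
begin

lemma comp_hom_sum:
  assumes "a \<in> Obj C" "b \<in> Obj C" "\<And>k. k < n \<Longrightarrow> f k \<in> Hom C a b" "h \<in> Arr C" "Dom C h = b"
  shows "h \<cdot> hom_sum C a b n f = hom_sum C a (Cod C h) n (\<lambda>k. h \<cdot> f k)"
  by (rule hom_finprod) (use assms Hom_comm_group in \<open>auto simp: Hom_group_def hom_def comp_Add\<close>)

lemma hom_sum_comp:
  assumes "a \<in> Obj C" "b \<in> Obj C" "\<And>k. k < n \<Longrightarrow> f k \<in> Hom C a b" "h \<in> Arr C" "Cod C h = a"
  shows "hom_sum C a b n f \<cdot> h = hom_sum C (Dom C h) b n (\<lambda>k. f k \<cdot> h)"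
  by (rule hom_finprod) (use assms Hom_comm_group in \<open>auto simp: Hom_group_def hom_def Add_comp\<close>)

text \<open>The induced map is the sum of the \<open>f k \<cdot> p k\<close>. It restricts correctly
  because \<open>p k \<cdot> i l\<close> is a Kronecker delta, and any competitor g equals it after
  composing g with the identity written as the sum of the \<open>i k \<cdot> p k\<close>.\<close>

lemma biproduct_coproduct:
  assumes "biproduct C n x y i p"
  shows "coproduct C {..<n} x y i"
  unfolding coproduct_def
proof (intro conjI ballI allI impI)
  note b = assms[unfolded biproduct_def]
  show "y \<in> Obj C" "\<And>k. k \<in> {..<n} \<Longrightarrow> i k \<in> Hom C (x k) y" using b by auto
  fix c f assume c: "c \<in> Obj C" and "\<forall>k\<in>{..<n}. f k \<in> Hom C (x k) c"
  then have f: "k < n \<Longrightarrow> f k \<in> Arr C \<and> Dom C (f k) = x k \<and> Cod C (f k) = c" for k by auto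
  define h where "h = hom_sum C y c n (\<lambda>k. f k \<cdot> p k)"
  have h: "h \<in> Arr C" "Dom C h = y" "Cod C h = c"
    using hom_sum_Arr[of y c n "\<lambda>k. f k \<cdot> p k"] b c f unfolding h_def by auto
  have hi: "h \<cdot> i l = f l" if l: "l < n" for l
  proof -
    have z: "f k \<cdot> p k \<cdot> i l = (if k = l then f l else ZeroArr C (x l) c)" if "k < n" for k
      using b f[OF that] that l by auto
    have "h \<cdot> i l = hom_sum C (Dom C (i l)) c n (\<lambda>k. (f k \<cdot> p k) \<cdot> i l)"
      unfolding h_def by (rule hom_sum_comp) (use b c f l in auto)
    also have "\<dots> = (f l \<cdot> p l) \<cdot> i l"
      by (rule hom_sum_delta) (use b c f l z in auto)
    finally show ?thesis using z b f l by simp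
  qed
  have uniq: "g = h" if g: "g \<in> Hom C y c" "\<And>k. k < n \<Longrightarrow> g \<cdot> i k = f k" for g
  proof -
    have "g = g \<cdot> hom_sum C y y n (\<lambda>k. i k \<cdot> p k)" using b g by simp
    also have "\<dots> = hom_sum C y (Cod C g) n (\<lambda>k. g \<cdot> i k \<cdot> p k)"
      by (rule comp_hom_sum) (use b g in auto)
    also have "\<dots> = hom_sum C y c n (\<lambda>k. f k \<cdot> p k)"
    proof -
      have "g \<cdot> i k \<cdot> p k = f k \<cdot> p k" if "k < n" for k
        using comp_assoc_eq[OF g(2)[OF that], of "p k"] b g(1) that by auto
      moreover have "Cod C g = c" using g(1) by simp
      ultimately show ?thesis
        using hom_sum_cong[of y c n "\<lambda>k. f k \<cdot> p k" "\<lambda>k. g \<cdot> i k \<cdot> p k"] b c f by simp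
    qed
    finally show ?thesis unfolding h_def .
  qed
  show "\<exists>!h. h \<in> Hom C y c \<and> (\<forall>k\<in>{..<n}. h \<cdot> i k = f k)"
  proof (rule ex1I[of _ h])
    show "h \<in> Hom C y c \<and> (\<forall>k\<in>{..<n}. h \<cdot> i k = f k)" using h hi by simp
  qed (rule uniq, auto)
qed

text \<open>A zero summand imposes no condition on a map, so only the summands in the image of
  \<sigma> matter, and matching these by \<theta> gives an isomorphism. This one construction yields
  \<open>sm\<close>, \<open>su\<close>, \<open>sb\<close> and the essential surjectivity of the
  realization, with \<sigma> recording which summands survive.\<close>

lemma coproduct_matching:
  assumes "coproduct C I x y e" "coproduct C J x' y' e'"
    "\<sigma> ` J \<subseteq> I" "inj_on \<sigma> J" "\<And>k. k \<in> I - \<sigma> ` J \<Longrightarrow> zero_obj C (x k)"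
    "\<And>j. j \<in> J \<Longrightarrow> iso_arr C (\<theta> j) \<and> Dom C (\<theta> j) = x (\<sigma> j) \<and> Cod C (\<theta> j) = x' j"
  obtains f where "iso_arr C f" "Dom C f = y" "Cod C f = y'"
    "\<And>j. j \<in> J \<Longrightarrow> f \<cdot> e (\<sigma> j) = e' j \<cdot> \<theta> j"
proof -
  have th: "\<theta> j \<in> Arr C" if "j \<in> J" for j using assms(6)[OF that] by (simp add: iso_arr_in)
  note e = coproductD[OF assms(1)] and e' = coproductD[OF assms(2)]
  \<comment> \<open>The prescribed restrictions of f: through \<theta> on matched summands, and zero
    on the others, where nothing else is possible.\<close>
  define u where "u k = (if k \<in> \<sigma> ` J then e' (inv_into J \<sigma> k) \<cdot> \<theta> (inv_into J \<sigma> k)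
    else ZeroArr C (x k) y')" for k
  have u\<sigma>: "u (\<sigma> j) = e' j \<cdot> \<theta> j" if "j \<in> J" for j
    using that assms(4) by (simp add: u_def)
  have "u k \<in> Hom C (x k) y'" if "k \<in> I" for k
  proof (cases "k \<in> \<sigma> ` J")
    case True
    then obtain j where "j \<in> J" "k = \<sigma> j" by auto
    then show ?thesis using u\<sigma>[of j] assms(6)[of j] th e' by simp
  next
    case False
    have "x k \<in> Obj C" using e that Dom_Obj by metis
    then show ?thesis using False e' by (simp add: u_def)
  qed
  then obtain f where f: "f \<in> Arr C" "Dom C f = y" "Cod C f = y'" "\<And>k. k \<in> I \<Longrightarrow> f \<cdot> e k = u k"
    using coproduct_ex[OF assms(1), of y' u] e' by auto
  have fe: "f \<cdot> e (\<sigma> j) = e' j \<cdot> \<theta> j" if "j \<in> J" for j using f(4) u\<sigma> that assms(3) by auto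
  have *: "e (\<sigma> j) \<cdot> inv_arr C (\<theta> j) \<in> Hom C (x' j) y" if "j \<in> J" for j
    using assms(3,6) that e by auto
  obtain g where g: "g \<in> Arr C" "Dom C g = y'" "Cod C g = y"
    "\<And>j. j \<in> J \<Longrightarrow> g \<cdot> e' j = e (\<sigma> j) \<cdot> inv_arr C (\<theta> j)"
    using coproduct_ex[OF assms(2), of y "\<lambda>j. e (\<sigma> j) \<cdot> inv_arr C (\<theta> j)"] * e by auto
  have gfe: "(g \<cdot> f) \<cdot> e (\<sigma> j) = e (\<sigma> j)" if j: "j \<in> J" for j
  proof -
    have s: "\<sigma> j \<in> I" using j assms(3) by auto
    have "(g \<cdot> f) \<cdot> e (\<sigma> j) = g \<cdot> e' j \<cdot> \<theta> j" using f g e s fe[OF j] by simp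
    also have "\<dots> = (e (\<sigma> j) \<cdot> inv_arr C (\<theta> j)) \<cdot> \<theta> j"
      using comp_assoc_eq[OF g(4)[OF j], of "\<theta> j"] g e' assms(6)[OF j] th j by simp
    also have "\<dots> = e (\<sigma> j)" using e s assms(6)[OF j] th j by simp
    finally show ?thesis .
  qed
  have "g \<cdot> f = Ident C y"
  proof (rule coproduct_eqI[OF assms(1)])
    fix k assume k: "k \<in> I"
    show "(g \<cdot> f) \<cdot> e k = Ident C y \<cdot> e k"
    proof (cases "k \<in> \<sigma> ` J")
      case True
      then show ?thesis using gfe e k by auto
    next
      case False
      then have "zero_obj C (x k)" using assms(5) k by auto
      then show ?thesis by (rule zero_obj_arr_eq) (use f(1-3) g(1-3) e k in auto)
    qed
  qed (use f(1-3) g(1-3) e in auto)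
  moreover have "f \<cdot> g = Ident C y'"
  proof (rule coproduct_eqI[OF assms(2)])
    fix j assume j: "j \<in> J"
    have s: "\<sigma> j \<in> I" using j assms(3) by auto
    have "(f \<cdot> g) \<cdot> e' j = f \<cdot> e (\<sigma> j) \<cdot> inv_arr C (\<theta> j)" using f g e' j by simp
    also have "\<dots> = (e' j \<cdot> \<theta> j) \<cdot> inv_arr C (\<theta> j)"
      using comp_assoc_eq[OF fe[OF j], of "inv_arr C (\<theta> j)"] f e s e' assms(6)[OF j] th j by simp
    also have "\<dots> = e' j" using e' assms(6)[OF j] th j by simp
    finally show "(f \<cdot> g) \<cdot> e' j = Ident C y' \<cdot> e' j" using e' j by simp
  qed (use f(1-3) g(1-3) e' in auto)
  ultimately have "iso_arr C f" by (intro iso_arrI[of _ _ g]) (use f(1-3) g(1-3) in auto)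
  then show thesis using that f fe by blast
qed

lemma biproduct_iso:
  assumes "biproduct C n x y i p" "iso_arr C f" "Dom C f = y" "Cod C f = y'"
    "\<And>k. k < n \<Longrightarrow> iso_arr C (\<theta> k) \<and> Dom C (\<theta> k) = x' k \<and> Cod C (\<theta> k) = x k"
  shows "biproduct C n x' y' (\<lambda>k. f \<cdot> i k \<cdot> \<theta> k) (\<lambda>k. inv_arr C (\<theta> k) \<cdot> p k \<cdot> inv_arr C f)"
proof -
  note b = assms(1)[unfolded biproduct_def]
  have f: "f \<in> Arr C" and th: "k < n \<Longrightarrow> \<theta> k \<in> Arr C" for k
    using assms(2,5) by (auto simp: iso_arr_in)
  have pi: "p k \<cdot> i l = (if k = l then Ident C (x k) else ZeroArr C (x l) (x k))"
    if "k < n" "l < n" for k l using b that by blast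
  have pi': "p k \<cdot> i l \<cdot> \<theta> l = (if k = l then \<theta> k else ZeroArr C (x' l) (x k))"
    if "k < n" "l < n" for k l
    using comp_assoc_eq[OF pi[OF that], of "\<theta> l"] b assms(5) th that by auto
  have "hom_sum C y' y' n (\<lambda>k. (f \<cdot> i k \<cdot> \<theta> k) \<cdot> (inv_arr C (\<theta> k) \<cdot> p k \<cdot> inv_arr C f))
      = hom_sum C y' y' n (\<lambda>k. f \<cdot> (i k \<cdot> p k) \<cdot> inv_arr C f)"
    by (rule hom_sum_cong) (use b assms f th in auto)
  also have "\<dots> = f \<cdot> hom_sum C y' y n (\<lambda>k. (i k \<cdot> p k) \<cdot> inv_arr C f)"
    using comp_hom_sum[of y' y n "\<lambda>k. (i k \<cdot> p k) \<cdot> inv_arr C f" f] b assms f by auto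
  also have "hom_sum C y' y n (\<lambda>k. (i k \<cdot> p k) \<cdot> inv_arr C f) = 
      hom_sum C y y n (\<lambda>k. (i k \<cdot> p k)) \<cdot> inv_arr C f"
    using hom_sum_comp[of y y n "\<lambda>k. i k \<cdot> p k" "inv_arr C f"] b assms f by auto
  finally have "hom_sum C y' y' n (\<lambda>k. (f \<cdot> i k \<cdot> \<theta> k) \<cdot> (inv_arr C (\<theta> k) \<cdot> p k \<cdot> inv_arr C f))
    = Ident C y'" using b assms f by simp
  moreover have "x' k \<in> Obj C" if "k < n" for k using assms(5)[OF that] th[OF that] Dom_Obj by metis
  ultimately show ?thesis using b assms f th pi' unfolding biproduct_def by auto
qed

lemma direct_sum_iso:
  assumes "direct_sum C n x y" "iso_arr C f" "Dom C f = y" "Cod C f = y'"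
    "\<And>k. k < n \<Longrightarrow> \<exists>\<theta>. iso_arr C \<theta> \<and> Dom C \<theta> = x' k \<and> Cod C \<theta> = x k"
  shows "direct_sum C n x' y'"
proof -
  obtain \<theta> where "\<And>k. k < n \<Longrightarrow> iso_arr C (\<theta> k) \<and> Dom C (\<theta> k) = x' k \<and> Cod C (\<theta> k) = x k"
    using assms(5) by metis
  with assms(1-4) show ?thesis unfolding direct_sum_iff using biproduct_iso by blast
qed

lemma direct_sum_unique:
  assumes "direct_sum C n x y" "direct_sum C n x y'"
  obtains f where "iso_arr C f" "Dom C f = y" "Cod C f = y'"
proof -
  obtain i p i' p' where b: "biproduct C n x y i p" "biproduct C n x y' i' p'"
    using assms unfolding direct_sum_iff by auto
  have "\<And>k. k < n \<Longrightarrow> x k \<in> Obj C" using b(1) by (simp add: biproduct_def)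
  then show thesis
    using coproduct_matching[OF biproduct_coproduct[OF b(1)] biproduct_coproduct[OF b(2)],
      of "\<lambda>k. k" "\<lambda>k. Ident C (x k)"] that by auto
qed

end

section \<open>Monoidal categories\<close>

context additive_monoidal_category
begin

lemma tensor_Obj [simp]: "a \<in> Obj C \<Longrightarrow> b \<in> Obj C \<Longrightarrow> a \<boxtimes> b \<in> Obj C"
  by (rule TObj_in)

lemma tensor_Arr [simp]:
  assumes "f \<in> Arr C" "k \<in> Arr C"
  shows "f \<boxtimes>\<^sub>m k \<in> Arr C" "Dom C (f \<boxtimes>\<^sub>m k) = Dom C f \<boxtimes> Dom C k"
    "Cod C (f \<boxtimes>\<^sub>m k) = Cod C f \<boxtimes> Cod C k"
  using TArr_in[of f "Dom C f" "Cod C f" k "Dom C k" "Cod C k"] assms by auto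

lemma tensor_Ident [simp]:
  "a \<in> Obj C \<Longrightarrow> b \<in> Obj C \<Longrightarrow> Ident C a \<boxtimes>\<^sub>m Ident C b = Ident C (a \<boxtimes> b)"
  by (rule TArr_Ident)

lemma tensor_comp:
  assumes "f \<in> Arr C" "g \<in> Arr C" "f' \<in> Arr C" "g' \<in> Arr C" "Cod C f = Dom C g" "Cod C f' = Dom C g'"
  shows "(g \<boxtimes>\<^sub>m g') \<cdot> (f \<boxtimes>\<^sub>m f') = (g \<cdot> f) \<boxtimes>\<^sub>m (g' \<cdot> f')"
    "k \<in> Arr C \<Longrightarrow> Cod C k = Dom C f \<boxtimes> Dom C f' \<Longrightarrow>
      (g \<boxtimes>\<^sub>m g') \<cdot> (f \<boxtimes>\<^sub>m f') \<cdot> k = ((g \<cdot> f) \<boxtimes>\<^sub>m (g' \<cdot> f')) \<cdot> k"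
proof -
  show *: "(g \<boxtimes>\<^sub>m g') \<cdot> (f \<boxtimes>\<^sub>m f') = (g \<cdot> f) \<boxtimes>\<^sub>m (g' \<cdot> f')"
    using TArr_Comp[of f "Dom C f" "Dom C g" g "Cod C g" f' "Dom C f'" "Dom C g'" g' "Cod C g'"] assms
    by simp
  show "k \<in> Arr C \<Longrightarrow> Cod C k = Dom C f \<boxtimes> Dom C f' \<Longrightarrow>
      (g \<boxtimes>\<^sub>m g') \<cdot> (f \<boxtimes>\<^sub>m f') \<cdot> k = ((g \<cdot> f) \<boxtimes>\<^sub>m (g' \<cdot> f')) \<cdot> k"
    by (rule comp_assoc_eq[OF *]) (use assms in auto)
qed

lemma tensor_Add:
  assumes "f \<in> Arr C" "g \<in> Arr C" "k \<in> Arr C" "Dom C f = Dom C g" "Cod C f = Cod C g"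
  shows "(f \<boxplus> g) \<boxtimes>\<^sub>m k = (f \<boxtimes>\<^sub>m k) \<boxplus> (g \<boxtimes>\<^sub>m k)" "k \<boxtimes>\<^sub>m (f \<boxplus> g) = (k \<boxtimes>\<^sub>m f) \<boxplus> (k \<boxtimes>\<^sub>m g)"
  using assms by (auto intro: TArr_Add_left TArr_Add_right)

lemma tensor_iso [simp]:
  assumes "iso_arr C f" "iso_arr C g"
  shows "iso_arr C (f \<boxtimes>\<^sub>m g)"
proof -
  have "f \<in> Arr C" "g \<in> Arr C" using assms by (auto dest: iso_arr_in)
  then show ?thesis
    by (intro iso_arrI[of _ _ "inv_arr C f \<boxtimes>\<^sub>m inv_arr C g"]) (use assms in \<open>auto simp: tensor_comp\<close>)
qed

lemma unit_Obj [simp]: "UnitObj C \<in> Obj C"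
  by (rule UnitObj_in)

lemma Assoc_Arr [simp]:
  assumes "a \<in> Obj C" "b \<in> Obj C" "c \<in> Obj C"
  shows "iso_arr C (Assoc C a b c)" "Assoc C a b c \<in> Arr C"
    "Dom C (Assoc C a b c) = (a \<boxtimes> b) \<boxtimes> c" "Cod C (Assoc C a b c) = a \<boxtimes> (b \<boxtimes> c)"
  using Assoc_iso[OF assms] by (auto simp: Isos_iff iso_arr_in)

lemma LUnit_Arr [simp]:
  assumes "a \<in> Obj C"
  shows "iso_arr C (LUnit C a)" "LUnit C a \<in> Arr C"
    "Dom C (LUnit C a) = UnitObj C \<boxtimes> a" "Cod C (LUnit C a) = a"
  using LUnit_iso[OF assms] by (auto simp: Isos_iff iso_arr_in)

lemma RUnit_Arr [simp]:
  assumes "a \<in> Obj C"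
  shows "iso_arr C (RUnit C a)" "RUnit C a \<in> Arr C"
    "Dom C (RUnit C a) = a \<boxtimes> UnitObj C" "Cod C (RUnit C a) = a"
  using RUnit_iso[OF assms] by (auto simp: Isos_iff iso_arr_in)

lemma assoc_nat:
  assumes "f \<in> Arr C" "g \<in> Arr C" "h \<in> Arr C" "Cod C f = a'" "Cod C g = b'" "Cod C h = c'"
  shows "Assoc C a' b' c' \<cdot> ((f \<boxtimes>\<^sub>m g) \<boxtimes>\<^sub>m h) =
    (f \<boxtimes>\<^sub>m (g \<boxtimes>\<^sub>m h)) \<cdot> Assoc C (Dom C f) (Dom C g) (Dom C h)"
  using Assoc_natural[of f "Dom C f" a' g "Dom C g" b' h "Dom C h" c'] assms by simp

lemma LUnit_nat:
  assumes "f \<in> Arr C" "Cod C f = b"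
  shows "LUnit C b \<cdot> (Ident C (UnitObj C) \<boxtimes>\<^sub>m f) = f \<cdot> LUnit C (Dom C f)"
  using LUnit_natural[of f "Dom C f" b] assms by simp

lemma RUnit_nat:
  assumes "f \<in> Arr C" "Cod C f = b"
  shows "RUnit C b \<cdot> (f \<boxtimes>\<^sub>m Ident C (UnitObj C)) = f \<cdot> RUnit C (Dom C f)"
  using RUnit_natural[of f "Dom C f" b] assms by simp

text \<open>Naturality of the left unitor makes tensoring with the unit conjugate to the identity
  functor, hence faithful.\<close>

lemma unit_tensor_cancel:
  assumes "Ident C (UnitObj C) \<boxtimes>\<^sub>m f = Ident C (UnitObj C) \<boxtimes>\<^sub>m g"
    "f \<in> Arr C" "g \<in> Arr C" "Dom C f = Dom C g" "Cod C f = Cod C g"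
  shows "f = g"
proof -
  have "f \<cdot> LUnit C (Dom C f) = g \<cdot> LUnit C (Dom C f)"
    using LUnit_nat[of f "Cod C f"] LUnit_nat[of g "Cod C f"] assms by simp
  then show ?thesis by (rule iso_cancel_right) (use assms in auto)
qed

lemma tensor_unit_cancel:
  assumes "f \<boxtimes>\<^sub>m Ident C (UnitObj C) = g \<boxtimes>\<^sub>m Ident C (UnitObj C)"
    "f \<in> Arr C" "g \<in> Arr C" "Dom C f = Dom C g" "Cod C f = Cod C g"
  shows "f = g"
proof -
  have "f \<cdot> RUnit C (Dom C f) = g \<cdot> RUnit C (Dom C f)"
    using RUnit_nat[of f "Cod C f"] RUnit_nat[of g "Cod C f"] assms by simp
  then show ?thesis by (rule iso_cancel_right) (use assms in auto)
qed

text \<open>Kelly's argument: the axioms contain only the triangle with the unit in the middle.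
  After tensoring with the unit on the left, the pentagon and two triangles give the claim, and the
  extra unit is cancelled.\<close>

lemma LUnit_tensor:
  assumes [simp]: "a \<in> Obj C" "b \<in> Obj C"
  shows "LUnit C (a \<boxtimes> b) \<cdot> Assoc C (UnitObj C) a b = LUnit C a \<boxtimes>\<^sub>m Ident C b"
proof (rule unit_tensor_cancel)
  let ?I = "UnitObj C"
  let ?i = "Ident C ?I"
  \<comment> \<open>Two of the three factors on the long side of the pentagon; being invertible,
    they can be cancelled at the end.\<close>
  let ?r = "Assoc C ?I (?I \<boxtimes> a) b \<cdot> (Assoc C ?I ?I a \<boxtimes>\<^sub>m Ident C b)"
  have "(?i \<boxtimes>\<^sub>m (LUnit C (a \<boxtimes> b) \<cdot> Assoc C ?I a b)) \<cdot> ?r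
      = (?i \<boxtimes>\<^sub>m LUnit C (a \<boxtimes> b)) \<cdot> ((?i \<boxtimes>\<^sub>m Assoc C ?I a b) \<cdot> ?r)"
    by (simp add: tensor_comp)
  also have "\<dots> = (?i \<boxtimes>\<^sub>m LUnit C (a \<boxtimes> b)) \<cdot> Assoc C ?I ?I (a \<boxtimes> b) \<cdot> Assoc C (?I \<boxtimes> ?I) a b"
    by (simp add: pentagon)
  also have "\<dots> = (RUnit C ?I \<boxtimes>\<^sub>m Ident C (a \<boxtimes> b)) \<cdot> Assoc C (?I \<boxtimes> ?I) a b"
    by (rule comp_assoc_eq[OF triangle]) auto
  also have "\<dots> = Assoc C ?I a b \<cdot> ((RUnit C ?I \<boxtimes>\<^sub>m Ident C a) \<boxtimes>\<^sub>m Ident C b)"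
    by (simp add: assoc_nat)
  also have "\<dots> = Assoc C ?I a b \<cdot> (((?i \<boxtimes>\<^sub>m LUnit C a) \<cdot> Assoc C ?I ?I a) \<boxtimes>\<^sub>m Ident C b)"
    by (simp add: triangle)
  also have "\<dots> = Assoc C ?I a b \<cdot> ((?i \<boxtimes>\<^sub>m LUnit C a) \<boxtimes>\<^sub>m Ident C b) \<cdot> (Assoc C ?I ?I a \<boxtimes>\<^sub>m Ident C b)"
    by (simp add: tensor_comp)
  also have "\<dots> = ((?i \<boxtimes>\<^sub>m (LUnit C a \<boxtimes>\<^sub>m Ident C b)) \<cdot> Assoc C ?I (?I \<boxtimes> a) b)
      \<cdot> (Assoc C ?I ?I a \<boxtimes>\<^sub>m Ident C b)"
    by (subst comp_assoc_eq[OF assoc_nat]) auto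
  also have "\<dots> = (?i \<boxtimes>\<^sub>m (LUnit C a \<boxtimes>\<^sub>m Ident C b)) \<cdot> ?r" by simp
  finally show "?i \<boxtimes>\<^sub>m (LUnit C (a \<boxtimes> b) \<cdot> Assoc C ?I a b) = ?i \<boxtimes>\<^sub>m (LUnit C a \<boxtimes>\<^sub>m Ident C b)"
    by (rule iso_cancel_right) auto
qed auto

text \<open>The mirror image of \<open>LUnit_tensor\<close>: an extra unit on the right, the
  pentagon, two triangles, and cancellation.\<close>

lemma RUnit_tensor:
  assumes [simp]: "a \<in> Obj C" "b \<in> Obj C"
  shows "(Ident C a \<boxtimes>\<^sub>m RUnit C b) \<cdot> Assoc C a b (UnitObj C) = RUnit C (a \<boxtimes> b)"
proof (rule tensor_unit_cancel)
  let ?I = "UnitObj C"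
  let ?i = "Ident C ?I"
  have "Assoc C a b ?I \<cdot> (((Ident C a \<boxtimes>\<^sub>m RUnit C b) \<cdot> Assoc C a b ?I) \<boxtimes>\<^sub>m ?i)
      = Assoc C a b ?I \<cdot> ((Ident C a \<boxtimes>\<^sub>m RUnit C b) \<boxtimes>\<^sub>m ?i) \<cdot> (Assoc C a b ?I \<boxtimes>\<^sub>m ?i)"
    by (simp add: tensor_comp)
  also have "\<dots> = ((Ident C a \<boxtimes>\<^sub>m (RUnit C b \<boxtimes>\<^sub>m ?i)) \<cdot> Assoc C a (b \<boxtimes> ?I) ?I)
       \<cdot> (Assoc C a b ?I \<boxtimes>\<^sub>m ?i)"
    by (subst comp_assoc_eq[OF assoc_nat]) auto
  also have "\<dots> = (Ident C a \<boxtimes>\<^sub>m ((Ident C b \<boxtimes>\<^sub>m LUnit C ?I) \<cdot> Assoc C b ?I ?I))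
      \<cdot> Assoc C a (b \<boxtimes> ?I) ?I \<cdot> (Assoc C a b ?I \<boxtimes>\<^sub>m ?i)"
    by (simp add: triangle)
  also have "\<dots> = (Ident C a \<boxtimes>\<^sub>m (Ident C b \<boxtimes>\<^sub>m LUnit C ?I)) \<cdot> (Ident C a \<boxtimes>\<^sub>m Assoc C b ?I ?I)
      \<cdot> Assoc C a (b \<boxtimes> ?I) ?I \<cdot> (Assoc C a b ?I \<boxtimes>\<^sub>m ?i)"
    by (simp add: tensor_comp)
  also have "\<dots> = (Ident C a \<boxtimes>\<^sub>m (Ident C b \<boxtimes>\<^sub>m LUnit C ?I)) \<cdot> Assoc C a b (?I \<boxtimes> ?I)
      \<cdot> Assoc C (a \<boxtimes> b) ?I ?I"
    by (simp add: pentagon)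
  also have "\<dots> = (Assoc C a b ?I \<cdot> (Ident C (a \<boxtimes> b) \<boxtimes>\<^sub>m LUnit C ?I)) \<cdot> Assoc C (a \<boxtimes> b) ?I ?I"
    using assoc_nat[of "Ident C a" "Ident C b" "LUnit C ?I" a b ?I] by simp
  also have "\<dots> = Assoc C a b ?I \<cdot> (RUnit C (a \<boxtimes> b) \<boxtimes>\<^sub>m ?i)"
    by (simp add: triangle)
  finally show "((Ident C a \<boxtimes>\<^sub>m RUnit C b) \<cdot> Assoc C a b ?I) \<boxtimes>\<^sub>m ?i = RUnit C (a \<boxtimes> b) \<boxtimes>\<^sub>m ?i"
    by (rule iso_cancel_left) auto
qed auto

lemma LUnit_eq_RUnit_unit: "LUnit C (UnitObj C) = RUnit C (UnitObj C)"
proof (rule tensor_unit_cancel)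
  let ?I = "UnitObj C"
  \<comment> \<open>Naturality of the left unitor at itself, with the outer unitor
    cancelled.\<close>
  have l: "Ident C ?I \<boxtimes>\<^sub>m LUnit C ?I = LUnit C (?I \<boxtimes> ?I)"
    by (rule iso_cancel_left[of "LUnit C ?I"]) (use LUnit_nat[of "LUnit C ?I" ?I] in auto)
  have "LUnit C ?I \<boxtimes>\<^sub>m Ident C ?I = LUnit C (?I \<boxtimes> ?I) \<cdot> Assoc C ?I ?I ?I"
    by (simp add: LUnit_tensor)
  also have "\<dots> = RUnit C ?I \<boxtimes>\<^sub>m Ident C ?I" by (simp add: triangle flip: l)
  finally show "LUnit C ?I \<boxtimes>\<^sub>m Ident C ?I = RUnit C ?I \<boxtimes>\<^sub>m Ident C ?I" .
qed auto

lemma tensor_functor_left: 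
  assumes "z \<in> Obj C"
  shows "additive_functor C C \<lparr>fobj = \<lambda>a. a \<boxtimes> z, fmor = \<lambda>f. f \<boxtimes>\<^sub>m Ident C z\<rparr>"
  by unfold_locales (use assms in \<open>auto simp: tensor_comp tensor_Add\<close>)

lemma tensor_functor_right: 
  assumes "z \<in> Obj C"
  shows "additive_functor C C \<lparr>fobj = \<lambda>a. z \<boxtimes> a, fmor = \<lambda>f. Ident C z \<boxtimes>\<^sub>m f\<rparr>"
  by unfold_locales (use assms in \<open>auto simp: tensor_comp tensor_Add\<close>)

lemma biproduct_tensor_left:
  assumes "biproduct C n x y i p" "z \<in> Obj C"
  shows "biproduct C n (\<lambda>k. x k \<boxtimes> z) (y \<boxtimes> z) (\<lambda>k. i k \<boxtimes>\<^sub>m Ident C z) (\<lambda>k. p k \<boxtimes>\<^sub>m Ident C z)"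
  using additive_functor.fmor_biproduct[OF tensor_functor_left assms(1), OF assms(2)] by simp

lemma biproduct_tensor_right:
  assumes "biproduct C n x y i p" "z \<in> Obj C"
  shows "biproduct C n (\<lambda>k. z \<boxtimes> x k) (z \<boxtimes> y) (\<lambda>k. Ident C z \<boxtimes>\<^sub>m i k) (\<lambda>k. Ident C z \<boxtimes>\<^sub>m p k)"
  using additive_functor.fmor_biproduct[OF tensor_functor_right assms(1), OF assms(2)] by simp

lemma zero_obj_tensor:
  assumes "zero_obj C a \<or> zero_obj C b" "a \<in> Obj C" "b \<in> Obj C"
  shows "zero_obj C (a \<boxtimes> b)"
proof -
  interpret l: additive_functor C C "\<lparr>fobj = \<lambda>a. a \<boxtimes> b, fmor = \<lambda>f. f \<boxtimes>\<^sub>m Ident C b\<rparr>"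
    using assms by (intro tensor_functor_left)
  interpret r: additive_functor C C "\<lparr>fobj = \<lambda>b. a \<boxtimes> b, fmor = \<lambda>f. Ident C a \<boxtimes>\<^sub>m f\<rparr>"
    using assms by (intro tensor_functor_right)
  have "Ident C (a \<boxtimes> b) = ZeroArr C a a \<boxtimes>\<^sub>m Ident C b \<or> Ident C (a \<boxtimes> b) = Ident C a \<boxtimes>\<^sub>m ZeroArr C b b"
    using assms by (metis tensor_Ident zero_obj_def)
  then show ?thesis using l.fmor_zero[of a a] r.fmor_zero[of b b] assms by (auto simp: zero_obj_def)
qed

text \<open>Tensoring with a fixed object preserves biproducts, so a family over pairs is extended
  in two stages: over k with j fixed (\<open>c2\<close>), then over j (\<open>c1\<close>).
  Uniqueness is checked in the same two stages.\<close>

lemma coproduct_tensor: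
  assumes b: "biproduct C n x y i p" and b': "biproduct C n' x' y' i' p'"
  shows "coproduct C ({..<n} \<times> {..<n'}) (\<lambda>(j, k). x j \<boxtimes> x' k) (y \<boxtimes> y') (\<lambda>(j, k). i j \<boxtimes>\<^sub>m i' k)"
proof -
  note bb = b[unfolded biproduct_def] and bb' = b'[unfolded biproduct_def]
  have i: "i j \<in> Arr C" "Dom C (i j) = x j" "Cod C (i j) = y" "x j \<in> Obj C" if "j < n" for j
    using bb that by auto
  have i': "i' j \<in> Arr C" "Dom C (i' j) = x' j" "Cod C (i' j) = y'" "x' j \<in> Obj C" if "j < n'" for j
    using bb' that by auto
  have y: "y \<in> Obj C" "y' \<in> Obj C" using bb bb' by auto
  have c1: "coproduct C {..<n} (\<lambda>k. x k \<boxtimes> y') (y \<boxtimes> y') (\<lambda>k. i k \<boxtimes>\<^sub>m Ident C y')"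
    using biproduct_coproduct[OF biproduct_tensor_left[OF b y(2)]] .
  have c2: "coproduct C {..<n'} (\<lambda>k. x j \<boxtimes> x' k) (x j \<boxtimes> y') (\<lambda>k. Ident C (x j) \<boxtimes>\<^sub>m i' k)"
    if "j < n" for j
    using biproduct_coproduct[OF biproduct_tensor_right[OF b' i(4)[OF that]]] .
  have ii: "(h \<cdot> (i j \<boxtimes>\<^sub>m Ident C y')) \<cdot> (Ident C (x j) \<boxtimes>\<^sub>m i' k) = h \<cdot> (i j \<boxtimes>\<^sub>m i' k)"
    if "j < n" "k < n'" "h \<in> Arr C" "Dom C h = y \<boxtimes> y'" for j k h
    using i[OF that(1)] i'[OF that(2)] that y by (simp add: tensor_comp)
  show ?thesis unfolding coproduct_def
  proof (intro conjI ballI allI impI)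
    show "y \<boxtimes> y' \<in> Obj C" using y by simp
    show "(case k of (j, k) \<Rightarrow> i j \<boxtimes>\<^sub>m i' k) \<in> Hom C (case k of (j, k) \<Rightarrow> x j \<boxtimes> x' k) (y \<boxtimes> y')"
      if "k \<in> {..<n} \<times> {..<n'}" for k using that i i' by auto
    fix c f
    assume c: "c \<in> Obj C" and
      f: "\<forall>k\<in>{..<n} \<times> {..<n'}. f k \<in> Hom C (case k of (j, k) \<Rightarrow> x j \<boxtimes> x' k) c"
    \<comment> \<open>First stage: for each j, the family over k is glued to a map on the product of
      x j with the whole of y'.\<close>
    have "\<exists>h. h \<in> Hom C (x j \<boxtimes> y') c \<and> (\<forall>k<n'. h \<cdot> (Ident C (x j) \<boxtimes>\<^sub>m i' k) = f (j, k))" if "j < n" for j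
    proof -
      have "\<forall>k<n'. f (j, k) \<in> Hom C (x j \<boxtimes> x' k) c" using f that by auto
      then show ?thesis using coproduct_ex[OF c2[OF that] c, of "\<lambda>k. f (j, k)"] by auto
    qed
    then obtain u where u: "\<And>j. j < n \<Longrightarrow> u j \<in> Hom C (x j \<boxtimes> y') c"
      "\<And>j k. j < n \<Longrightarrow> k < n' \<Longrightarrow> u j \<cdot> (Ident C (x j) \<boxtimes>\<^sub>m i' k) = f (j, k)"
      by metis
    then obtain h where h: "h \<in> Arr C" "Dom C h = y \<boxtimes> y'" "Cod C h = c"
      "\<And>j. j < n \<Longrightarrow> h \<cdot> (i j \<boxtimes>\<^sub>m Ident C y') = u j"
      using coproduct_ex[OF c1 c, of u] by (metis lessThan_iff)
    show "\<exists>!h. h \<in> Hom C (y \<boxtimes> y') c \<and>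
      (\<forall>k\<in>{..<n} \<times> {..<n'}. h \<cdot> (case k of (j, k) \<Rightarrow> i j \<boxtimes>\<^sub>m i' k) = f k)"
    proof (rule ex1I[of _ h])
      have "h \<cdot> (i j \<boxtimes>\<^sub>m i' k) = f (j, k)" if "j < n" "k < n'" for j k
        using ii[OF that h(1,2)] h(4) u(2) that by simp
      then show "h \<in> Hom C (y \<boxtimes> y') c \<and>
        (\<forall>k\<in>{..<n} \<times> {..<n'}. h \<cdot> (case k of (j, k) \<Rightarrow> i j \<boxtimes>\<^sub>m i' k) = f k)"
        using h(1-3) by auto
      fix g assume "g \<in> Hom C (y \<boxtimes> y') c \<and>
        (\<forall>k\<in>{..<n} \<times> {..<n'}. g \<cdot> (case k of (j, k) \<Rightarrow> i j \<boxtimes>\<^sub>m i' k) = f k)"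
      then have g: "g \<in> Arr C" "Dom C g = y \<boxtimes> y'" "Cod C g = c"
        "\<And>j k. j < n \<Longrightarrow> k < n' \<Longrightarrow> g \<cdot> (i j \<boxtimes>\<^sub>m i' k) = f (j, k)" by auto
      show "g = h"
      proof (rule coproduct_eqI[OF c1])
        fix j assume j: "j \<in> {..<n}"
        show "g \<cdot> (i j \<boxtimes>\<^sub>m Ident C y') = h \<cdot> (i j \<boxtimes>\<^sub>m Ident C y')"
        proof (rule coproduct_eqI[OF c2])
          fix k assume k: "k \<in> {..<n'}"
          show "(g \<cdot> (i j \<boxtimes>\<^sub>m Ident C y')) \<cdot> (Ident C (x j) \<boxtimes>\<^sub>m i' k) =
            (h \<cdot> (i j \<boxtimes>\<^sub>m Ident C y')) \<cdot> (Ident C (x j) \<boxtimes>\<^sub>m i' k)"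
            using ii[of j k g] g ii[of j k h] h(1-3) j k \<open>\<And>j k. j < n \<Longrightarrow> k < n' \<Longrightarrow> h \<cdot> (i j \<boxtimes>\<^sub>m i' k) = f (j, k)\<close>
            by simp
        qed (use j i g(1-3) h(1-3) y in auto)
      qed (use g(1-3) h(1-3) in auto)
    qed
  qed
qed

text \<open>The triple product is split along its first factor, and then
  \<open>coproduct_tensor\<close> handles the other two. Serves the associativity coherence of
  \<open>sm\<close>.\<close>

lemma tensor3_eqI:
  assumes b: "biproduct C n x y i p" and b': "biproduct C n' x' y' i' p'"
    and b'': "biproduct C n'' x'' y'' i'' p''"
    and f: "f \<in> Arr C" "Dom C f = (y \<boxtimes> y') \<boxtimes> y''"
    and g: "g \<in> Arr C" "Dom C g = (y \<boxtimes> y') \<boxtimes> y''" "Cod C g = Cod C f"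
    and eq: "\<And>j k l. j < n \<Longrightarrow> k < n' \<Longrightarrow> l < n'' \<Longrightarrow>
      f \<cdot> ((i j \<boxtimes>\<^sub>m i' k) \<boxtimes>\<^sub>m i'' l) = g \<cdot> ((i j \<boxtimes>\<^sub>m i' k) \<boxtimes>\<^sub>m i'' l)"
  shows "f = g"
proof -
  note bb = b[unfolded biproduct_def] and bb' = b'[unfolded biproduct_def]
    and bb'' = b''[unfolded biproduct_def]
  have i: "i j \<in> Arr C" "Dom C (i j) = x j" "Cod C (i j) = y" "x j \<in> Obj C" if "j < n" for j
    using bb that by auto
  have i': "i' j \<in> Arr C" "Dom C (i' j) = x' j" "Cod C (i' j) = y'" "x' j \<in> Obj C" if "j < n'" for j
    using bb' that by auto
  have i'': "i'' j \<in> Arr C" "Dom C (i'' j) = x'' j" "Cod C (i'' j) = y''" "x'' j \<in> Obj C"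
    if "j < n''" for j using bb'' that by auto
  have y: "y \<in> Obj C" "y' \<in> Obj C" "y'' \<in> Obj C" using bb bb' bb'' by auto
  have c1: "coproduct C {..<n} (\<lambda>k. (x k \<boxtimes> y') \<boxtimes> y'') ((y \<boxtimes> y') \<boxtimes> y'')
    (\<lambda>k. (i k \<boxtimes>\<^sub>m Ident C y') \<boxtimes>\<^sub>m Ident C y'')"
    by (rule biproduct_coproduct[OF biproduct_tensor_left[OF biproduct_tensor_left[OF b y(2)] y(3)]])
  have c2: "coproduct C ({..<n'} \<times> {..<n''}) (\<lambda>(k, l). (x j \<boxtimes> x' k) \<boxtimes> x'' l) ((x j \<boxtimes> y') \<boxtimes> y'')
      (\<lambda>(k, l). (Ident C (x j) \<boxtimes>\<^sub>m i' k) \<boxtimes>\<^sub>m i'' l)" if "j < n" for j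
    using coproduct_tensor[OF biproduct_tensor_right[OF b' i(4)[OF that]] b''] .
  have ii: "(h \<cdot> ((i j \<boxtimes>\<^sub>m Ident C y') \<boxtimes>\<^sub>m Ident C y'')) \<cdot> ((Ident C (x j) \<boxtimes>\<^sub>m i' k) \<boxtimes>\<^sub>m i'' l)
      = h \<cdot> ((i j \<boxtimes>\<^sub>m i' k) \<boxtimes>\<^sub>m i'' l)"
    if "j < n" "k < n'" "l < n''" "h \<in> Arr C" "Dom C h = (y \<boxtimes> y') \<boxtimes> y''" for j k l h
    using i[OF that(1)] i'[OF that(2)] i''[OF that(3)] that y by (simp add: tensor_comp)
  show "f = g"
  proof (rule coproduct_eqI[OF c1])
    fix j assume j: "j \<in> {..<n}"
    show "f \<cdot> ((i j \<boxtimes>\<^sub>m Ident C y') \<boxtimes>\<^sub>m Ident C y'') = g \<cdot> ((i j \<boxtimes>\<^sub>m Ident C y') \<boxtimes>\<^sub>m Ident C y'')"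
    proof (rule coproduct_eqI[OF c2])
      fix kl assume kl: "kl \<in> {..<n'} \<times> {..<n''}"
      then obtain k l where [simp]: "kl = (k, l)" "k < n'" "l < n''" by auto
      show "(f \<cdot> ((i j \<boxtimes>\<^sub>m Ident C y') \<boxtimes>\<^sub>m Ident C y'')) \<cdot>
          (case kl of (k, l) \<Rightarrow> (Ident C (x j) \<boxtimes>\<^sub>m i' k) \<boxtimes>\<^sub>m i'' l) =
        (g \<cdot> ((i j \<boxtimes>\<^sub>m Ident C y') \<boxtimes>\<^sub>m Ident C y'')) \<cdot>
          (case kl of (k, l) \<Rightarrow> (Ident C (x j) \<boxtimes>\<^sub>m i' k) \<boxtimes>\<^sub>m i'' l)"
        using ii[of j k l f] ii[of j k l g] eq[of j k l] f g j by (simp del: comp_assoc)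
    qed (use j i f g y in auto)
  qed (use f g in auto)
qed

end

section \<open>Degrees of zero objects, of direct sums and of the unit\<close>

context grading
begin

lemma gr_Obj: "s \<in> carrier \<Gamma> \<Longrightarrow> a \<in> gr s \<Longrightarrow> a \<in> Obj C"
  using gr_subcategory unfolding full_additive_subcategory_def by blast

lemma gr_iso:
  assumes "s \<in> carrier \<Gamma>" "iso_arr C f" "Dom C f \<in> gr s"
  shows "Cod C f \<in> gr s"
proof -
  have "f \<in> Isos C (Dom C f) (Cod C f)" using assms by (simp add: Isos_iff)
  then show ?thesis using gr_iso_closed[OF assms(1,3)] iso_arr_in[OF assms(2)]
    by (metis Cod_Obj empty_iff)
qed

text \<open>The grading only provides some direct sum inside \<open>gr s\<close>; uniqueness of
  direct sums and closure under isomorphism extend this to every direct sum.\<close>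

lemma gr_direct_sum:
  assumes "s \<in> carrier \<Gamma>" "direct_sum C n x y" "\<And>k. k < n \<Longrightarrow> x k \<in> gr s"
  shows "y \<in> gr s"
proof -
  obtain y' where "y' \<in> gr s" "direct_sum C n x y'"
    using gr_subcategory[OF assms(1)] assms(3) unfolding full_additive_subcategory_def by blast
  then show ?thesis using direct_sum_unique[OF _ assms(2)] gr_iso[OF assms(1)] by metis
qed

text \<open>A zero object is a direct sum of no objects, so it belongs to every degree.\<close>

lemma zero_obj_gr:
  assumes "s \<in> carrier \<Gamma>" "zero_obj C a" "a \<in> Obj C"
  shows "a \<in> gr s"
proof -
  have "direct_sum C 0 (\<lambda>_. a) a"
    using assms unfolding direct_sum_def by (simp add: zero_obj_def)
  then show ?thesis using gr_direct_sum[OF assms(1)] by blast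
qed

text \<open>By orthogonality the split monomorphism f is zero, and then so is the identity
  \<open>g \<cdot> f\<close>.\<close>

lemma gr_retract_zero:
  assumes "s \<in> carrier \<Gamma>" "t \<in> carrier \<Gamma>" "s \<noteq> t" "Dom C f \<in> gr s" "Cod C f \<in> gr t"
    "f \<in> Arr C" "g \<in> Arr C" "Dom C g = Cod C f" "Cod C g = Dom C f" "g \<cdot> f = Ident C (Dom C f)"
  shows "zero_obj C (Dom C f)"
proof -
  have "f \<in> Hom C (Dom C f) (Cod C f)" using assms by simp
  then have "f = ZeroArr C (Dom C f) (Cod C f)" using gr_orthogonal[OF assms(1-5)] by blast
  then have "g \<cdot> ZeroArr C (Dom C f) (Cod C f) = Ident C (Dom C f)" using assms by metis
  then show ?thesis using assms by (simp add: zero_obj_def)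
qed

end

text \<open>The unit is decomposed into homogeneous summands. Those of degree other than the neutral
  element turn out to be zero, hence have the neutral degree as well, and a direct sum of objects of
  one degree has that degree.\<close>

lemma (in graded_monoidal_category) unit_Gr:
  assumes "group \<Gamma>"
  shows "UnitObj C \<in> Gr C \<one>\<^bsub>\<Gamma>\<^esub>"
proof -
  interpret \<Gamma>: group \<Gamma> by fact
  let ?I = "UnitObj C"
  obtain n x where x: "\<forall>k<n. \<exists>s\<in>carrier \<Gamma>. x k \<in> Gr C s" and ds: "direct_sum C n x ?I"
    using gr_decomposition[OF unit_Obj] by blast
  obtain d where d: "\<And>k. k < n \<Longrightarrow> d k \<in> carrier \<Gamma>" "\<And>k. k < n \<Longrightarrow> x k \<in> Gr C (d k)"
    using x by metis
  then have xo [simp]: "\<And>k. k < n \<Longrightarrow> x k \<in> Obj C" using gr_Obj by blast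
  obtain i p where b: "biproduct C n x ?I i p" using ds unfolding direct_sum_iff by auto
  note bb = b[unfolded biproduct_def]
  have i: "i j \<in> Arr C" "Dom C (i j) = x j" "Cod C (i j) = ?I" "p j \<in> Arr C" "Dom C (p j) = ?I"
    "Cod C (p j) = x j" "p j \<cdot> i j = Ident C (x j)" if "j < n" for j
    using bb that by auto
  have "x k \<in> Gr C \<one>\<^bsub>\<Gamma>\<^esub>" if k: "k < n" for k
  proof (cases "d k = \<one>\<^bsub>\<Gamma>\<^esub>")
    case True
    then show ?thesis using d(2)[OF k] by simp
  next
    case False
    \<comment> \<open>The product \<open>x k \<otimes> x l\<close> is a retract of \<open>x k \<otimes> \<one> \<cong> x k\<close> and of \<open>\<one> \<otimes> x l \<cong> x l\<close>.
      Comparing degrees, the former makes it zero if \<open>d l \<noteq> \<one>\<close>, the latter if \<open>d l = \<one>\<close>.\<close>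
    have z: "zero_obj C (x k \<boxtimes> x l)" if l: "l < n" for l
    proof -
      have dg: "x k \<boxtimes> x l \<in> Gr C (d k \<otimes>\<^bsub>\<Gamma>\<^esub> d l)" using Gr_TObj d k l by blast
      let ?f = "RUnit C (x k) \<cdot> (Ident C (x k) \<boxtimes>\<^sub>m i l)"
      let ?f' = "(Ident C (x k) \<boxtimes>\<^sub>m p l) \<cdot> inv_arr C (RUnit C (x k))"
      let ?g = "LUnit C (x l) \<cdot> (i k \<boxtimes>\<^sub>m Ident C (x l))"
      let ?g' = "(p k \<boxtimes>\<^sub>m Ident C (x l)) \<cdot> inv_arr C (LUnit C (x l))"
      show ?thesis
      proof (cases "d l = \<one>\<^bsub>\<Gamma>\<^esub>")
        case True
        have "zero_obj C (Dom C ?g)"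
          by (rule gr_retract_zero[of "d k \<otimes>\<^bsub>\<Gamma>\<^esub> d l" "d l" ?g ?g'])
            (use True False dg d(1) d(2)[OF l] k l i in \<open>auto simp: tensor_comp\<close>)
        then show ?thesis using k l i by simp
      next
        case F: False
        have "d k \<otimes>\<^bsub>\<Gamma>\<^esub> d l \<noteq> d k" using F d k l by simp
        have "zero_obj C (Dom C ?f)"
          by (rule gr_retract_zero[of "d k \<otimes>\<^bsub>\<Gamma>\<^esub> d l" "d k" ?f ?f'])
            (use F dg d k l i in \<open>auto simp: tensor_comp\<close>)
        then show ?thesis using k l i by simp
      qed
    qed
    \<comment> \<open>Tensoring the decomposition of the unit with x k exhibits x k, up to the right
      unitor, as a sum of the zero objects just found.\<close>
    have b2: "coproduct C {..<n} (\<lambda>l. x k \<boxtimes> x l) (x k \<boxtimes> ?I) (\<lambda>l. Ident C (x k) \<boxtimes>\<^sub>m i l)"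
      by (rule biproduct_coproduct[OF biproduct_tensor_right[OF b xo[OF k]]])
    have "Ident C (x k \<boxtimes> ?I) = ZeroArr C (x k \<boxtimes> ?I) (x k \<boxtimes> ?I)"
    proof (rule coproduct_eqI[OF b2])
      fix l assume "l \<in> {..<n}"
      then have l: "l < n" by simp
      show "Ident C (x k \<boxtimes> ?I) \<cdot> (Ident C (x k) \<boxtimes>\<^sub>m i l) =
        ZeroArr C (x k \<boxtimes> ?I) (x k \<boxtimes> ?I) \<cdot> (Ident C (x k) \<boxtimes>\<^sub>m i l)"
        by (rule zero_obj_arr_eq[OF z[OF l]]) (use k l i in auto)
    qed (use k in auto)
    then have "zero_obj C (x k)"
      using zero_obj_iso[of "RUnit C (x k)"] k by (simp add: zero_obj_def)
    then show ?thesis using zero_obj_gr k by simp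
  qed
  then show ?thesis using gr_direct_sum[OF _ ds] by simp
qed

section \<open>Crossed monoidal categories\<close>

context matched_pair
begin

sublocale G: group G by (rule group_G)
sublocale \<Gamma>: group \<Gamma> by (rule group_Gamma)

lemma act1_closed [simp]: "g \<in> carrier G \<Longrightarrow> s \<in> carrier \<Gamma> \<Longrightarrow> g \<rhd>\<^sub>1 s \<in> carrier \<Gamma>"
  using group_action.element_image[OF action1] by blast

lemma act2_closed [simp]: "s \<in> carrier \<Gamma> \<Longrightarrow> g \<in> carrier G \<Longrightarrow> s \<rhd>\<^sub>2 g \<in> carrier G"
  using group_action.element_image[OF action2] by blast

lemma act1_act1:
  "g \<in> carrier G \<Longrightarrow> h \<in> carrier G \<Longrightarrow> s \<in> carrier \<Gamma> \<Longrightarrow> g \<rhd>\<^sub>1 h \<rhd>\<^sub>1 s = (g \<otimes>\<^bsub>G\<^esub> h) \<rhd>\<^sub>1 s"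
  using group_action.composition_rule[OF action1] by metis

lemma act2_act2:
  "s \<in> carrier \<Gamma> \<Longrightarrow> t \<in> carrier \<Gamma> \<Longrightarrow> g \<in> carrier G \<Longrightarrow> s \<rhd>\<^sub>2 t \<rhd>\<^sub>2 g = (s \<otimes>\<^bsub>\<Gamma>\<^esub> t) \<rhd>\<^sub>2 g"
  using group_action.composition_rule[OF action2] by metis

end

context crossed_monoidal_category
begin

lemma act_Obj [simp]: "g \<in> carrier G \<Longrightarrow> a \<in> Obj C \<Longrightarrow> g \<star> a \<in> Obj C"
  using act_functor[THEN additive_functor.axioms(1)] by (metis cfunctor.fobj_in)

lemma act_Arr [simp]:
  assumes "g \<in> carrier G" "f \<in> Arr C"
  shows "g \<star>\<^sub>m f \<in> Arr C" "Dom C (g \<star>\<^sub>m f) = g \<star> Dom C f" "Cod C (g \<star>\<^sub>m f) = g \<star> Cod C f"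
proof -
  interpret additive_functor C C "Act C g" using assms by (intro act_functor)
  show "g \<star>\<^sub>m f \<in> Arr C" "Dom C (g \<star>\<^sub>m f) = g \<star> Dom C f" "Cod C (g \<star>\<^sub>m f) = g \<star> Cod C f"
    using assms by simp_all
qed

lemma act_Ident [simp]: "g \<in> carrier G \<Longrightarrow> a \<in> Obj C \<Longrightarrow> g \<star>\<^sub>m Ident C a = Ident C (g \<star> a)"
  using act_functor[THEN additive_functor.axioms(1)] by (metis cfunctor.fmor_Ident)

lemma act_comp:
  assumes "g \<in> carrier G" "f \<in> Arr C" "k \<in> Arr C" "Cod C f = Dom C k"
  shows "g \<star>\<^sub>m (k \<cdot> f) = g \<star>\<^sub>m k \<cdot> g \<star>\<^sub>m f"
proof -
  interpret additive_functor C C "Act C g" using assms by (intro act_functor)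
  show ?thesis using assms by (intro fmor_comp)
qed

lemma act_Add:
  assumes "g \<in> carrier G" "f \<in> Arr C" "k \<in> Arr C" "Cod C f = Cod C k" "Dom C f = Dom C k"
  shows "g \<star>\<^sub>m (k \<boxplus> f) = g \<star>\<^sub>m k \<boxplus> g \<star>\<^sub>m f"
proof -
  interpret additive_functor C C "Act C g" using assms by (intro act_functor)
  show ?thesis using assms by (intro fmor_Add) auto
qed

lemma act_iso [simp]:
  assumes "g \<in> carrier G" "iso_arr C f"
  shows "iso_arr C (g \<star>\<^sub>m f)" "inv_arr C (g \<star>\<^sub>m f) = g \<star>\<^sub>m (inv_arr C f)"
proof -
  interpret additive_functor C C "Act C g" using assms by (intro act_functor)
  show "iso_arr C (g \<star>\<^sub>m f)" "inv_arr C (g \<star>\<^sub>m f) = g \<star>\<^sub>m (inv_arr C f)"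
    using assms fmor_iso by auto
qed

lemma zero_obj_act:
  assumes "g \<in> carrier G" "a \<in> Obj C" "zero_obj C a"
  shows "zero_obj C (g \<star> a)"
proof -
  interpret additive_functor C C "Act C g" using assms by (intro act_functor)
  show ?thesis using assms fmor_zero[of a a] act_Ident[of g a] unfolding zero_obj_def by metis
qed

lemma Chi_Arr [simp]:
  assumes "g \<in> carrier G" "h \<in> carrier G" "a \<in> Obj C"
  shows "iso_arr C (Chi C g h a)" "Chi C g h a \<in> Arr C"
    "Dom C (Chi C g h a) = g \<star> h \<star> a" "Cod C (Chi C g h a) = (g \<otimes>\<^bsub>G\<^esub> h) \<star> a"
  using chi_iso[OF assms(1,2)] assms(3)
  by (auto simp: natural_iso_def Isos_iff comp_functor_def iso_arr_in)

lemma Chi_nat: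
  assumes "g \<in> carrier G" "h \<in> carrier G" "f \<in> Arr C" "Cod C f = b"
  shows "Chi C g h b \<cdot> g \<star>\<^sub>m h \<star>\<^sub>m f = (g \<otimes>\<^bsub>G\<^esub> h) \<star>\<^sub>m f \<cdot> Chi C g h (Dom C f)"
  using chi_iso[OF assms(1,2)] assms(3,4)
  by (simp add: natural_iso_def natural_trans_def comp_functor_def)

lemma Iota_Arr [simp]:
  assumes "a \<in> Obj C"
  shows "iso_arr C (Iota C a)" "Iota C a \<in> Arr C"
    "Dom C (Iota C a) = a" "Cod C (Iota C a) = \<one>\<^bsub>G\<^esub> \<star> a"
  using iota_iso assms by (auto simp: natural_iso_def Isos_iff id_functor_def iso_arr_in)

lemma Iota_nat:
  assumes "f \<in> Arr C" "Cod C f = b"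
  shows "Iota C b \<cdot> f = \<one>\<^bsub>G\<^esub> \<star>\<^sub>m f \<cdot> Iota C (Dom C f)"
  using iota_iso assms by (simp add: natural_iso_def natural_trans_def id_functor_def)

lemma ActMult_Arr [simp]:
  assumes "g \<in> carrier G" "s \<in> carrier \<Gamma>" "a \<in> Obj C" "b \<in> Gr C s"
  shows "iso_arr C (ActMult C g s a b)" "ActMult C g s a b \<in> Arr C"
    "Dom C (ActMult C g s a b) = (s \<rhd>\<^sub>2 g) \<star> a \<boxtimes> g \<star> b" "Cod C (ActMult C g s a b) = g \<star> (a \<boxtimes> b)"
  using ActMult_iso[OF assms] by (auto simp: Isos_iff iso_arr_in)

lemma ActMult_nat:
  assumes "g \<in> carrier G" "s \<in> carrier \<Gamma>" "f \<in> Arr C" "k \<in> Arr C" "Dom C k \<in> Gr C s" "b' \<in> Gr C s"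
    "Cod C f = a'" "Cod C k = b'"
  shows "ActMult C g s a' b' \<cdot> ((s \<rhd>\<^sub>2 g) \<star>\<^sub>m f \<boxtimes>\<^sub>m g \<star>\<^sub>m k)
    = g \<star>\<^sub>m (f \<boxtimes>\<^sub>m k) \<cdot> ActMult C g s (Dom C f) (Dom C k)"
  using ActMult_natural[of g s f "Dom C f" a' k "Dom C k" b'] assms by simp

lemma ActUnit_Arr [simp]:
  assumes "g \<in> carrier G"
  shows "iso_arr C (ActUnit C g)" "ActUnit C g \<in> Arr C"
    "Dom C (ActUnit C g) = UnitObj C" "Cod C (ActUnit C g) = g \<star> UnitObj C"
  using ActUnit_iso[OF assms] by (auto simp: Isos_iff iso_arr_in)

lemma unit_Gr_one: "UnitObj C \<in> Gr C \<one>\<^bsub>\<Gamma>\<^esub>"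
  by (rule unit_Gr[OF group_Gamma])

end


section \<open>Strictification along an essentially surjective family of objects\<close>

text \<open>The conditions on M, U and B are the coherence identities for R to become a crossed
  monoidal functor with \<open>fmult\<close> M, \<open>funit\<close> U and \<open>feta\<close> B.
  Naturality is absent because morphisms between formal objects are yet to be defined. The law
  \<open>gact_ten\<close> is demanded for every degree s of \<open>R y\<close>, hence for all s when
  \<open>R y\<close> is zero.\<close>

locale strict_model = crossed_monoidal_category G \<Gamma> act1 act2 C
  for G :: "('g, 'x) monoid_scheme" and \<Gamma> :: "('s, 'y) monoid_scheme"
    and act1 :: "'g \<Rightarrow> 's \<Rightarrow> 's" (infixr "\<rhd>\<^sub>1" 75)
    and act2 :: "'s \<Rightarrow> 'g \<Rightarrow> 'g" (infixr "\<rhd>\<^sub>2" 75)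
    and C :: "('o, 'm, 'g, 's, 'z) crossed_category_scheme" (structure) +
  fixes X :: "'p set" and R :: "'p \<Rightarrow> 'o" and ten :: "'p \<Rightarrow> 'p \<Rightarrow> 'p" and un :: 'p
    and gact :: "'g \<Rightarrow> 'p \<Rightarrow> 'p"
    and M :: "'p \<Rightarrow> 'p \<Rightarrow> 'm" and U :: 'm and B :: "'g \<Rightarrow> 'p \<Rightarrow> 'm"
  assumes R_Obj [simp]: "x \<in> X \<Longrightarrow> R x \<in> Obj C"
    and R_surj: "a \<in> Obj C \<Longrightarrow> \<exists>x\<in>X. \<exists>f. iso_arr C f \<and> Dom C f = R x \<and> Cod C f = a"
    and ten_in [simp]: "x \<in> X \<Longrightarrow> y \<in> X \<Longrightarrow> ten x y \<in> X"
    and un_in [simp]: "un \<in> X"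
    and gact_in [simp]: "g \<in> carrier G \<Longrightarrow> x \<in> X \<Longrightarrow> gact g x \<in> X"
    and ten_assoc: "x \<in> X \<Longrightarrow> y \<in> X \<Longrightarrow> z \<in> X \<Longrightarrow> ten (ten x y) z = ten x (ten y z)"
    and ten_un_left [simp]: "x \<in> X \<Longrightarrow> ten un x = x"
    and ten_un_right [simp]: "x \<in> X \<Longrightarrow> ten x un = x"
    and gact_one [simp]: "x \<in> X \<Longrightarrow> gact \<one>\<^bsub>G\<^esub> x = x"
    and gact_mult: "g \<in> carrier G \<Longrightarrow> h \<in> carrier G \<Longrightarrow> x \<in> X
      \<Longrightarrow> gact g (gact h x) = gact (g \<otimes>\<^bsub>G\<^esub> h) x"
    and gact_un [simp]: "g \<in> carrier G \<Longrightarrow> gact g un = un"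
    and gact_ten: "g \<in> carrier G \<Longrightarrow> s \<in> carrier \<Gamma> \<Longrightarrow> x \<in> X \<Longrightarrow> y \<in> X \<Longrightarrow> R y \<in> Gr C s
      \<Longrightarrow> gact g (ten x y) = ten (gact (s \<rhd>\<^sub>2 g) x) (gact g y)"
    and M_iso: "x \<in> X \<Longrightarrow> y \<in> X \<Longrightarrow> M x y \<in> Isos C (R x \<boxtimes> R y) (R (ten x y))"
    and U_iso: "U \<in> Isos C (UnitObj C) (R un)"
    and B_iso: "g \<in> carrier G \<Longrightarrow> x \<in> X \<Longrightarrow> B g x \<in> Isos C (R (gact g x)) (g \<star> R x)"
    and M_assoc: "x \<in> X \<Longrightarrow> y \<in> X \<Longrightarrow> z \<in> X \<Longrightarrow>
      M x (ten y z) \<cdot> (Ident C (R x) \<boxtimes>\<^sub>m M y z) \<cdot> Assoc C (R x) (R y) (R z)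
        = M (ten x y) z \<cdot> (M x y \<boxtimes>\<^sub>m Ident C (R z))"
    and M_left: "x \<in> X \<Longrightarrow> M un x \<cdot> (U \<boxtimes>\<^sub>m Ident C (R x)) = LUnit C (R x)"
    and M_right: "x \<in> X \<Longrightarrow> M x un \<cdot> (Ident C (R x) \<boxtimes>\<^sub>m U) = RUnit C (R x)"
    and B_mult: "g \<in> carrier G \<Longrightarrow> h \<in> carrier G \<Longrightarrow> x \<in> X
      \<Longrightarrow> Chi C g h (R x) \<cdot> g \<star>\<^sub>m B h x \<cdot> B g (gact h x) = B (g \<otimes>\<^bsub>G\<^esub> h) x"
    and B_one: "x \<in> X \<Longrightarrow> B \<one>\<^bsub>G\<^esub> x = Iota C (R x)"
    and B_ten: "g \<in> carrier G \<Longrightarrow> s \<in> carrier \<Gamma> \<Longrightarrow> x \<in> X \<Longrightarrow> y \<in> X \<Longrightarrow> R y \<in> Gr C s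
      \<Longrightarrow> g \<star>\<^sub>m M x y \<cdot> ActMult C g s (R x) (R y) \<cdot> (B (s \<rhd>\<^sub>2 g) x \<boxtimes>\<^sub>m B g y)
        = B g (ten x y) \<cdot> M (gact (s \<rhd>\<^sub>2 g) x) (gact g y)"
begin

section \<open>Product and action transported to morphisms between realizations\<close>

lemma M_Arr [simp]:
  assumes "x \<in> X" "y \<in> X"
  shows "iso_arr C (M x y)" "M x y \<in> Arr C" "Dom C (M x y) = R x \<boxtimes> R y" "Cod C (M x y) = R (ten x y)"
  using M_iso[OF assms] by (auto simp: Isos_iff iso_arr_in)

lemma U_Arr [simp]: "iso_arr C U" "U \<in> Arr C" "Dom C U = UnitObj C" "Cod C U = R un"
  using U_iso by (auto simp: Isos_iff iso_arr_in)

lemma B_Arr [simp]: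
  assumes "g \<in> carrier G" "x \<in> X"
  shows "iso_arr C (B g x)" "B g x \<in> Arr C" "Dom C (B g x) = R (gact g x)" "Cod C (B g x) = g \<star> R x"
  using B_iso[OF assms] by (auto simp: Isos_iff iso_arr_in)

lemma R_surjE:
  assumes "a \<in> Obj C"
  obtains x f where "x \<in> X" "iso_arr C f" "f \<in> Arr C" "Dom C f = R x" "Cod C f = a"
  using R_surj[OF assms] by (metis iso_arr_in)

text \<open>The only morphism that makes M natural; \<open>am\<close> plays the same role for B. The
  formal objects are arguments because R need not be injective, so f does not determine
  them.\<close>

definition tm :: "'p \<Rightarrow> 'p \<Rightarrow> 'm \<Rightarrow> 'p \<Rightarrow> 'p \<Rightarrow> 'm \<Rightarrow> 'm" where
  "tm x x' f y y' k = M x' y' \<cdot> (f \<boxtimes>\<^sub>m k) \<cdot> inv_arr C (M x y)"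

definition am :: "'g \<Rightarrow> 'p \<Rightarrow> 'p \<Rightarrow> 'm \<Rightarrow> 'm" where
  "am g x x' f = inv_arr C (B g x') \<cdot> g \<star>\<^sub>m f \<cdot> B g x"

definition rarr :: "'p \<Rightarrow> 'p \<Rightarrow> 'm \<Rightarrow> bool" where
  "rarr x x' f \<longleftrightarrow> x \<in> X \<and> x' \<in> X \<and> f \<in> Arr C \<and> Dom C f = R x \<and> Cod C f = R x'"

lemma tm_Arr [simp]:
  assumes "rarr x x' f" "rarr y y' k"
  shows "tm x x' f y y' k \<in> Arr C" "Dom C (tm x x' f y y' k) = R (ten x y)"
    "Cod C (tm x x' f y y' k) = R (ten x' y')"
  using assms by (simp_all add: tm_def rarr_def)

lemma rarr_tm [simp]:
  "rarr x x' f \<Longrightarrow> rarr y y' k \<Longrightarrow> rarr (ten x y) (ten x' y') (tm x x' f y y' k)"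
  by (simp add: rarr_def tm_def)

lemma am_Arr [simp]:
  assumes "rarr x x' f" "g \<in> carrier G"
  shows "am g x x' f \<in> Arr C" "Dom C (am g x x' f) = R (gact g x)"
    "Cod C (am g x x' f) = R (gact g x')"
  using assms by (simp_all add: am_def rarr_def)

lemma rarr_am [simp]:
  "rarr x x' f \<Longrightarrow> g \<in> carrier G \<Longrightarrow> rarr (gact g x) (gact g x') (am g x x' f)"
  by (simp add: rarr_def am_def)

lemma rarr_Ident [simp]: "x \<in> X \<Longrightarrow> rarr x x (Ident C (R x))"
  by (simp add: rarr_def)

lemma rarr_comp: "rarr x y f \<Longrightarrow> rarr y z g \<Longrightarrow> rarr x z (g \<cdot> f)"
  by (simp add: rarr_def)

lemma rarr_Add [simp]: "rarr x y f \<Longrightarrow> rarr x y g \<Longrightarrow> rarr x y (g \<boxplus> f)"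
  by (simp add: rarr_def)

lemma rarrD:
  assumes "rarr x x' f"
  shows "x \<in> X" "x' \<in> X" "f \<in> Arr C" "Dom C f = R x" "Cod C f = R x'"
  using assms by (simp_all add: rarr_def)

lemma tm_M:
  assumes "rarr x x' f" "rarr y y' k"
  shows "tm x x' f y y' k \<cdot> M x y = M x' y' \<cdot> (f \<boxtimes>\<^sub>m k)"
  using assms by (simp add: tm_def rarr_def)

text \<open>Since M is invertible, its naturality square characterises \<open>tm\<close>; identities
  for products of morphisms thereby become identities in C.\<close>

lemma tm_eqI:
  assumes "t \<cdot> M x y = M x' y' \<cdot> (f \<boxtimes>\<^sub>m k)" "rarr (ten x y) (ten x' y') t"
    "rarr x x' f" "rarr y y' k" 
  shows "tm x x' f y y' k = t"
proof (rule iso_cancel_right[of _ "M x y"])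
  show "tm x x' f y y' k \<cdot> M x y = t \<cdot> M x y" using assms tm_M by simp
qed (use assms in \<open>auto simp: rarrD\<close>)

lemma B_am:
  assumes "rarr x x' f" "g \<in> carrier G"
  shows "B g x' \<cdot> am g x x' f = g \<star>\<^sub>m f \<cdot> B g x"
  using assms by (simp add: am_def rarr_def)

lemma am_eqI:
  assumes "B g x' \<cdot> t = g \<star>\<^sub>m f \<cdot> B g x" "rarr (gact g x) (gact g x') t" "rarr x x' f" "g \<in> carrier G"
  shows "am g x x' f = t"
proof (rule iso_cancel_left[of "B g x'"])
  show "B g x' \<cdot> am g x x' f = B g x' \<cdot> t" using assms B_am by simp
qed (use assms in \<open>auto simp: rarrD\<close>)

lemma tm_Ident [simp]: "x \<in> X \<Longrightarrow> y \<in> X \<Longrightarrow>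
  tm x x (Ident C (R x)) y y (Ident C (R y)) = Ident C (R (ten x y))"
  by (rule tm_eqI) auto

lemma tm_comp:
  assumes "rarr x x' f" "rarr x' x'' f'" "rarr y y' k" "rarr y' y'' k'"
  shows "tm x x'' (f' \<cdot> f) y y'' (k' \<cdot> k) = tm x' x'' f' y' y'' k' \<cdot> tm x x' f y y' k"
  using assms by (simp add: tm_def rarr_def tensor_comp)

lemma tm_Add:
  assumes "rarr x x' f" "rarr y y' k"
  shows "rarr x x' f' \<Longrightarrow> tm x x' (f \<boxplus> f') y y' k = tm x x' f y y' k \<boxplus> tm x x' f' y y' k"
    "rarr y y' k' \<Longrightarrow> tm x x' f y y' (k \<boxplus> k') = tm x x' f y y' k \<boxplus> tm x x' f y y' k'"
  using assms by (simp_all add: tm_def rarr_def tensor_Add Add_comp comp_Add)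

lemma tm_assoc:
  assumes "rarr x x' f" "rarr y y' k" "rarr z z' l"
  shows "tm (ten x y) (ten x' y') (tm x x' f y y' k) z z' l
    = tm x x' f (ten y z) (ten y' z') (tm y y' k z z' l)"
proof -
  note [simp] = assms assms[unfolded rarr_def] ten_assoc
  let ?L = "tm (ten x y) (ten x' y') (tm x x' f y y' k) z z' l"
  let ?R = "tm x x' f (ten y z) (ten y' z') (tm y y' k z z' l)"
  \<comment> \<open>\<open>?N\<close> and \<open>?N'\<close> are the two-step multiplications before
    and after. Both iterated products are shown to be the conjugate of (f \<otimes> k) \<otimes> l
    by them, the second one with the help of \<open>M_assoc\<close>.\<close>
  let ?N = "M (ten x y) z \<cdot> (M x y \<boxtimes>\<^sub>m Ident C (R z))"
  let ?N' = "M (ten x' y') z' \<cdot> (M x' y' \<boxtimes>\<^sub>m Ident C (R z'))"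
  have rR: "rarr (ten x (ten y z)) (ten x' (ten y' z')) ?R" by (intro rarr_tm assms)
  note [simp] = rarrD[OF rR]
  have "?L \<cdot> ?N = (M (ten x' y') z' \<cdot> (tm x x' f y y' k \<boxtimes>\<^sub>m l)) \<cdot> (M x y \<boxtimes>\<^sub>m Ident C (R z))"
    by (rule comp_assoc_eq[OF tm_M]) auto
  also have "\<dots> = M (ten x' y') z' \<cdot> ((M x' y' \<cdot> (f \<boxtimes>\<^sub>m k)) \<boxtimes>\<^sub>m l)"
    by (simp add: tensor_comp tm_M)
  also have "\<dots> = ?N' \<cdot> ((f \<boxtimes>\<^sub>m k) \<boxtimes>\<^sub>m l)"
    by (simp add: tensor_comp)
  finally have L: "?L \<cdot> ?N = ?N' \<cdot> ((f \<boxtimes>\<^sub>m k) \<boxtimes>\<^sub>m l)" .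
  have "?R \<cdot> ?N = ?R \<cdot> M x (ten y z) \<cdot> (Ident C (R x) \<boxtimes>\<^sub>m M y z) \<cdot> Assoc C (R x) (R y) (R z)"
    using M_assoc[of x y z] by simp
  also have "\<dots> = (M x' (ten y' z') \<cdot> (f \<boxtimes>\<^sub>m tm y y' k z z' l)) \<cdot> (Ident C (R x) \<boxtimes>\<^sub>m M y z) \<cdot> Assoc C (R x) (R y) (R z)"
    by (rule comp_assoc_eq[OF tm_M]) auto
  also have "\<dots> = M x' (ten y' z') \<cdot> (f \<boxtimes>\<^sub>m (M y' z' \<cdot> (k \<boxtimes>\<^sub>m l))) \<cdot> Assoc C (R x) (R y) (R z)"
    by (simp add: tensor_comp tm_M)
  also have "\<dots> = M x' (ten y' z') \<cdot> (Ident C (R x') \<boxtimes>\<^sub>m M y' z') \<cdot> (f \<boxtimes>\<^sub>m (k \<boxtimes>\<^sub>m l)) \<cdot> Assoc C (R x) (R y) (R z)"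
    by (simp add: tensor_comp)
  also have "\<dots> = (M x' (ten y' z') \<cdot> (Ident C (R x') \<boxtimes>\<^sub>m M y' z') \<cdot> Assoc C (R x') (R y') (R z')) \<cdot> ((f \<boxtimes>\<^sub>m k) \<boxtimes>\<^sub>m l)"
    by (simp add: assoc_nat)
  also have "\<dots> = ?N' \<cdot> ((f \<boxtimes>\<^sub>m k) \<boxtimes>\<^sub>m l)" by (simp only: M_assoc[OF rarrD(2) rarrD(2) rarrD(2), OF assms])
  finally have "?L \<cdot> ?N = ?R \<cdot> ?N" using L by metis
  then show ?thesis by (rule iso_cancel_right) auto
qed

lemma tm_un_left:
  assumes "rarr x x' f"
  shows "tm un un (Ident C (R un)) x x' f = f"
proof (rule tm_eqI)
  note [simp] = assms rarrD[OF assms]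
  have "(f \<cdot> M un x) \<cdot> (U \<boxtimes>\<^sub>m Ident C (R x)) = f \<cdot> LUnit C (R x)"
    by (simp add: M_left)
  also have "\<dots> = LUnit C (R x') \<cdot> (Ident C (UnitObj C) \<boxtimes>\<^sub>m f)"
    by (simp add: LUnit_nat)
  also have "\<dots> = (M un x' \<cdot> (Ident C (R un) \<boxtimes>\<^sub>m f)) \<cdot> (U \<boxtimes>\<^sub>m Ident C (R x))"
    by (simp add: tensor_comp flip: M_left)
  finally show "f \<cdot> M un x = M un x' \<cdot> (Ident C (R un) \<boxtimes>\<^sub>m f)"
    by (rule iso_cancel_right) auto
qed (use assms in \<open>auto simp: rarrD\<close>)

lemma tm_un_right:
  assumes "rarr x x' f"
  shows "tm x x' f un un (Ident C (R un)) = f"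
proof (rule tm_eqI)
  note [simp] = assms rarrD[OF assms]
  have "(f \<cdot> M x un) \<cdot> (Ident C (R x) \<boxtimes>\<^sub>m U) = f \<cdot> RUnit C (R x)"
    by (simp add: M_right)
  also have "\<dots> = RUnit C (R x') \<cdot> (f \<boxtimes>\<^sub>m Ident C (UnitObj C))"
    by (simp add: RUnit_nat)
  also have "\<dots> = (M x' un \<cdot> (f \<boxtimes>\<^sub>m Ident C (R un))) \<cdot> (Ident C (R x) \<boxtimes>\<^sub>m U)"
    by (simp add: tensor_comp flip: M_right)
  finally show "f \<cdot> M x un = M x' un \<cdot> (f \<boxtimes>\<^sub>m Ident C (R un))"
    by (rule iso_cancel_right) auto
qed (use assms in \<open>auto simp: rarrD\<close>)

lemma am_Ident [simp]: "x \<in> X \<Longrightarrow> g \<in> carrier G \<Longrightarrow> am g x x (Ident C (R x)) = Ident C (R (gact g x))"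
  by (rule am_eqI) auto

lemma am_comp:
  assumes "rarr x x' f" "rarr x' x'' f'" "g \<in> carrier G"
  shows "am g x x'' (f' \<cdot> f) = am g x' x'' f' \<cdot> am g x x' f"
  using assms by (simp add: am_def rarr_def act_comp)

lemma am_Add:
  assumes "rarr x x' f" "rarr x x' f'" "g \<in> carrier G"
  shows "am g x x' (f \<boxplus> f') = am g x x' f \<boxplus> am g x x' f'"
  using assms by (simp add: am_def rarr_def act_Add Add_comp comp_Add)

lemma am_one:
  assumes "rarr x x' f"
  shows "am \<one>\<^bsub>G\<^esub> x x' f = f"
proof (rule am_eqI)
  note [simp] = rarrD[OF assms]
  show "B \<one>\<^bsub>G\<^esub> x' \<cdot> f = \<one>\<^bsub>G\<^esub> \<star>\<^sub>m f \<cdot> B \<one>\<^bsub>G\<^esub> x"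
    by (simp add: B_one Iota_nat)
qed (use assms in \<open>auto simp: rarrD\<close>)

text \<open>B at a product of group elements factors by \<open>B_mult\<close> into two instances of
  B and \<open>Chi\<close>, each of which is natural.\<close>

lemma am_mult:
  assumes "rarr x x' f" "g \<in> carrier G" "h \<in> carrier G"
  shows "am (g \<otimes>\<^bsub>G\<^esub> h) x x' f = am g (gact h x) (gact h x') (am h x x' f)"
proof (rule am_eqI)
  note [simp] = assms rarrD[OF assms(1)] gact_mult
  let ?a = "am g (gact h x) (gact h x') (am h x x' f)"
  have ra: "rarr (gact g (gact h x)) (gact g (gact h x')) ?a" by (intro rarr_am assms)
  note [simp] = rarrD[OF ra]
  have "B (g \<otimes>\<^bsub>G\<^esub> h) x' \<cdot> ?a = Chi C g h (R x') \<cdot> g \<star>\<^sub>m B h x' \<cdot> B g (gact h x') \<cdot> ?a"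
    using arg_cong[OF B_mult[of g h x'], of "\<lambda>t. t \<cdot> ?a"] by simp
  also have "\<dots> = Chi C g h (R x') \<cdot> g \<star>\<^sub>m B h x' \<cdot> g \<star>\<^sub>m am h x x' f \<cdot> B g (gact h x)"
    by (simp add: B_am)
  also have "\<dots> = Chi C g h (R x') \<cdot> g \<star>\<^sub>m (B h x' \<cdot> am h x x' f) \<cdot> B g (gact h x)"
    by (simp add: act_comp)
  also have "\<dots> = (Chi C g h (R x') \<cdot> g \<star>\<^sub>m h \<star>\<^sub>m f) \<cdot> g \<star>\<^sub>m B h x \<cdot> B g (gact h x)"
    by (simp add: B_am act_comp)
  also have "\<dots> = (g \<otimes>\<^bsub>G\<^esub> h) \<star>\<^sub>m f \<cdot> Chi C g h (R x) \<cdot> g \<star>\<^sub>m B h x \<cdot> B g (gact h x)"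
    by (simp add: Chi_nat)
  also have "\<dots> = (g \<otimes>\<^bsub>G\<^esub> h) \<star>\<^sub>m f \<cdot> B (g \<otimes>\<^bsub>G\<^esub> h) x"
    by (simp add: B_mult)
  finally show "B (g \<otimes>\<^bsub>G\<^esub> h) x' \<cdot> ?a = (g \<otimes>\<^bsub>G\<^esub> h) \<star>\<^sub>m f \<cdot> B (g \<otimes>\<^bsub>G\<^esub> h) x" .
  show "rarr (gact (g \<otimes>\<^bsub>G\<^esub> h) x) (gact (g \<otimes>\<^bsub>G\<^esub> h) x') ?a" using ra by simp
qed (use assms in auto)

text \<open>Both y and y' carry the same degree s, since \<open>ActMult\<close> is natural only
  within one degree. The twist by s then agrees at source and target, and \<open>B_ten\<close> turns
  the square for \<open>ActMult\<close> into the strict law.\<close>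

lemma am_tm:
  assumes "rarr x x' f" "rarr y y' k" "g \<in> carrier G" "s \<in> carrier \<Gamma>" "R y \<in> Gr C s" "R y' \<in> Gr C s"
  shows "am g (ten x y) (ten x' y') (tm x x' f y y' k)
    = tm (gact (s \<rhd>\<^sub>2 g) x) (gact (s \<rhd>\<^sub>2 g) x') (am (s \<rhd>\<^sub>2 g) x x' f) (gact g y) (gact g y') (am g y y' k)"
    (is "?l = ?r")
proof -
  note [simp] = assms assms(1,2)[unfolded rarr_def]
  let ?h = "s \<rhd>\<^sub>2 g"
  have gt [simp]: "ten (gact ?h x) (gact g y) = gact g (ten x y)"
    "ten (gact ?h x') (gact g y') = gact g (ten x' y')" by (simp_all add: gact_ten[of g s])
  have rr: "rarr (ten (gact ?h x) (gact g y)) (ten (gact ?h x') (gact g y')) ?r"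
    by (intro rarr_tm rarr_am) auto
  note [simp] = rarrD[OF rr, unfolded gt]
  show ?thesis
  proof (rule am_eqI)
    have "(B g (ten x' y') \<cdot> ?r) \<cdot> M (gact ?h x) (gact g y)
      = B g (ten x' y') \<cdot> M (gact ?h x') (gact g y') \<cdot> (am ?h x x' f \<boxtimes>\<^sub>m am g y y' k)"
      by (simp add: tm_M)
    also have "\<dots> = (g \<star>\<^sub>m M x' y' \<cdot> ActMult C g s (R x') (R y') \<cdot> (B ?h x' \<boxtimes>\<^sub>m B g y')) \<cdot>
      (am ?h x x' f \<boxtimes>\<^sub>m am g y y' k)"
      by (rule comp_assoc_eq[OF B_ten[symmetric]]) auto
    also have "\<dots> = g \<star>\<^sub>m M x' y' \<cdot> ActMult C g s (R x') (R y')
        \<cdot> (?h \<star>\<^sub>m f \<boxtimes>\<^sub>m g \<star>\<^sub>m k) \<cdot> (B ?h x \<boxtimes>\<^sub>m B g y)"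
      by (simp add: tensor_comp B_am)
    also have "\<dots> = g \<star>\<^sub>m M x' y' \<cdot> (g \<star>\<^sub>m (f \<boxtimes>\<^sub>m k) \<cdot> ActMult C g s (R x) (R y)) \<cdot> (B ?h x \<boxtimes>\<^sub>m B g y)"
      by (subst comp_assoc_eq[OF ActMult_nat]) auto
    also have "\<dots> = g \<star>\<^sub>m (M x' y' \<cdot> (f \<boxtimes>\<^sub>m k)) \<cdot> ActMult C g s (R x) (R y) \<cdot> (B ?h x \<boxtimes>\<^sub>m B g y)"
      by (simp add: act_comp)
    also have "\<dots> = g \<star>\<^sub>m tm x x' f y y' k \<cdot> g \<star>\<^sub>m M x y \<cdot> ActMult C g s (R x) (R y) \<cdot> (B ?h x \<boxtimes>\<^sub>m B g y)"
      unfolding tm_M[OF assms(1,2), symmetric] by (simp add: act_comp)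
    also have "\<dots> = g \<star>\<^sub>m tm x x' f y y' k \<cdot> B g (ten x y) \<cdot> M (gact ?h x) (gact g y)"
      by (simp add: B_ten)
    also have "\<dots> = (g \<star>\<^sub>m tm x x' f y y' k \<cdot> B g (ten x y)) \<cdot> M (gact ?h x) (gact g y)"
      by simp
    finally show "B g (ten x' y') \<cdot> ?r = g \<star>\<^sub>m tm x x' f y y' k \<cdot> B g (ten x y)"
      by (rule iso_cancel_right) auto
  qed (use rr in auto)
qed


text \<open>Endpoints are stored in a morphism because R need not be injective. Every structure
  morphism is an identity, so the axioms reduce to the strict laws of \<open>ten\<close> and
  \<open>gact\<close> on objects and those of \<open>tm\<close> and \<open>am\<close> on
  morphisms.\<close>

definition SC :: "('p, 'p \<times> 'p \<times> 'm, 'g, 's) crossed_category" where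
  "SC = \<lparr>Obj = X, Arr = {(x, x', f). rarr x x' f}, Dom = (\<lambda>(x, x', f). x), Cod = (\<lambda>(x, x', f). x'),
    Ident = (\<lambda>x. (x, x, Ident C (R x))), Comp = (\<lambda>(y, z, g) (x, y', f). (x, z, g \<cdot> f)),
    Add = (\<lambda>(x, x', f) (y, y', k). (x, x', f \<boxplus> k)),
    ZeroArr = (\<lambda>x y. (x, y, ZeroArr C (R x) (R y))),
    TObj = ten, TArr = (\<lambda>(x, x', f) (y, y', k). (ten x y, ten x' y', tm x x' f y y' k)),
    UnitObj = un, Assoc = (\<lambda>x y z. let w = ten x (ten y z) in (w, w, Ident C (R w))),
    LUnit = (\<lambda>x. (x, x, Ident C (R x))), RUnit = (\<lambda>x. (x, x, Ident C (R x))),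
    Gr = (\<lambda>s. {x \<in> X. R x \<in> Gr C s}),
    Act = (\<lambda>g. \<lparr>fobj = gact g, fmor = (\<lambda>(x, x', f). (gact g x, gact g x', am g x x' f))\<rparr>),
    Chi = (\<lambda>g h x. let w = gact (g \<otimes>\<^bsub>G\<^esub> h) x in (w, w, Ident C (R w))),
    Iota = (\<lambda>x. (x, x, Ident C (R x))),
    ActMult = (\<lambda>g s x y. let w = gact g (ten x y) in (w, w, Ident C (R w))),
    ActUnit = (\<lambda>g. (un, un, Ident C (R un)))\<rparr>"

lemma SC_simps [simp]:
  "Obj SC = X" "(x, x', f) \<in> Arr SC \<longleftrightarrow> rarr x x' f" "Dom SC (x, x', f) = x" "Cod SC (x, x', f) = x'"
  "Ident SC x = (x, x, Ident C (R x))" "(y, z, g) \<cdot>\<^bsub>SC\<^esub> (x, y', f) = (x, z, g \<cdot> f)"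
  "(x, x', f) \<boxplus>\<^bsub>SC\<^esub> (y, y', k) = (x, x', f \<boxplus> k)"
  "ZeroArr SC x y = (x, y, ZeroArr C (R x) (R y))"
  "x \<boxtimes>\<^bsub>SC\<^esub> y = ten x y"
  "(x, x', f) \<boxtimes>\<^sub>m\<^bsub>SC\<^esub> (y, y', k) = (ten x y, ten x' y', tm x x' f y y' k)"
  "UnitObj SC = un" "Assoc SC x y w = (let w = ten x (ten y w) in (w, w, Ident C (R w)))"
  "LUnit SC x = (x, x, Ident C (R x))" "RUnit SC x = (x, x, Ident C (R x))"
  "x \<in> Gr SC s \<longleftrightarrow> x \<in> X \<and> R x \<in> Gr C s"
  "h \<star>\<^bsub>SC\<^esub> x = gact h x"
  "h \<star>\<^sub>m\<^bsub>SC\<^esub> (x, x', f) = (gact h x, gact h x', am h x x' f)"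
  "Chi SC h k' x = (let w = gact (h \<otimes>\<^bsub>G\<^esub> k') x in (w, w, Ident C (R w)))"
  "Iota SC x = (x, x, Ident C (R x))"
  "ActMult SC h s x y = (let w = gact h (ten x y) in (w, w, Ident C (R w)))"
  "ActUnit SC h = (un, un, Ident C (R un))"
  by (simp_all add: SC_def)

section \<open>The transported data form a crossed monoidal category\<close>

lemma category_SC: "category SC"
  by unfold_locales (auto simp: rarrD intro: rarr_comp)

interpretation SC: category SC by (rule category_SC)

lemma iso_SC [simp]:
  assumes "rarr x y f" "iso_arr C f"
  shows "iso_arr SC (x, y, f)" "inv_arr SC (x, y, f) = (y, x, inv_arr C f)"
proof -
  note [simp] = assms rarrD[OF assms(1)]
  have [simp]: "rarr y x (inv_arr C f)" by (simp add: rarr_def)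
  show i: "iso_arr SC (x, y, f)" by (rule iso_arrI[of _ _ "(y, x, inv_arr C f)"]) auto
  show "inv_arr SC (x, y, f) = (y, x, inv_arr C f)" by (rule SC.inv_arr_eqI[OF i]) auto
qed

lemma iso_SC_D:
  assumes "iso_arr SC (x, y, f)"
  shows "iso_arr C f"
proof -
  obtain x' y' g where g: "inv_arr SC (x, y, f) = (x', y', g)" using prod_cases3 by blast
  have "rarr x y f" using assms iso_arr_in by force
  then show ?thesis
    using inv_arr[OF assms] unfolding g by (intro iso_arrI[of _ _ g]) (auto simp: rarr_def)
qed

lemma Hom_group_SC: 
  assumes "x \<in> X" "y \<in> X"
  shows "comm_group (Hom_group SC x y)"
proof -
  interpret H: comm_group "Hom_group C (R x) (R y)" using assms by (intro Hom_comm_group) auto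
  let ?h = "\<lambda>f. (x, y, f)"
  \<comment> \<open>Tagging is a homomorphism, so its image is a commutative group, and the image is
    the whole Hom set.\<close>
  have "?h \<in> hom (Hom_group C (R x) (R y)) (Hom_group SC x y)"
    using assms by (auto simp: hom_def Hom_group_def rarr_def)
  then have "comm_group (Hom_group SC x y
      \<lparr>carrier := ?h ` carrier (Hom_group C (R x) (R y)), one := ?h \<one>\<^bsub>Hom_group C (R x) (R y)\<^esub>\<rparr>)"
    by (rule H.hom_imp_img_comm_group)
  moreover have "?h ` carrier (Hom_group C (R x) (R y)) = carrier (Hom_group SC x y)"
    using assms by (auto simp: Hom_group_def rarr_def image_def)
  ultimately show ?thesis by (simp add: Hom_group_def)
qed

lemma hom_sum_SC:
  assumes "x \<in> X" "y \<in> X" "\<And>k. k < n \<Longrightarrow> rarr x y (f k)"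
  shows "hom_sum SC x y n (\<lambda>k. (x, y, f k)) = (x, y, hom_sum C (R x) (R y) n f)"
  by (rule hom_finprod[symmetric]) (use assms Hom_comm_group Hom_group_SC in
    \<open>auto simp: Hom_group_def hom_def rarr_def\<close>)

lemma direct_sum_SC:
  assumes "y \<in> X" "\<And>k. k < n \<Longrightarrow> x k \<in> X" "direct_sum C n (\<lambda>k. R (x k)) (R y)"
  shows "direct_sum SC n x y"
proof -
  obtain i p where b: "biproduct C n (\<lambda>k. R (x k)) (R y) i p"
    using assms(3) unfolding direct_sum_iff by blast
  note bb = b[unfolded biproduct_def]
  have i: "rarr (x k) y (i k)" "rarr y (x k) (p k)" if "k < n" for k
    using bb that assms by (auto simp: rarr_def)
  have "hom_sum SC y y n (\<lambda>k. (y, y, i k \<cdot> p k)) = (y, y, hom_sum C (R y) (R y) n (\<lambda>k. i k \<cdot> p k))"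
    by (rule hom_sum_SC) (use assms i in \<open>auto intro: rarr_comp\<close>)
  then have "biproduct SC n x y (\<lambda>k. (x k, y, i k)) (\<lambda>k. (y, x k, p k))"
    using bb assms i unfolding biproduct_def by auto
  then show ?thesis unfolding direct_sum_iff by blast
qed

text \<open>A direct sum c found in C need not be a realization, but by essential surjectivity it is
  isomorphic to one. The isomorphism is returned so that the degree of c can be carried
  over.\<close>

lemma direct_sum_SC_ex:
  assumes "\<And>k. k < n \<Longrightarrow> x k \<in> X" "direct_sum C n (\<lambda>k. R (x k)) c"
  obtains y f where "y \<in> X" "direct_sum SC n x y" "iso_arr C f" "Dom C f = c" "Cod C f = R y"
proof -
  have "c \<in> Obj C" using assms(2) by (simp add: direct_sum_def)
  then obtain y f where y: "y \<in> X" "iso_arr C f" "f \<in> Arr C" "Dom C f = R y" "Cod C f = c"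
    by (rule R_surjE)
  have "direct_sum C n (\<lambda>k. R (x k)) (R y)"
  proof (rule direct_sum_iso[OF assms(2), of "inv_arr C f"])
    show "\<exists>\<theta>. iso_arr C \<theta> \<and> Dom C \<theta> = R (x k) \<and> Cod C \<theta> = R (x k)" if "k < n" for k
      using assms(1)[OF that] by (intro exI[of _ "Ident C (R (x k))"]) simp
  qed (use y in auto)
  then show thesis using that[of y "inv_arr C f"] direct_sum_SC[of y n x] assms y by auto
qed

lemma additive_SC: "additive_category SC"
proof (intro additive_category.intro additive_category_axioms.intro category_SC)
  show "comm_group (Hom_group SC a b)" if "a \<in> Obj SC" "b \<in> Obj SC" for a b
    using that by (simp add: Hom_group_SC)
  show "(g \<boxplus>\<^bsub>SC\<^esub> h) \<cdot>\<^bsub>SC\<^esub> f = (g \<cdot>\<^bsub>SC\<^esub> f) \<boxplus>\<^bsub>SC\<^esub> (h \<cdot>\<^bsub>SC\<^esub> f)"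
    if "f \<in> Hom SC a b" "g \<in> Hom SC b c" "h \<in> Hom SC b c" for f a b g h c
    using that by (cases f, cases g, cases h) (auto simp: rarr_def Add_comp)
  show "h \<cdot>\<^bsub>SC\<^esub> (f \<boxplus>\<^bsub>SC\<^esub> g) = (h \<cdot>\<^bsub>SC\<^esub> f) \<boxplus>\<^bsub>SC\<^esub> (h \<cdot>\<^bsub>SC\<^esub> g)"
    if "f \<in> Hom SC a b" "g \<in> Hom SC a b" "h \<in> Hom SC b c" for f a b g h c
    using that by (cases f, cases g, cases h) (auto simp: rarr_def comp_Add)
  show "\<exists>y. direct_sum SC n x y" if x: "\<And>k. k < n \<Longrightarrow> x k \<in> Obj SC" for n x
  proof -
    obtain c where "direct_sum C n (\<lambda>k. R (x k)) c"
      using x direct_sum_exists[of n "\<lambda>k. R (x k)"] by auto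
    then show ?thesis using x direct_sum_SC_ex[of n x c] by (metis SC_simps(1))
  qed
qed

interpretation SC: additive_category SC by (rule additive_SC)

lemma grading_SC: "grading \<Gamma> SC (Gr SC)"
proof unfold_locales
  fix s assume s: "s \<in> carrier \<Gamma>"
  show "full_additive_subcategory SC (Gr SC s)"
    unfolding full_additive_subcategory_def
  proof (intro conjI allI impI)
    show "Gr SC s \<subseteq> Obj SC" by auto
    fix n :: nat and x assume x: "\<forall>k<n. x k \<in> Gr SC s"
    then obtain c where c: "c \<in> Gr C s" "direct_sum C n (\<lambda>k. R (x k)) c"
      using gr_subcategory[OF s] unfolding full_additive_subcategory_def by (auto 4 4)
    obtain y f where y: "y \<in> X" "direct_sum SC n x y" "iso_arr C f" "Dom C f = c" "Cod C f = R y"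
      using direct_sum_SC_ex[OF _ c(2)] x by auto
    then have "y \<in> Gr SC s" using gr_iso[OF s, of f] c by simp
    then show "\<exists>y\<in>Gr SC s. direct_sum SC n x y" using y by blast
  qed
next
  fix s a b assume s: "s \<in> carrier \<Gamma>" and a: "a \<in> Gr SC s" "b \<in> Obj SC" "Isos SC a b \<noteq> {}"
  then obtain f where "iso_arr SC (a, b, f)" by (auto simp: Isos_iff dest: iso_arr_in)
  then have "rarr a b f" "iso_arr C f" using iso_SC_D iso_arr_in by fastforce+
  then show "b \<in> Gr SC s" using gr_iso[OF s, of f] a by (simp add: rarr_def)
next
  fix y assume y: "y \<in> Obj SC"
  then obtain n c where c: "\<forall>k<n. \<exists>s\<in>carrier \<Gamma>. c k \<in> Gr C s" and ds: "direct_sum C n c (R y)"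
    using gr_decomposition[of "R y"] by auto
  \<comment> \<open>The homogeneous summands c k are replaced by isomorphic realizations of formal
    objects.\<close>
  have "\<forall>k. \<exists>x. k < n \<longrightarrow> x \<in> X \<and> (\<exists>f. iso_arr C f \<and> Dom C f = R x \<and> Cod C f = c k)"
  proof
    fix k
    have "k < n \<Longrightarrow> c k \<in> Obj C" using ds by (simp add: direct_sum_def)
    then show "\<exists>x. k < n \<longrightarrow> x \<in> X \<and> (\<exists>f. iso_arr C f \<and> Dom C f = R x \<and> Cod C f = c k)"
      using R_surj[of "c k"] by blast
  qed
  then obtain x where x: "\<And>k. k < n \<Longrightarrow> x k \<in> X"
    "\<And>k. k < n \<Longrightarrow> \<exists>f. iso_arr C f \<and> Dom C f = R (x k) \<and> Cod C f = c k" by metis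
  have "direct_sum C n (\<lambda>k. R (x k)) (R y)"
    by (rule direct_sum_iso[OF ds, of "Ident C (R y)"]) (use x y in auto)
  then have "direct_sum SC n x y" using x y by (intro direct_sum_SC) auto
  moreover have "\<exists>s\<in>carrier \<Gamma>. x k \<in> Gr SC s" if k: "k < n" for k
  proof -
    obtain f where f: "iso_arr C f" "Dom C f = R (x k)" "Cod C f = c k" using x(2)[OF k] by blast
    obtain s where s: "s \<in> carrier \<Gamma>" "c k \<in> Gr C s" using c k by blast
    then have "R (x k) \<in> Gr C s" using gr_iso[OF s(1), of "inv_arr C f"] f by simp
    then show ?thesis using s x(1)[OF k] by auto
  qed
  ultimately show "\<exists>n x. (\<forall>k<n. \<exists>s\<in>carrier \<Gamma>. x k \<in> Gr SC s) \<and> direct_sum SC n x y" by blast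
next
  fix s t a b assume *: "s \<in> carrier \<Gamma>" "t \<in> carrier \<Gamma>" "s \<noteq> t" "a \<in> Gr SC s" "b \<in> Gr SC t"
  then have o: "Hom C (R a) (R b) = {ZeroArr C (R a) (R b)}" using gr_orthogonal[of s t] by auto
  show "Hom SC a b = {ZeroArr SC a b}"
  proof (intro equalityI subsetI)
    fix f assume "f \<in> Hom SC a b"
    then obtain f' where f: "f = (a, b, f')" "rarr a b f'" by (cases f) auto
    then have "f' \<in> Hom C (R a) (R b)" by (simp add: rarr_def)
    then show "f \<in> {ZeroArr SC a b}" using o f by simp
  qed (use * in \<open>auto simp: rarr_def\<close>)
qed

lemma monoidal_SC: "additive_monoidal_category SC"
proof -
  have i: "(x, x, Ident C (R x)) \<in> Isos SC x x" if "x \<in> X" for x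
    using that by (auto simp: Isos_iff)
  show ?thesis
    apply (intro additive_monoidal_category.intro additive_monoidal_category_axioms.intro)
    subgoal by (rule additive_SC)
    subgoal by simp
    subgoal for f a b k a' b' by (cases f, cases k) auto
    subgoal by simp
    subgoal for f a b g c f' a' b' g' c' by (cases f, cases g, cases f', cases g') (auto simp: tm_comp)
    subgoal for f a b g k a' b' by (cases f, cases g, cases k) (auto simp: tm_Add)
    subgoal for k a' b' f a b g by (cases f, cases g, cases k) (auto simp: tm_Add)
    subgoal by simp
    subgoal by (simp add: Let_def ten_assoc i)
    subgoal for f a a' g b b' h c c'
      using rarr_tm[of a a' "snd (snd f)" "ten b c" "ten b' c'" "tm b b' (snd (snd g)) c c' (snd (snd h))"]
      by (cases f, cases g, cases h) (auto simp: Let_def tm_assoc ten_assoc rarrD)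
    subgoal by (simp add: i)
    subgoal for f a b by (cases f) (auto simp: tm_un_left rarrD)
    subgoal by (simp add: i)
    subgoal for f a b by (cases f) (auto simp: tm_un_right rarrD)
    subgoal by (simp add: Let_def ten_assoc)
    subgoal by (simp add: Let_def)
    done
qed

lemma graded_SC: "graded_monoidal_category \<Gamma> SC"
proof -
  note C_gr_iso = gr_iso
  interpret additive_monoidal_category SC by (rule monoidal_SC)
  interpret grading \<Gamma> SC "Gr SC" by (rule grading_SC)
  show ?thesis
  proof unfold_locales
    fix s t a b assume *: "s \<in> carrier \<Gamma>" "t \<in> carrier \<Gamma>" "a \<in> Gr SC s" "b \<in> Gr SC t"
    then have "R a \<boxtimes> R b \<in> Gr C (s \<otimes>\<^bsub>\<Gamma>\<^esub> t)" by (simp add: Gr_TObj)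
    then show "a \<boxtimes>\<^bsub>SC\<^esub> b \<in> Gr SC (s \<otimes>\<^bsub>\<Gamma>\<^esub> t)"
      using * C_gr_iso[of "s \<otimes>\<^bsub>\<Gamma>\<^esub> t" "M a b"] by simp
  qed
qed

lemma action_SC: "category_action G SC (Act SC) (Chi SC) (Iota SC)"
proof -
  interpret SC: additive_category SC by (rule additive_SC)
  have i: "(x, x, Ident C (R x)) \<in> Isos SC x x" if "x \<in> X" for x
    using that by (auto simp: Isos_iff)
  show ?thesis
    apply (intro category_action.intro category_action_axioms.intro additive_SC G.is_group)
    subgoal for g by unfold_locales (auto simp: am_comp am_Add dest: rarrD)
    subgoal for g h
      by (auto simp: natural_iso_def natural_trans_def comp_functor_def Let_def gact_mult i am_mult rarrD)
    subgoal by (auto simp: natural_iso_def natural_trans_def id_functor_def i am_one rarrD)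
    subgoal by (simp add: Let_def gact_mult G.m_assoc)
    subgoal by (simp add: Let_def)
    subgoal by (simp add: Let_def)
    done
qed

lemma crossed_SC: "crossed_monoidal_category G \<Gamma> act1 act2 SC"
proof -
  note C_gr_iso = gr_iso
  have i: "(x, x, Ident C (R x)) \<in> Isos SC x x" if "x \<in> X" for x
    using that by (auto simp: Isos_iff)
  \<comment> \<open>With identities as structure maps, \<open>ActMult_assoc\<close> needs only that
    its objects agree. The degree of the realization of \<open>ten b c\<close> is obtained along the
    isomorphism \<open>M b c\<close>.\<close>
  have assoc: "ten (gact ((s \<otimes>\<^bsub>\<Gamma>\<^esub> t) \<rhd>\<^sub>2 g) a) (ten (gact (t \<rhd>\<^sub>2 g) b) (gact g c)) = gact g (ten a (ten b c))"
    if "g \<in> carrier G" "s \<in> carrier \<Gamma>" "t \<in> carrier \<Gamma>" "a \<in> X" "b \<in> X" "R b \<in> Gr C s" "c \<in> X" "R c \<in> Gr C t"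
    for g s t a b c
  proof -
    have "R b \<boxtimes> R c \<in> Gr C (s \<otimes>\<^bsub>\<Gamma>\<^esub> t)" using Gr_TObj that by simp
    then have "R (ten b c) \<in> Gr C (s \<otimes>\<^bsub>\<Gamma>\<^esub> t)" using C_gr_iso[of _ "M b c"] that by simp
    then show ?thesis using gact_ten[of g "s \<otimes>\<^bsub>\<Gamma>\<^esub> t" a "ten b c"] gact_ten[of g t b c] that by simp
  qed
  have Gr_act: "R (gact g a) \<in> Gr C (g \<rhd>\<^sub>1 s)"
    if "g \<in> carrier G" "s \<in> carrier \<Gamma>" "a \<in> X" "R a \<in> Gr C s" for g s a
    using C_gr_iso[of "g \<rhd>\<^sub>1 s" "inv_arr C (B g a)"] act_Gr[of g s "R a"] that by simp
  show ?thesis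
    apply (intro crossed_monoidal_category.intro crossed_monoidal_category_axioms.intro)
    subgoal by (rule matched_pair_axioms)
    subgoal by (rule graded_SC)
    subgoal by (rule action_SC)
    subgoal for g s a b using gact_ten[of g s a b] by (simp add: Let_def i)
    subgoal for g s f a a' k b b'
      using gact_ten[of g s a b] gact_ten[of g s a' b']
      by (cases f, cases k) (auto simp: Let_def am_tm[of _ _ _ _ _ _ g s] rarrD)
    subgoal by (simp add: i)
    subgoal by (simp add: Gr_act)
    subgoal for g s t a b c
      using assoc[of g s t a b c] gact_ten[of g t "ten a b" c] gact_ten[of "t \<rhd>\<^sub>2 g" s a b] gact_ten[of g t b c]
      by (simp add: Let_def ten_assoc)
    subgoal by (simp add: Let_def)
    subgoal by (simp add: Let_def)
    subgoal for g h s a b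
      using gact_ten[of h s a b] gact_ten[of g "h \<rhd>\<^sub>1 s" "gact (s \<rhd>\<^sub>2 h) a" "gact h b"]
        gact_ten[of "g \<otimes>\<^bsub>G\<^esub> h" s a b] Gr_act[of h s b]
      by (simp add: Let_def gact_mult)
    subgoal by simp
    subgoal by (simp add: Let_def)
    subgoal by simp
    done
qed

end

section \<open>The equivalence between C and the strict category\<close>

context strict_model
begin

lemma strictly_crossed_SC: "strictly_crossed G \<Gamma> SC" and strict_monoidal_SC: "strict_monoidal SC"
  by (simp_all add: strictly_crossed_def strict_monoidal_def Let_def)

text \<open>A chosen formal object whose realization is isomorphic to a; \<open>th a\<close> is a
  chosen isomorphism from that realization to a.\<close>

definition rx :: "'o \<Rightarrow> 'p" where
  "rx a = (SOME x. x \<in> X \<and> (\<exists>f. iso_arr C f \<and> Dom C f = R x \<and> Cod C f = a))"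

definition th :: "'o \<Rightarrow> 'm" where
  "th a = (SOME f. iso_arr C f \<and> Dom C f = R (rx a) \<and> Cod C f = a)"

lemma th_Arr [simp]:
  assumes "a \<in> Obj C"
  shows "rx a \<in> X" "iso_arr C (th a)" "th a \<in> Arr C" "Dom C (th a) = R (rx a)" "Cod C (th a) = a"
proof -
  have "\<exists>x. x \<in> X \<and> (\<exists>f. iso_arr C f \<and> Dom C f = R x \<and> Cod C f = a)" using R_surj[OF assms] by blast
  from someI_ex[OF this] have 1: "rx a \<in> X" "\<exists>f. iso_arr C f \<and> Dom C f = R (rx a) \<and> Cod C f = a"
    unfolding rx_def by auto
  from someI_ex[OF 1(2)] show "iso_arr C (th a)" "Dom C (th a) = R (rx a)" "Cod C (th a) = a" "rx a \<in> X"
    unfolding th_def[symmetric] using 1(1) by auto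
  then show "th a \<in> Arr C" by (simp add: iso_arr_in)
qed

text \<open>\<open>Fm\<close>, \<open>Fj\<close>, \<open>Fu\<close> and \<open>Fe\<close> are forced
  by requiring \<open>th\<close> to be a crossed monoidal natural isomorphism from the composite
  through the strict category to the identity of C. The lemmas \<open>th_Fm\<close>,
  \<open>th_Fj\<close>, \<open>th_Fu\<close> and \<open>th_Fe\<close> state this, and the coherence
  of the functor follows by composing with \<open>th\<close> and cancelling.\<close>

definition Fm :: "'m \<Rightarrow> 'm" where
  "Fm f = inv_arr C (th (Cod C f)) \<cdot> f \<cdot> th (Dom C f)"

definition Fj :: "'o \<Rightarrow> 'o \<Rightarrow> 'm" where
  "Fj a b = inv_arr C (th (a \<boxtimes> b)) \<cdot> (th a \<boxtimes>\<^sub>m th b) \<cdot> inv_arr C (M (rx a) (rx b))"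

definition Fu :: 'm where
  "Fu = inv_arr C (th (UnitObj C)) \<cdot> inv_arr C U"

definition Fe :: "'g \<Rightarrow> 'o \<Rightarrow> 'm" where
  "Fe g a = inv_arr C (B g (rx a)) \<cdot> inv_arr C (g \<star>\<^sub>m th a) \<cdot> th (g \<star> a)"

lemma rarr_Fm: "f \<in> Arr C \<Longrightarrow> Dom C f = a \<Longrightarrow> Cod C f = b \<Longrightarrow> rarr (rx a) (rx b) (Fm f)"
  by (auto simp: rarr_def Fm_def)

lemma rarr_Fj: "a \<in> Obj C \<Longrightarrow> b \<in> Obj C \<Longrightarrow> rarr (ten (rx a) (rx b)) (rx (a \<boxtimes> b)) (Fj a b)"
  by (auto simp: rarr_def Fj_def)

lemma rarr_Fu: "rarr un (rx (UnitObj C)) Fu"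
  by (auto simp: rarr_def Fu_def)

lemma rarr_Fe: "g \<in> carrier G \<Longrightarrow> a \<in> Obj C \<Longrightarrow> rarr (rx (g \<star> a)) (gact g (rx a)) (Fe g a)"
  by (auto simp: rarr_def Fe_def simp del: act_iso(2))

lemma Fm_Arr [simp]: "f \<in> Arr C \<Longrightarrow> Fm f \<in> Arr C" "f \<in> Arr C \<Longrightarrow> Dom C (Fm f) = R (rx (Dom C f))"
  "f \<in> Arr C \<Longrightarrow> Cod C (Fm f) = R (rx (Cod C f))"
  using rarrD[OF rarr_Fm[OF _ refl refl]] by auto

lemma Fj_Arr [simp]:
  assumes "a \<in> Obj C" "b \<in> Obj C"
  shows "iso_arr C (Fj a b)" "Fj a b \<in> Arr C" "Dom C (Fj a b) = R (ten (rx a) (rx b))"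
    "Cod C (Fj a b) = R (rx (a \<boxtimes> b))"
  using rarrD[OF rarr_Fj[OF assms]] assms by (auto simp: Fj_def)

lemma Fu_Arr [simp]:
  shows "iso_arr C Fu" "Fu \<in> Arr C" "Dom C Fu = R un" "Cod C Fu = R (rx (UnitObj C))"
  using rarrD[OF rarr_Fu] by (auto simp: Fu_def)

lemma Fe_Arr [simp]:
  assumes "g \<in> carrier G" "a \<in> Obj C"
  shows "iso_arr C (Fe g a)" "Fe g a \<in> Arr C" "Dom C (Fe g a) = R (rx (g \<star> a))"
    "Cod C (Fe g a) = R (gact g (rx a))"
  using rarrD[OF rarr_Fe[OF assms]] assms by (auto simp: Fe_def simp del: act_iso(2))

lemma th_Fm: "f \<in> Arr C \<Longrightarrow> Cod C f = b \<Longrightarrow> th b \<cdot> Fm f = f \<cdot> th (Dom C f)"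
  by (auto simp: Fm_def)

lemma th_Fj: "a \<in> Obj C \<Longrightarrow> b \<in> Obj C \<Longrightarrow> th (a \<boxtimes> b) \<cdot> Fj a b \<cdot> M (rx a) (rx b) = th a \<boxtimes>\<^sub>m th b"
  by (simp add: Fj_def)

lemma th_Fu: "th (UnitObj C) \<cdot> Fu \<cdot> U = Ident C (UnitObj C)"
  by (simp add: Fu_def)

lemma th_Fe: "g \<in> carrier G \<Longrightarrow> a \<in> Obj C \<Longrightarrow> g \<star>\<^sub>m th a \<cdot> B g (rx a) \<cdot> Fe g a = th (g \<star> a)"
  by (simp add: Fe_def del: act_iso(2))

lemma Fm_Ident: "a \<in> Obj C \<Longrightarrow> Fm (Ident C a) = Ident C (R (rx a))"
  by (simp add: Fm_def)

lemma Fm_comp: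
  assumes "f \<in> Arr C" "g \<in> Arr C" "Cod C f = Dom C g"
  shows "Fm (g \<cdot> f) = Fm g \<cdot> Fm f"
  using assms by (simp add: Fm_def)

lemma Fm_Add:
  assumes "f \<in> Arr C" "g \<in> Arr C" "Dom C f = Dom C g" "Cod C f = Cod C g"
  shows "Fm (f \<boxplus> g) = Fm f \<boxplus> Fm g"
  using assms by (simp add: Fm_def Add_comp comp_Add)

lemma Fj_nat:
  assumes [simp]: "f \<in> Arr C" "k \<in> Arr C"
  shows "Fj (Cod C f) (Cod C k) \<cdot> tm (rx (Dom C f)) (rx (Cod C f)) (Fm f) (rx (Dom C k)) (rx (Cod C k)) (Fm k)
    = Fm (f \<boxtimes>\<^sub>m k) \<cdot> Fj (Dom C f) (Dom C k)" (is "?j \<cdot> ?t = ?r")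
proof -
  let ?th = "th (Cod C f \<boxtimes> Cod C k)" and ?M = "M (rx (Dom C f)) (rx (Dom C k))"
  note [simp] = rarr_Fm[OF assms(1) refl refl] rarr_Fm[OF assms(2) refl refl]
  have t: "?t \<cdot> ?M = M (rx (Cod C f)) (rx (Cod C k)) \<cdot> (Fm f \<boxtimes>\<^sub>m Fm k)"
    by (rule tm_M) auto
  have "(?th \<cdot> ?j \<cdot> ?t) \<cdot> ?M = (?th \<cdot> ?j \<cdot> M (rx (Cod C f)) (rx (Cod C k))) \<cdot> (Fm f \<boxtimes>\<^sub>m Fm k)"
    by (simp add: t)
  also have "\<dots> = (f \<boxtimes>\<^sub>m k) \<cdot> (th (Dom C f) \<boxtimes>\<^sub>m th (Dom C k))"
    by (simp only: th_Fj Cod_Obj assms) (simp add: tensor_comp th_Fm)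
  also have "\<dots> = (f \<boxtimes>\<^sub>m k) \<cdot> th (Dom C f \<boxtimes> Dom C k) \<cdot> Fj (Dom C f) (Dom C k) \<cdot> ?M"
    by (simp add: th_Fj)
  also have "\<dots> = (?th \<cdot> Fm (f \<boxtimes>\<^sub>m k)) \<cdot> Fj (Dom C f) (Dom C k) \<cdot> ?M"
    using th_Fm[of "f \<boxtimes>\<^sub>m k" "Cod C f \<boxtimes> Cod C k"] by simp
  also have "\<dots> = (?th \<cdot> ?r) \<cdot> ?M" by simp
  finally have "?th \<cdot> ?j \<cdot> ?t = ?th \<cdot> ?r" by (rule iso_cancel_right) auto
  then show ?thesis by (rule iso_cancel_left) auto
qed

lemma Fj_assoc:
  assumes [simp]: "a \<in> Obj C" "b \<in> Obj C" "c \<in> Obj C"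
  shows "Fm (Assoc C a b c) \<cdot> Fj (a \<boxtimes> b) c \<cdot>
      tm (ten (rx a) (rx b)) (rx (a \<boxtimes> b)) (Fj a b) (rx c) (rx c) (Ident C (R (rx c)))
    = Fj a (b \<boxtimes> c) \<cdot> tm (rx a) (rx a) (Ident C (R (rx a))) (ten (rx b) (rx c)) (rx (b \<boxtimes> c)) (Fj b c)"
    (is "?A \<cdot> ?j \<cdot> ?t = ?j' \<cdot> ?t'")
proof -
  let ?x = "rx a" and ?y = "rx b" and ?z = "rx c"
  let ?\<alpha> = "Assoc C (R ?x) (R ?y) (R ?z)"
  \<comment> \<open>After composing with \<open>?th\<close> on the left and \<open>?N\<close> on the
    right, both sides become the associator of C conjoined with the tensor product of
    \<open>th a\<close>, \<open>th b\<close> and \<open>th c\<close>.\<close>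
  let ?N = "M (ten ?x ?y) ?z \<cdot> (M ?x ?y \<boxtimes>\<^sub>m Ident C (R ?z))"
  let ?th = "th (a \<boxtimes> (b \<boxtimes> c))"
  note [simp] = rarr_Fj ten_assoc
  have t: "?t \<cdot> M (ten ?x ?y) ?z = M (rx (a \<boxtimes> b)) ?z \<cdot> (Fj a b \<boxtimes>\<^sub>m Ident C (R ?z))"
    by (rule tm_M) auto
  have t': "?t' \<cdot> M ?x (ten ?y ?z) = M ?x (rx (b \<boxtimes> c)) \<cdot> (Ident C (R ?x) \<boxtimes>\<^sub>m Fj b c)"
    by (rule tm_M) auto
  have tt: "rarr (ten (ten ?x ?y) ?z) (ten (rx (a \<boxtimes> b)) ?z) ?t"
    "rarr (ten ?x (ten ?y ?z)) (ten ?x (rx (b \<boxtimes> c))) ?t'"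
    by (intro rarr_tm rarr_Fj rarr_Ident; simp)+
  note [simp] = rarrD[OF tt(1)] rarrD[OF tt(2)]
  have "(?th \<cdot> ?A \<cdot> ?j \<cdot> ?t) \<cdot> ?N = (?th \<cdot> ?A) \<cdot> ?j \<cdot> (?t \<cdot> M (ten ?x ?y) ?z) \<cdot> (M ?x ?y \<boxtimes>\<^sub>m Ident C (R ?z))"
    by simp
  also have "\<dots> = Assoc C a b c \<cdot> (th ((a \<boxtimes> b) \<boxtimes> c) \<cdot> ?j \<cdot> M (rx (a \<boxtimes> b)) ?z)
      \<cdot> ((Fj a b \<cdot> M ?x ?y) \<boxtimes>\<^sub>m Ident C (R ?z))"
    unfolding t by (simp add: th_Fm tensor_comp)
  also have "\<dots> = Assoc C a b c \<cdot> ((th a \<boxtimes>\<^sub>m th b) \<boxtimes>\<^sub>m th c)"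
    by (simp add: th_Fj tensor_comp)
  also have "\<dots> = (th a \<boxtimes>\<^sub>m (th b \<boxtimes>\<^sub>m th c)) \<cdot> ?\<alpha>"
    by (simp add: assoc_nat)
  also have "\<dots> = (th a \<boxtimes>\<^sub>m (th (b \<boxtimes> c) \<cdot> Fj b c \<cdot> M ?y ?z)) \<cdot> ?\<alpha>"
    by (simp add: th_Fj)
  also have "\<dots> = (th a \<boxtimes>\<^sub>m th (b \<boxtimes> c)) \<cdot> (Ident C (R ?x) \<boxtimes>\<^sub>m (Fj b c \<cdot> M ?y ?z)) \<cdot> ?\<alpha>"
    by (simp add: tensor_comp)
  also have "\<dots> = (?th \<cdot> ?j' \<cdot> M ?x (rx (b \<boxtimes> c))) \<cdot> (Ident C (R ?x) \<boxtimes>\<^sub>m (Fj b c \<cdot> M ?y ?z))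
      \<cdot> ?\<alpha>"
    by (simp only: th_Fj assms tensor_Obj)
  also have "\<dots> = ?th \<cdot> ?j' \<cdot> (?t' \<cdot> M ?x (ten ?y ?z)) \<cdot> (Ident C (R ?x) \<boxtimes>\<^sub>m M ?y ?z) \<cdot> ?\<alpha>"
    unfolding t' by (simp add: tensor_comp)
  also have "\<dots> = (?th \<cdot> ?j' \<cdot> ?t') \<cdot> (M ?x (ten ?y ?z) \<cdot> (Ident C (R ?x) \<boxtimes>\<^sub>m M ?y ?z) \<cdot> ?\<alpha>)"
    by simp
  also have "\<dots> = (?th \<cdot> ?j' \<cdot> ?t') \<cdot> ?N" by (simp only: M_assoc th_Arr assms)
  finally have "?th \<cdot> ?A \<cdot> ?j \<cdot> ?t = ?th \<cdot> ?j' \<cdot> ?t'" by (rule iso_cancel_right) auto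
  then show ?thesis by (rule iso_cancel_left) auto
qed

lemma Fj_left:
  assumes [simp]: "a \<in> Obj C"
  shows "Fm (LUnit C a) \<cdot> Fj (UnitObj C) a \<cdot> tm un (rx (UnitObj C)) Fu (rx a) (rx a) (Ident C (R (rx a)))
    = Ident C (R (rx a))" (is "?l \<cdot> ?j \<cdot> ?t = _")
proof -
  let ?x = "rx a" and ?u = "rx (UnitObj C)" and ?i = "Ident C (UnitObj C)"
  note [simp] = rarr_Fu
  have t: "?t \<cdot> M un ?x = M ?u ?x \<cdot> (Fu \<boxtimes>\<^sub>m Ident C (R ?x))"
    by (rule tm_M) auto
  have tt: "rarr (ten un ?x) (ten ?u ?x) ?t" by (intro rarr_tm rarr_Fu rarr_Ident) simp
  note [simp] = rarrD[OF tt, simplified]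
  let ?N = "M un ?x \<cdot> (U \<boxtimes>\<^sub>m Ident C (R ?x))"
  have "(th a \<cdot> ?l \<cdot> ?j \<cdot> ?t) \<cdot> ?N = (th a \<cdot> ?l) \<cdot> ?j \<cdot> (?t \<cdot> M un ?x) \<cdot> (U \<boxtimes>\<^sub>m Ident C (R ?x))"
    by simp
  also have "\<dots> = LUnit C a \<cdot> (th (UnitObj C \<boxtimes> a) \<cdot> ?j \<cdot> M ?u ?x) \<cdot> ((Fu \<cdot> U) \<boxtimes>\<^sub>m Ident C (R ?x))"
    unfolding t by (simp add: th_Fm tensor_comp)
  also have "\<dots> = LUnit C a \<cdot> (?i \<boxtimes>\<^sub>m th a)"
    by (simp add: th_Fj tensor_comp th_Fu)
  also have "\<dots> = (th a \<cdot> Ident C (R ?x)) \<cdot> ?N" by (simp add: LUnit_nat M_left)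
  finally have "th a \<cdot> ?l \<cdot> ?j \<cdot> ?t = th a \<cdot> Ident C (R ?x)" by (rule iso_cancel_right) auto
  then show ?thesis by (rule iso_cancel_left) auto
qed

lemma Fj_right:
  assumes [simp]: "a \<in> Obj C"
  shows "Fm (RUnit C a) \<cdot> Fj a (UnitObj C) \<cdot> tm (rx a) (rx a) (Ident C (R (rx a))) un (rx (UnitObj C)) Fu
    = Ident C (R (rx a))" (is "?l \<cdot> ?j \<cdot> ?t = _")
proof -
  let ?x = "rx a" and ?u = "rx (UnitObj C)" and ?i = "Ident C (UnitObj C)"
  note [simp] = rarr_Fu
  have t: "?t \<cdot> M ?x un = M ?x ?u \<cdot> (Ident C (R ?x) \<boxtimes>\<^sub>m Fu)"
    by (rule tm_M) auto
  have tt: "rarr (ten ?x un) (ten ?x ?u) ?t" by (intro rarr_tm rarr_Fu rarr_Ident) simp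
  note [simp] = rarrD[OF tt, simplified]
  let ?N = "M ?x un \<cdot> (Ident C (R ?x) \<boxtimes>\<^sub>m U)"
  have "(th a \<cdot> ?l \<cdot> ?j \<cdot> ?t) \<cdot> ?N = (th a \<cdot> ?l) \<cdot> ?j \<cdot> (?t \<cdot> M ?x un) \<cdot> (Ident C (R ?x) \<boxtimes>\<^sub>m U)"
    by simp
  also have "\<dots> = RUnit C a \<cdot> (th (a \<boxtimes> UnitObj C) \<cdot> ?j \<cdot> M ?x ?u) \<cdot> (Ident C (R ?x) \<boxtimes>\<^sub>m (Fu \<cdot> U))"
    unfolding t by (simp add: th_Fm tensor_comp)
  also have "\<dots> = RUnit C a \<cdot> (th a \<boxtimes>\<^sub>m ?i)"
    by (simp add: th_Fj tensor_comp th_Fu)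
  also have "\<dots> = (th a \<cdot> Ident C (R ?x)) \<cdot> ?N" by (simp add: RUnit_nat M_right)
  finally have "th a \<cdot> ?l \<cdot> ?j \<cdot> ?t = th a \<cdot> Ident C (R ?x)" by (rule iso_cancel_right) auto
  then show ?thesis by (rule iso_cancel_left) auto
qed

lemma Fe_nat:
  assumes [simp]: "f \<in> Arr C" "g \<in> carrier G"
  shows "Fe g (Cod C f) \<cdot> Fm (g \<star>\<^sub>m f) = am g (rx (Dom C f)) (rx (Cod C f)) (Fm f) \<cdot> Fe g (Dom C f)"
    (is "?e \<cdot> ?f = ?a \<cdot> ?e'")
proof -
  let ?x = "rx (Dom C f)" and ?y = "rx (Cod C f)"
  note r [simp] = rarr_Fm[OF assms(1) refl refl]
  let ?N = "g \<star>\<^sub>m th (Cod C f) \<cdot> B g ?y"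
  have "?N \<cdot> ?e \<cdot> ?f = (g \<star>\<^sub>m th (Cod C f) \<cdot> B g ?y \<cdot> ?e) \<cdot> ?f" by simp
  also have "\<dots> = g \<star>\<^sub>m f \<cdot> th (g \<star> Dom C f)" by (simp only: th_Fe Cod_Obj assms) (simp add: th_Fm)
  also have "\<dots> = g \<star>\<^sub>m (f \<cdot> th (Dom C f)) \<cdot> B g ?x \<cdot> ?e'" by (simp add: act_comp th_Fe)
  also have "\<dots> = g \<star>\<^sub>m (th (Cod C f) \<cdot> Fm f) \<cdot> B g ?x \<cdot> ?e'" by (simp add: th_Fm)
  also have "\<dots> = g \<star>\<^sub>m th (Cod C f) \<cdot> (g \<star>\<^sub>m Fm f \<cdot> B g ?x) \<cdot> ?e'" by (simp add: act_comp)
  also have "\<dots> = ?N \<cdot> ?a \<cdot> ?e'" unfolding B_am[OF r assms(2), symmetric] by simp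
  finally show ?thesis by (rule iso_cancel_left) auto
qed

lemma Fe_Chi:
  assumes [simp]: "g \<in> carrier G" "h \<in> carrier G" "a \<in> Obj C"
  shows "Fe (g \<otimes>\<^bsub>G\<^esub> h) a \<cdot> Fm (Chi C g h a) = am g (rx (h \<star> a)) (gact h (rx a)) (Fe h a) \<cdot> Fe g (h \<star> a)"
    (is "?e \<cdot> ?f = ?a \<cdot> ?e'")
proof -
  let ?x = "rx a" and ?gh = "g \<otimes>\<^bsub>G\<^esub> h"
  note r [simp] = rarr_Fe[OF assms(2,3)]
  note [simp] = gact_mult
  let ?N = "?gh \<star>\<^sub>m th a \<cdot> B ?gh ?x"
  note ra [simp] = rarr_am[OF r assms(1)]
  have "?N \<cdot> ?a \<cdot> ?e' = ?gh \<star>\<^sub>m th a \<cdot> (Chi C g h (R ?x) \<cdot> g \<star>\<^sub>m B h ?x \<cdot> B g (gact h ?x)) \<cdot> ?a \<cdot> ?e'"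
    by (subst B_mult) (use am_Arr[OF r assms(1)] in auto)
  also have "\<dots> = (?gh \<star>\<^sub>m th a \<cdot> Chi C g h (R ?x)) \<cdot> g \<star>\<^sub>m B h ?x \<cdot> (B g (gact h ?x) \<cdot> ?a) \<cdot> ?e'"
    by simp
  also have "\<dots> = (Chi C g h a \<cdot> g \<star>\<^sub>m h \<star>\<^sub>m th a) \<cdot> g \<star>\<^sub>m B h ?x \<cdot> (g \<star>\<^sub>m Fe h a \<cdot> B g (rx (h \<star> a))) \<cdot> ?e'"
    by (simp add: Chi_nat B_am)
  also have "\<dots> = Chi C g h a \<cdot> g \<star>\<^sub>m (h \<star>\<^sub>m th a \<cdot> B h ?x \<cdot> Fe h a) \<cdot> B g (rx (h \<star> a)) \<cdot> ?e'"
    by (simp add: act_comp)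
  also have "\<dots> = Chi C g h a \<cdot> th (g \<star> h \<star> a)" by (simp add: th_Fe)
  also have "\<dots> = th (?gh \<star> a) \<cdot> ?f" by (simp add: th_Fm)
  also have "\<dots> = (?gh \<star>\<^sub>m th a \<cdot> B ?gh ?x \<cdot> ?e) \<cdot> ?f" by (simp only: th_Fe G.m_closed assms)
  also have "\<dots> = ?N \<cdot> ?e \<cdot> ?f" by simp
  finally have "?N \<cdot> ?e \<cdot> ?f = ?N \<cdot> ?a \<cdot> ?e'" by simp
  then show ?thesis by (rule iso_cancel_left) auto
qed

lemma Fe_ActMult:
  assumes [simp]: "g \<in> carrier G" "s \<in> carrier \<Gamma>" "a \<in> Obj C" "b \<in> Gr C s"
  shows "Fe g (a \<boxtimes> b) \<cdot> Fm (ActMult C g s a b) \<cdot> Fj ((s \<rhd>\<^sub>2 g) \<star> a) (g \<star> b)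
    = am g (ten (rx a) (rx b)) (rx (a \<boxtimes> b)) (Fj a b) \<cdot>
      tm (rx ((s \<rhd>\<^sub>2 g) \<star> a)) (gact (s \<rhd>\<^sub>2 g) (rx a)) (Fe (s \<rhd>\<^sub>2 g) a) (rx (g \<star> b)) (gact g (rx b)) (Fe g b)"
    (is "?e \<cdot> ?J \<cdot> ?j = ?a \<cdot> ?t")
proof -
  have b [simp]: "b \<in> Obj C" using gr_Obj assms by blast
  \<comment> \<open>The realization of \<open>rx b\<close> is isomorphic to b, so it has degree s
    and the law \<open>gact_ten\<close> and the identity \<open>B_ten\<close> apply with this
    s.\<close>
  have gb [simp]: "R (rx b) \<in> Gr C s"
    using gr_iso[of s "inv_arr C (th b)"] assms by simp
  let ?h = "s \<rhd>\<^sub>2 g" and ?x = "rx a" and ?y = "rx b"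
  have gt [simp]: "ten (gact ?h ?x) (gact g ?y) = gact g (ten ?x ?y)" by (simp add: gact_ten[of g s])
  note r = rarr_Fj[of a b] rarr_Fe[of ?h a] rarr_Fe[of g b]
  note [simp] = r[simplified]
  have t: "?t \<cdot> M (rx (?h \<star> a)) (rx (g \<star> b)) = M (gact ?h ?x) (gact g ?y) \<cdot> (Fe ?h a \<boxtimes>\<^sub>m Fe g b)"
    by (rule tm_M) auto
  have tt: "rarr (ten (rx (?h \<star> a)) (rx (g \<star> b))) (ten (gact ?h ?x) (gact g ?y)) ?t"
    by (intro rarr_tm r) auto
  note [simp] = rarrD[OF tt, simplified]
  have at: "rarr (gact g (ten ?x ?y)) (gact g (rx (a \<boxtimes> b))) ?a" by (intro rarr_am r) auto
  note [simp] = rarrD[OF at, simplified]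
  have a: "B g (rx (a \<boxtimes> b)) \<cdot> ?a = g \<star>\<^sub>m Fj a b \<cdot> B g (ten ?x ?y)"
    by (rule B_am) auto
  let ?N = "g \<star>\<^sub>m th (a \<boxtimes> b) \<cdot> B g (rx (a \<boxtimes> b))" and ?M = "M (rx (?h \<star> a)) (rx (g \<star> b))"
  have "(?N \<cdot> ?a \<cdot> ?t) \<cdot> ?M = g \<star>\<^sub>m th (a \<boxtimes> b) \<cdot> (B g (rx (a \<boxtimes> b)) \<cdot> ?a) \<cdot> (?t \<cdot> ?M)"
    by simp
  also have "\<dots> = g \<star>\<^sub>m (th (a \<boxtimes> b) \<cdot> Fj a b) \<cdot> (B g (ten ?x ?y) \<cdot> M (gact ?h ?x) (gact g ?y)) \<cdot> (Fe ?h a \<boxtimes>\<^sub>m Fe g b)"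
    unfolding a t by (simp add: act_comp)
  also have "\<dots> = g \<star>\<^sub>m (th (a \<boxtimes> b) \<cdot> Fj a b) \<cdot>
      (g \<star>\<^sub>m M ?x ?y \<cdot> ActMult C g s (R ?x) (R ?y) \<cdot> (B ?h ?x \<boxtimes>\<^sub>m B g ?y)) \<cdot> (Fe ?h a \<boxtimes>\<^sub>m Fe g b)"
    by (subst B_ten) auto
  also have "\<dots> = g \<star>\<^sub>m (th (a \<boxtimes> b) \<cdot> Fj a b \<cdot> M ?x ?y) \<cdot> ActMult C g s (R ?x) (R ?y)
      \<cdot> ((B ?h ?x \<cdot> Fe ?h a) \<boxtimes>\<^sub>m (B g ?y \<cdot> Fe g b))"
    by (simp add: act_comp tensor_comp)
  also have "\<dots> = (g \<star>\<^sub>m (th a \<boxtimes>\<^sub>m th b) \<cdot> ActMult C g s (R ?x) (R ?y))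
      \<cdot> ((B ?h ?x \<cdot> Fe ?h a) \<boxtimes>\<^sub>m (B g ?y \<cdot> Fe g b))"
    by (simp add: th_Fj)
  also have "\<dots> = (ActMult C g s a b \<cdot> (?h \<star>\<^sub>m th a \<boxtimes>\<^sub>m g \<star>\<^sub>m th b)) \<cdot> ((B ?h ?x \<cdot> Fe ?h a) \<boxtimes>\<^sub>m (B g ?y \<cdot> Fe g b))"
    using ActMult_nat[of g s "th a" "th b" b a] by simp
  also have "\<dots> = ActMult C g s a b \<cdot> (th (?h \<star> a) \<boxtimes>\<^sub>m th (g \<star> b))"
    by (simp add: tensor_comp th_Fe)
  also have "\<dots> = ActMult C g s a b \<cdot> th (?h \<star> a \<boxtimes> g \<star> b) \<cdot> ?j \<cdot> ?M"
    by (simp add: th_Fj)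
  also have "\<dots> = (th (g \<star> (a \<boxtimes> b)) \<cdot> ?J) \<cdot> ?j \<cdot> ?M" by (simp add: th_Fm)
  also have "\<dots> = (g \<star>\<^sub>m th (a \<boxtimes> b) \<cdot> B g (rx (a \<boxtimes> b)) \<cdot> ?e) \<cdot> ?J \<cdot> ?j \<cdot> ?M"
    by (subst th_Fe) auto
  also have "\<dots> = (?N \<cdot> ?e \<cdot> ?J \<cdot> ?j) \<cdot> ?M" by simp
  finally have "?N \<cdot> ?a \<cdot> ?t = ?N \<cdot> ?e \<cdot> ?J \<cdot> ?j" by (rule iso_cancel_right) auto
  then have "?a \<cdot> ?t = ?e \<cdot> ?J \<cdot> ?j" by (rule iso_cancel_left) auto
  then show ?thesis by simp
qed

definition RF :: "('p, 'p \<times> 'p \<times> 'm, 'o, 'm, 'g) crossed_functor" where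
  "RF = \<lparr>fobj = R, fmor = (\<lambda>(x, y, f). f), fmult = M, funit = U, feta = B\<rparr>"

definition SF :: "('o, 'm, 'p, 'p \<times> 'p \<times> 'm, 'g) crossed_functor" where
  "SF = \<lparr>fobj = rx, fmor = (\<lambda>f. (rx (Dom C f), rx (Cod C f), Fm f)),
    fmult = (\<lambda>a b. (ten (rx a) (rx b), rx (a \<boxtimes> b), Fj a b)), funit = (un, rx (UnitObj C), Fu),
    feta = (\<lambda>g a. (rx (g \<star> a), gact g (rx a), Fe g a))\<rparr>"

lemma RF_simps [simp]: "fobj RF = R" "fmor RF (x, y, f) = f" "fmult RF = M" "funit RF = U" "feta RF = B"
  by (simp_all add: RF_def)

lemma SF_simps [simp]: "fobj SF = rx" "fmor SF f = (rx (Dom C f), rx (Cod C f), Fm f)"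
  "fmult SF a b = (ten (rx a) (rx b), rx (a \<boxtimes> b), Fj a b)" "funit SF = (un, rx (UnitObj C), Fu)"
  "feta SF g a = (rx (g \<star> a), gact g (rx a), Fe g a)"
  by (simp_all add: SF_def)

lemma Isos_I: "iso_arr C f \<Longrightarrow> Dom C f = a \<Longrightarrow> Cod C f = b \<Longrightarrow> f \<in> Isos C a b"
  by (simp add: Isos_iff)

lemma Isos_SC_I: "rarr x y f \<Longrightarrow> iso_arr C f \<Longrightarrow> (x, y, f) \<in> Isos SC x y"
  by (simp add: Isos_iff)

lemma additive_functor_RF: "additive_functor SC C RF"
  apply (intro additive_functor.intro additive_functor_axioms.intro cfunctor.intro cfunctor_axioms.intro
      additive_SC additive_category_axioms category_SC category_axioms)
  subgoal by simp
  subgoal for f by (cases f) (auto simp: rarrD)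
  subgoal by simp
  subgoal for f a b g by (cases f, cases g) simp
  subgoal for f a b g by (cases f, cases g) simp
  done

lemma additive_functor_SF: "additive_functor C SC SF"
  apply (intro additive_functor.intro additive_functor_axioms.intro cfunctor.intro cfunctor_axioms.intro
      additive_SC additive_category_axioms category_SC category_axioms)
  subgoal by simp
  subgoal by (simp add: rarr_Fm)
  subgoal by (simp add: Fm_Ident)
  subgoal by (simp add: Fm_comp)
  subgoal by (simp add: Fm_Add)
  done

lemma crossed_functor_RF: "crossed_monoidal_functor G \<Gamma> act1 act2 SC C RF"
  apply (intro crossed_monoidal_functor.intro crossed_monoidal_functor_axioms.intro
      graded_monoidal_functor.intro graded_monoidal_functor_axioms.intro
      additive_monoidal_functor.intro additive_monoidal_functor_axioms.intro
      crossed_SC crossed_monoidal_category_axioms graded_SC graded_monoidal_category_axioms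
      monoidal_SC additive_monoidal_category_axioms additive_functor_RF)
  subgoal by (simp add: Isos_I)
  subgoal for f a a' k b b' by (cases f, cases k) (auto simp: tm_M rarrD)
  subgoal by (simp add: Isos_I)
  subgoal for a b c using M_assoc[of a b c] by (simp add: Let_def ten_assoc)
  subgoal for a by (simp add: M_left)
  subgoal for a by (simp add: M_right)
  subgoal by simp
  subgoal for g
    by (auto simp: natural_iso_def natural_trans_def comp_functor_def B_am rarrD intro: Isos_I)
  subgoal for g h a by (simp add: Let_def B_mult)
  subgoal for g s a b using B_ten[of g s a b] gact_ten[of g s a b] by (simp add: Let_def)
  done

lemma crossed_functor_SF: "crossed_monoidal_functor G \<Gamma> act1 act2 C SC SF"
  apply (intro crossed_monoidal_functor.intro crossed_monoidal_functor_axioms.intro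
      graded_monoidal_functor.intro graded_monoidal_functor_axioms.intro
      additive_monoidal_functor.intro additive_monoidal_functor_axioms.intro
      crossed_SC crossed_monoidal_category_axioms graded_SC graded_monoidal_category_axioms
      monoidal_SC additive_monoidal_category_axioms additive_functor_SF)
  subgoal by (simp add: Isos_SC_I rarr_Fj)
  subgoal for f a a' k b b' using Fj_nat[of f k] by simp
  subgoal by (simp add: Isos_SC_I rarr_Fu)
  subgoal for a b c using Fj_assoc[of a b c] rarrD(3-)[OF rarr_tm[OF rarr_Ident[of "rx a"] rarr_Fj[of b c]]]
    by (simp add: Let_def ten_assoc)
  subgoal for a using Fj_left[of a] by simp
  subgoal for a using Fj_right[of a] by simp
  subgoal for s a using gr_iso[of s "inv_arr C (th a)"] gr_Obj[of s a] by simp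
  subgoal for g using Fe_nat[of _ g]
    by (auto simp: natural_iso_def natural_trans_def comp_functor_def rarr_Fe intro: Isos_SC_I)
  subgoal for g h a
    using Fe_Chi[of g h a] rarrD(3-)[OF rarr_am[OF rarr_Fe[of h a], of g]] by (simp add: Let_def gact_mult)
  subgoal for g s a b
    using Fe_ActMult[of g s a b] gact_ten[of g s "rx a" "rx b"] gr_iso[of s "inv_arr C (th b)"] gr_Obj[of s b]
      rarrD(3-)[OF rarr_tm[OF rarr_Fe[of "s \<rhd>\<^sub>2 g" a] rarr_Fe[of g b]]]
    by (simp add: Let_def)
  done

lemma iso_RF_SF: "crossed_monoidal_natural_iso G C C (comp_crossed C RF SF) (id_crossed C) th"
proof -
  have e: "g \<star>\<^sub>m th a \<cdot> B g (rx a) \<cdot> Fe g a = th (g \<star> a)" if "g \<in> carrier G" "a \<in> Obj C" for g a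
    using th_Fe that by simp
  show ?thesis
    unfolding crossed_monoidal_natural_iso_def crossed_monoidal_natural_trans_def
      monoidal_natural_trans_def natural_iso_def natural_trans_def comp_crossed_def id_crossed_def
    by (auto simp: th_Fm th_Fj th_Fu e intro: Isos_I)
qed

text \<open>Morphisms of the strict category are morphisms between realizations, so
  \<open>th (R x)\<close> itself, read as a morphism from \<open>rx (R x)\<close> to x, is the
  required component. Its identities are again obtained by cancelling M, U and B.\<close>

lemma iso_SF_RF:
  "crossed_monoidal_natural_iso G SC SC (comp_crossed SC SF RF) (id_crossed SC) (\<lambda>x. (rx (R x), x, th (R x)))"
proof -
  have r: "rarr (rx (R x)) x (th (R x))" if "x \<in> X" for x using that by (simp add: rarr_def)
  note rD [simp] = rarrD(3-)[OF r]
  have tens: "th (R (ten x y)) \<cdot> Fm (M x y) \<cdot> Fj (R x) (R y)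
      = Ident C (R (ten x y)) \<cdot> tm (rx (R x)) x (th (R x)) (rx (R y)) y (th (R y))"
    if [simp]: "x \<in> X" "y \<in> X" for x y
  proof -
    have "tm (rx (R x)) x (th (R x)) (rx (R y)) y (th (R y)) = th (R (ten x y)) \<cdot> Fm (M x y) \<cdot> Fj (R x) (R y)"
    proof (rule tm_eqI)
      have "(th (R (ten x y)) \<cdot> Fm (M x y) \<cdot> Fj (R x) (R y)) \<cdot> M (rx (R x)) (rx (R y))
        = (th (R (ten x y)) \<cdot> Fm (M x y)) \<cdot> Fj (R x) (R y) \<cdot> M (rx (R x)) (rx (R y))" by simp
      also have "\<dots> = M x y \<cdot> th (R x \<boxtimes> R y) \<cdot> Fj (R x) (R y) \<cdot> M (rx (R x)) (rx (R y))"
        by (simp add: th_Fm)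
      finally show "(th (R (ten x y)) \<cdot> Fm (M x y) \<cdot> Fj (R x) (R y)) \<cdot> M (rx (R x)) (rx (R y))
        = M x y \<cdot> (th (R x) \<boxtimes>\<^sub>m th (R y))" by (simp add: th_Fj)
    qed (simp_all add: rarr_def)
    then show ?thesis by simp
  qed
  have unit: "th (R un) \<cdot> Fm U \<cdot> Fu = Ident C (R un)"
  proof (rule iso_cancel_right[of _ U])
    have "(th (R un) \<cdot> Fm U \<cdot> Fu) \<cdot> U = (th (R un) \<cdot> Fm U) \<cdot> Fu \<cdot> U" by simp
    also have "\<dots> = U \<cdot> th (UnitObj C) \<cdot> Fu \<cdot> U" by (simp add: th_Fm)
    finally show "(th (R un) \<cdot> Fm U \<cdot> Fu) \<cdot> U = Ident C (R un) \<cdot> U" by (simp add: th_Fu)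
  qed auto
  have eta: "am g (rx (R x)) x (th (R x)) \<cdot> Fe g (R x) \<cdot> Fm (B g x) = th (R (gact g x))"
    if [simp]: "g \<in> carrier G" "x \<in> X" for g x
  proof (rule iso_cancel_left[of "B g x"])
    note a [simp] = rarrD(3-)[OF rarr_am[OF r]]
    have "B g x \<cdot> am g (rx (R x)) x (th (R x)) \<cdot> Fe g (R x) \<cdot> Fm (B g x)
      = (B g x \<cdot> am g (rx (R x)) x (th (R x))) \<cdot> Fe g (R x) \<cdot> Fm (B g x)" by simp
    also have "\<dots> = (g \<star>\<^sub>m th (R x) \<cdot> B g (rx (R x)) \<cdot> Fe g (R x)) \<cdot> Fm (B g x)"
      using B_am[OF r, of x g] by simp
    also have "\<dots> = th (g \<star> R x) \<cdot> Fm (B g x)" by (simp only: th_Fe R_Obj that)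
    finally show "B g x \<cdot> am g (rx (R x)) x (th (R x)) \<cdot> Fe g (R x) \<cdot> Fm (B g x) = B g x \<cdot> th (R (gact g x))"
      by (simp add: th_Fm)
  qed (use rarrD(3-)[OF rarr_am[OF r]] in auto)
  show ?thesis
    unfolding crossed_monoidal_natural_iso_def crossed_monoidal_natural_trans_def
      monoidal_natural_trans_def natural_iso_def natural_trans_def comp_crossed_def id_crossed_def
    apply (intro conjI ballI allI)
    subgoal by (simp add: r)
    subgoal for a b f by (cases f) (auto simp: th_Fm rarrD)
    subgoal by (simp add: tens)
    subgoal by (simp add: unit)
    subgoal by (simp add: eta)
    subgoal by (simp add: r)
    subgoal for a b f by (cases f) (auto simp: th_Fm rarrD)
    subgoal by (simp add: Isos_SC_I r)
    done
qed

lemma equivalence_SC: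
  "crossed_monoidal_category G \<Gamma> act1 act2 SC" "strictly_crossed G \<Gamma> SC" "strict_monoidal SC"
  "crossed_monoidal_equivalence G \<Gamma> act1 act2 C SC SF"
  unfolding crossed_monoidal_equivalence_def
  using crossed_SC strictly_crossed_SC strict_monoidal_SC crossed_functor_SF crossed_functor_RF
    iso_RF_SF iso_SF_RF by blast+

end

section \<open>Words in formal translates of homogeneous objects\<close>

context crossed_monoidal_category
begin

text \<open>The degree is arbitrary for a zero object. This is harmless: a word with a zero letter
  has zero realization and never occurs in a sum.\<close>

definition hdeg :: "'o \<Rightarrow> 's" where
  "hdeg a = (SOME s. s \<in> carrier \<Gamma> \<and> a \<in> Gr C s)"

definition letter :: "'g \<times> 'o \<Rightarrow> bool" where
  "letter l \<longleftrightarrow> fst l \<in> carrier G \<and> (\<exists>s\<in>carrier \<Gamma>. snd l \<in> Gr C s)"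

definition lobj :: "'g \<times> 'o \<Rightarrow> 'o" where
  "lobj l = fst l \<star> snd l"

definition ldeg :: "'g \<times> 'o \<Rightarrow> 's" where
  "ldeg l = fst l \<rhd>\<^sub>1 hdeg (snd l)"

abbreviation lact :: "'g \<Rightarrow> 'g \<times> 'o \<Rightarrow> 'g \<times> 'o" where
  "lact g l \<equiv> (g \<otimes>\<^bsub>G\<^esub> fst l, snd l)"

text \<open>\<open>Chi\<close> is inverted so that the map runs from the letter acted on formally to
  the actual action on its realization, the direction of B.\<close>

definition lb :: "'g \<Rightarrow> 'g \<times> 'o \<Rightarrow> 'm" where
  "lb g l = inv_arr C (Chi C g (fst l) (snd l))"

abbreviation word :: "('g \<times> 'o) list \<Rightarrow> bool" where
  "word w \<equiv> list_all letter w"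

text \<open>Right-nested and always ending in the unit, so that recursion is uniform. In particular
  a one-letter word is realized by the letter tensored with the unit.\<close>

primrec wobj :: "('g \<times> 'o) list \<Rightarrow> 'o" where
  "wobj [] = UnitObj C"
| "wobj (l # w) = lobj l \<boxtimes> wobj w"

primrec wdeg :: "('g \<times> 'o) list \<Rightarrow> 's" where
  "wdeg [] = \<one>\<^bsub>\<Gamma>\<^esub>"
| "wdeg (l # w) = ldeg l \<otimes>\<^bsub>\<Gamma>\<^esub> wdeg w"

primrec wact :: "'g \<Rightarrow> ('g \<times> 'o) list \<Rightarrow> ('g \<times> 'o) list" where
  "wact g [] = []"
| "wact g (l # w) = lact (wdeg w \<rhd>\<^sub>2 g) l # wact g w"

primrec wm :: "('g \<times> 'o) list \<Rightarrow> ('g \<times> 'o) list \<Rightarrow> 'm" where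
  "wm [] v = LUnit C (wobj v)"
| "wm (l # w) v = (Ident C (lobj l) \<boxtimes>\<^sub>m wm w v) \<cdot> Assoc C (lobj l) (wobj w) (wobj v)"

primrec wb :: "'g \<Rightarrow> ('g \<times> 'o) list \<Rightarrow> 'm" where
  "wb g [] = ActUnit C g"
| "wb g (l # w) = ActMult C g (wdeg w) (lobj l) (wobj w) \<cdot> (lb (wdeg w \<rhd>\<^sub>2 g) l \<boxtimes>\<^sub>m wb g w)"

lemma letterD:
  assumes "letter l"
  shows "fst l \<in> carrier G" "hdeg (snd l) \<in> carrier \<Gamma>" "snd l \<in> Gr C (hdeg (snd l))" "snd l \<in> Obj C"
proof -
  show "fst l \<in> carrier G" using assms by (simp add: letter_def)
  have "\<exists>s. s \<in> carrier \<Gamma> \<and> snd l \<in> Gr C s" using assms by (auto simp: letter_def)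
  from someI_ex[OF this] show h: "hdeg (snd l) \<in> carrier \<Gamma>" "snd l \<in> Gr C (hdeg (snd l))"
    unfolding hdeg_def by auto
  show "snd l \<in> Obj C" using gr_Obj[OF h] .
qed

lemma lobj_in [simp]:
  assumes "letter l"
  shows "lobj l \<in> Obj C" "ldeg l \<in> carrier \<Gamma>" "lobj l \<in> Gr C (ldeg l)"
  using letterD[OF assms] by (simp_all add: lobj_def ldeg_def act_Gr)

lemma letter_lact [simp]: "letter l \<Longrightarrow> g \<in> carrier G \<Longrightarrow> letter (lact g l)"
  by (simp add: letter_def)

lemma ldeg_lact: "letter l \<Longrightarrow> g \<in> carrier G \<Longrightarrow> ldeg (lact g l) = g \<rhd>\<^sub>1 ldeg l"
  using letterD[of l] by (simp add: ldeg_def act1_act1)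

lemma lb_Arr [simp]:
  assumes "letter l" "g \<in> carrier G"
  shows "iso_arr C (lb g l)" "lb g l \<in> Arr C" "Dom C (lb g l) = lobj (lact g l)"
    "Cod C (lb g l) = g \<star> lobj l"
  using letterD[OF assms(1)] assms by (simp_all add: lb_def lobj_def)

text \<open>This is \<open>chi_assoc\<close> with every factor except \<open>Chi g h\<close> moved
  to the other side; composing with the remaining invertible \<open>Chi\<close> reduces the claim to
  it.\<close>

lemma lb_mult:
  assumes [simp]: "letter l" "g \<in> carrier G" "h \<in> carrier G"
  shows "Chi C g h (lobj l) \<cdot> g \<star>\<^sub>m lb h l \<cdot> lb g (lact h l) = lb (g \<otimes>\<^bsub>G\<^esub> h) l"
proof -
  note [simp] = letterD[OF assms(1)] G.m_assoc
  obtain k a where l: "l = (k, a)" by (cases l)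
  have [simp]: "k \<in> carrier G" "a \<in> Obj C" using letterD[OF assms(1)] by (simp_all add: l)
  have "Chi C (g \<otimes>\<^bsub>G\<^esub> h) k a \<cdot> Chi C g h (k \<star> a) \<cdot> g \<star>\<^sub>m lb h l \<cdot> lb g (lact h l)
    = (Chi C (g \<otimes>\<^bsub>G\<^esub> h) k a \<cdot> Chi C g h (k \<star> a)) \<cdot> g \<star>\<^sub>m lb h l \<cdot> lb g (lact h l)"
    by (simp add: l lb_def lobj_def del: act_iso(2))
  also have "\<dots> = (Chi C g (h \<otimes>\<^bsub>G\<^esub> k) a \<cdot> g \<star>\<^sub>m Chi C h k a) \<cdot> g \<star>\<^sub>m lb h l \<cdot> lb g (lact h l)"
    by (simp only: chi_assoc assms \<open>k \<in> carrier G\<close> \<open>a \<in> Obj C\<close>)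
  also have "\<dots> = Ident C ((g \<otimes>\<^bsub>G\<^esub> h \<otimes>\<^bsub>G\<^esub> k) \<star> a)"
    by (simp add: l lb_def lobj_def del: act_iso(2) flip: act_iso(2))
  also have "\<dots> = Chi C (g \<otimes>\<^bsub>G\<^esub> h) k a \<cdot> lb (g \<otimes>\<^bsub>G\<^esub> h) l"
    by (simp add: l lb_def)
  finally have "Chi C g h (k \<star> a) \<cdot> g \<star>\<^sub>m lb h l \<cdot> lb g (lact h l) = lb (g \<otimes>\<^bsub>G\<^esub> h) l"
    by (rule iso_cancel_left) (simp_all add: l lb_def)
  then show ?thesis by (simp add: l lobj_def)
qed

lemma lb_one:
  assumes "letter l"
  shows "lb \<one>\<^bsub>G\<^esub> l = Iota C (lobj l)"
  unfolding lb_def lobj_def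
  by (rule inv_arr_eqI) (use letterD[OF assms] chi_iota_left in simp_all)

lemma wobj_in [simp]:
  assumes "word w"
  shows "wobj w \<in> Obj C" "wdeg w \<in> carrier \<Gamma>" "wobj w \<in> Gr C (wdeg w)"
  using assms by (induction w) (auto simp: unit_Gr_one intro: Gr_TObj)

lemma word_wact [simp]: "word w \<Longrightarrow> g \<in> carrier G \<Longrightarrow> word (wact g w)"
  by (induction w) auto

lemma wdeg_wact [simp]: "word w \<Longrightarrow> g \<in> carrier G \<Longrightarrow> wdeg (wact g w) = g \<rhd>\<^sub>1 wdeg w"
  by (induction w) (auto simp: act1_one act1_mult ldeg_lact)

lemma wdeg_append [simp]: "word w \<Longrightarrow> word v \<Longrightarrow> wdeg (w @ v) = wdeg w \<otimes>\<^bsub>\<Gamma>\<^esub> wdeg v"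
  by (induction w) (auto simp: \<Gamma>.m_assoc)

text \<open>A letter of w sees the rest of w followed by v, so it is twisted by a product of
  degrees, which \<open>act2_act2\<close> splits into two successive twists.\<close>

lemma wact_append:
  "word w \<Longrightarrow> word v \<Longrightarrow> g \<in> carrier G \<Longrightarrow> wact g (w @ v) = wact (wdeg v \<rhd>\<^sub>2 g) w @ wact g v"
  by (induction w) (auto simp: act2_act2)

lemma wact_one: "word w \<Longrightarrow> wact \<one>\<^bsub>G\<^esub> w = w"
  using letterD(1) by (induction w) (auto simp: act2_one)

text \<open>Once \<open>wdeg_wact\<close> gives the degree of the suffix after the first action, the
  matched pair identity \<open>act2_mult\<close> says precisely that the two twists compose.\<close>

lemma wact_wact:
  "word w \<Longrightarrow> g \<in> carrier G \<Longrightarrow> h \<in> carrier G \<Longrightarrow> wact g (wact h w) = wact (g \<otimes>\<^bsub>G\<^esub> h) w"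
  using letterD(1) by (induction w) (auto simp: act2_mult G.m_assoc)

lemma wm_Arr [simp]:
  assumes "word w" "word v"
  shows "iso_arr C (wm w v)" "wm w v \<in> Arr C" "Dom C (wm w v) = wobj w \<boxtimes> wobj v"
    "Cod C (wm w v) = wobj (w @ v)"
  using assms by (induction w) auto

text \<open>The step is \<open>RUnit_tensor\<close>; the base case is the coincidence of the two
  unitors at the unit.\<close>

lemma wm_Nil_right: "word w \<Longrightarrow> wm w [] = RUnit C (wobj w)"
  by (induction w) (auto simp: RUnit_tensor LUnit_eq_RUnit_unit)

text \<open>Induction on the first word: naturality of the left unitor and
  \<open>LUnit_tensor\<close> in the base case, naturality of the associator and the pentagon in the
  step.\<close>

lemma wm_assoc:
  assumes "word w" "word v" "word u"
  shows "wm (w @ v) u \<cdot> (wm w v \<boxtimes>\<^sub>m Ident C (wobj u))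
    = wm w (v @ u) \<cdot> (Ident C (wobj w) \<boxtimes>\<^sub>m wm v u) \<cdot> Assoc C (wobj w) (wobj v) (wobj u)"
  using assms(1)
proof (induction w)
  case Nil
  note [simp] = assms(2,3)
  have "LUnit C (wobj (v @ u)) \<cdot> (Ident C (UnitObj C) \<boxtimes>\<^sub>m wm v u) \<cdot> Assoc C (UnitObj C) (wobj v) (wobj u)
      = (wm v u \<cdot> LUnit C (wobj v \<boxtimes> wobj u)) \<cdot> Assoc C (UnitObj C) (wobj v) (wobj u)"
    by (subst comp_assoc_eq[OF LUnit_nat]) auto
  also have "\<dots> = wm v u \<cdot> (LUnit C (wobj v) \<boxtimes>\<^sub>m Ident C (wobj u))"
    by (simp add: LUnit_tensor)
  finally show ?case by simp
next
  case (Cons l w)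
  note [simp] = assms(2,3)
  have [simp]: "letter l" "word w" using Cons by auto
  let ?l = "lobj l" and ?w = "wobj w" and ?v = "wobj v" and ?u = "wobj u"
  let ?i = "Ident C ?l"
  let ?\<beta> = "Assoc C ?l (?w \<boxtimes> ?v) ?u" and ?\<gamma> = "Assoc C ?l ?w ?v \<boxtimes>\<^sub>m Ident C ?u"
  have "wm ((l # w) @ v) u \<cdot> (wm (l # w) v \<boxtimes>\<^sub>m Ident C ?u)
      = (?i \<boxtimes>\<^sub>m wm (w @ v) u) \<cdot> Assoc C ?l (wobj (w @ v)) ?u \<cdot> ((?i \<boxtimes>\<^sub>m wm w v) \<boxtimes>\<^sub>m Ident C ?u)
        \<cdot> ?\<gamma>"
    by (simp add: tensor_comp)
  also have "\<dots> = (?i \<boxtimes>\<^sub>m wm (w @ v) u) \<cdot> ((?i \<boxtimes>\<^sub>m (wm w v \<boxtimes>\<^sub>m Ident C ?u)) \<cdot> ?\<beta>)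
        \<cdot> ?\<gamma>"
    by (subst comp_assoc_eq[OF assoc_nat]) auto
  also have "\<dots> = (?i \<boxtimes>\<^sub>m (wm (w @ v) u \<cdot> (wm w v \<boxtimes>\<^sub>m Ident C ?u))) \<cdot> ?\<beta>
        \<cdot> ?\<gamma>"
    by (simp add: tensor_comp)
  also have "\<dots> = (?i \<boxtimes>\<^sub>m (wm w (v @ u) \<cdot> (Ident C ?w \<boxtimes>\<^sub>m wm v u))) \<cdot>
      ((?i \<boxtimes>\<^sub>m Assoc C ?w ?v ?u) \<cdot> ?\<beta> \<cdot> ?\<gamma>)"
    using Cons by (simp add: tensor_comp)
  also have "\<dots> = (?i \<boxtimes>\<^sub>m (wm w (v @ u) \<cdot> (Ident C ?w \<boxtimes>\<^sub>m wm v u))) \<cdot>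
      Assoc C ?l ?w (?v \<boxtimes> ?u) \<cdot> Assoc C (?l \<boxtimes> ?w) ?v ?u"
    by (simp only: pentagon wobj_in(1) lobj_in(1) \<open>letter l\<close> \<open>word w\<close> assms)
  also have "\<dots> = (?i \<boxtimes>\<^sub>m wm w (v @ u)) \<cdot> ((?i \<boxtimes>\<^sub>m (Ident C ?w \<boxtimes>\<^sub>m wm v u)) \<cdot>
      Assoc C ?l ?w (?v \<boxtimes> ?u)) \<cdot> Assoc C (?l \<boxtimes> ?w) ?v ?u"
    by (simp add: tensor_comp)
  also have "(?i \<boxtimes>\<^sub>m (Ident C ?w \<boxtimes>\<^sub>m wm v u)) \<cdot> Assoc C ?l ?w (?v \<boxtimes> ?u)
      = Assoc C ?l ?w (wobj (v @ u)) \<cdot> (Ident C (?l \<boxtimes> ?w) \<boxtimes>\<^sub>m wm v u)"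
    using assoc_nat[of ?i "Ident C ?w" "wm v u" ?l ?w "wobj (v @ u)"] by simp
  finally show ?case by simp
qed

lemma wb_Arr [simp]:
  assumes "word w" "g \<in> carrier G"
  shows "iso_arr C (wb g w)" "wb g w \<in> Arr C" "Dom C (wb g w) = wobj (wact g w)"
    "Cod C (wb g w) = g \<star> wobj w"
  using assms by (induction w) auto

lemma wobj_wact_Gr [simp]: "word w \<Longrightarrow> g \<in> carrier G \<Longrightarrow> wobj (wact g w) \<in> Gr C (g \<rhd>\<^sub>1 wdeg w)"
  using wobj_in(3)[of "wact g w"] by simp

lemma wb_one: "word w \<Longrightarrow> wb \<one>\<^bsub>G\<^esub> w = Iota C (wobj w)"
proof (induction w)
  case (Cons l w)
  then show ?case using Iota_ActMult[of "wdeg w" "lobj l" "wobj w"] by (simp add: act2_one lb_one)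
qed (simp add: Iota_ActUnit)

text \<open>Induction on the word: \<open>Chi_ActUnit\<close> for the empty word, and in the step
  naturality of \<open>ActMult\<close> followed by \<open>Chi_ActMult\<close>, with
  \<open>lb_mult\<close> for the first letter.\<close>

lemma wb_mult:
  assumes "word w" and g [simp]: "g \<in> carrier G" "h \<in> carrier G"
  shows "Chi C g h (wobj w) \<cdot> g \<star>\<^sub>m wb h w \<cdot> wb g (wact h w) = wb (g \<otimes>\<^bsub>G\<^esub> h) w"
  using assms(1)
proof (induction w)
  case Nil
  then show ?case by (simp add: Chi_ActUnit)
next
  case (Cons l w)
  have [simp]: "letter l" "word w" using Cons by auto
  let ?s = "wdeg w" and ?l = "lobj l" and ?w = "wobj w"
  let ?h = "?s \<rhd>\<^sub>2 h" and ?g = "(h \<rhd>\<^sub>1 ?s) \<rhd>\<^sub>2 g"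
  \<comment> \<open>The twist of a product is the product of the twists, the outer one taken at the
    degree after the inner action.\<close>
  have gh: "?s \<rhd>\<^sub>2 (g \<otimes>\<^bsub>G\<^esub> h) = ?g \<otimes>\<^bsub>G\<^esub> ?h" by (simp add: act2_mult)
  let ?X = "Chi C g h (?l \<boxtimes> ?w)" and ?J = "g \<star>\<^sub>m ActMult C h ?s ?l ?w"
  let ?K = "ActMult C g (h \<rhd>\<^sub>1 ?s) (?h \<star> ?l) (h \<star> ?w)"
  note [simp] = act_Gr
  have "Chi C g h (wobj (l # w)) \<cdot> g \<star>\<^sub>m wb h (l # w) \<cdot> wb g (wact h (l # w))
    = ?X \<cdot> ?J \<cdot> (g \<star>\<^sub>m (lb ?h l \<boxtimes>\<^sub>m wb h w) \<cdot>
        ActMult C g (h \<rhd>\<^sub>1 ?s) (lobj (lact ?h l)) (wobj (wact h w))) \<cdot>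
        (lb ?g (lact ?h l) \<boxtimes>\<^sub>m wb g (wact h w))"
    by (simp add: act_comp)
  also have "\<dots> = ?X \<cdot> ?J \<cdot> (?K \<cdot> (?g \<star>\<^sub>m lb ?h l \<boxtimes>\<^sub>m g \<star>\<^sub>m wb h w)) \<cdot>
        (lb ?g (lact ?h l) \<boxtimes>\<^sub>m wb g (wact h w))"
    using ActMult_nat[of g "h \<rhd>\<^sub>1 ?s" "lb ?h l" "wb h w" "h \<star> ?w" "?h \<star> ?l"] by simp
  also have "\<dots> = (?X \<cdot> ?J \<cdot> ?K) \<cdot> ((?g \<star>\<^sub>m lb ?h l \<cdot> lb ?g (lact ?h l)) \<boxtimes>\<^sub>m (g \<star>\<^sub>m wb h w \<cdot> wb g (wact h w)))"
    by (simp add: tensor_comp)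
  also have "\<dots> = (ActMult C (g \<otimes>\<^bsub>G\<^esub> h) ?s ?l ?w \<cdot> (Chi C ?g ?h ?l \<boxtimes>\<^sub>m Chi C g h ?w)) \<cdot>
      ((?g \<star>\<^sub>m lb ?h l \<cdot> lb ?g (lact ?h l)) \<boxtimes>\<^sub>m (g \<star>\<^sub>m wb h w \<cdot> wb g (wact h w)))"
    by (subst Chi_ActMult) auto
  also have "\<dots> = ActMult C (g \<otimes>\<^bsub>G\<^esub> h) ?s ?l ?w \<cdot>
      ((Chi C ?g ?h ?l \<cdot> ?g \<star>\<^sub>m lb ?h l \<cdot> lb ?g (lact ?h l)) \<boxtimes>\<^sub>m (Chi C g h ?w \<cdot> g \<star>\<^sub>m wb h w \<cdot> wb g (wact h w)))"
    by (simp add: tensor_comp flip: gh)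
  also have "\<dots> = wb (g \<otimes>\<^bsub>G\<^esub> h) (l # w)"
    using Cons lb_mult[of l ?g ?h] by (simp add: gh)
  finally show ?case .
qed

text \<open>Induction on the first word: the base case is \<open>ActMult_unit_left\<close>, and in
  the step \<open>ActMult_assoc\<close> moves the first letter out so that the hypothesis applies to
  the rest.\<close>

lemma wb_append:
  assumes "word w" and v [simp]: "word v" "g \<in> carrier G"
  shows "g \<star>\<^sub>m wm w v \<cdot> ActMult C g (wdeg v) (wobj w) (wobj v) \<cdot> (wb (wdeg v \<rhd>\<^sub>2 g) w \<boxtimes>\<^sub>m wb g v)
    = wb g (w @ v) \<cdot> wm (wact (wdeg v \<rhd>\<^sub>2 g) w) (wact g v)"
  using assms(1)
proof (induction w)
  case Nil
  let ?s = "wdeg v" and ?v = "wobj v"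
  have "g \<star>\<^sub>m LUnit C ?v \<cdot> ActMult C g ?s (UnitObj C) ?v \<cdot> (ActUnit C (?s \<rhd>\<^sub>2 g) \<boxtimes>\<^sub>m wb g v)
    = (g \<star>\<^sub>m LUnit C ?v \<cdot> ActMult C g ?s (UnitObj C) ?v \<cdot> (ActUnit C (?s \<rhd>\<^sub>2 g) \<boxtimes>\<^sub>m Ident C (g \<star> ?v)))
        \<cdot> (Ident C (UnitObj C) \<boxtimes>\<^sub>m wb g v)"
    by (simp add: tensor_comp)
  also have "\<dots> = LUnit C (g \<star> ?v) \<cdot> (Ident C (UnitObj C) \<boxtimes>\<^sub>m wb g v)"
    by (subst ActMult_unit_left) auto
  also have "\<dots> = wb g v \<cdot> LUnit C (wobj (wact g v))" by (simp add: LUnit_nat)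
  finally show ?case by simp
next
  case (Cons l w)
  have [simp]: "letter l" "word w" using Cons by auto
  let ?s = "wdeg w" and ?t = "wdeg v" and ?l = "lobj l" and ?w = "wobj w" and ?v = "wobj v"
  let ?h = "?t \<rhd>\<^sub>2 g" and ?k = "(?s \<otimes>\<^bsub>\<Gamma>\<^esub> ?t) \<rhd>\<^sub>2 g"
  \<comment> \<open>The letter l is twisted by the degree of everything to its right, that is of w
    followed by v.\<close>
  have k: "?s \<rhd>\<^sub>2 ?h = ?k" by (simp add: act2_act2)
  let ?c = "lb ?k l" and ?l' = "lobj (lact ?k l)"
  let ?I = "Ident C ?l"
  let ?\<alpha> = "Assoc C ?l' (wobj (wact ?h w)) (wobj (wact g v))" and ?K = "Ident C (?k \<star> ?l)"
    and ?J = "ActMult C g (?s \<otimes>\<^bsub>\<Gamma>\<^esub> ?t) ?l (wobj (w @ v))"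
  have GrWV [simp]: "?w \<boxtimes> ?v \<in> Gr C (?s \<otimes>\<^bsub>\<Gamma>\<^esub> ?t)" by (intro Gr_TObj) auto
  have GrWV' [simp]: "wobj (w @ v) \<in> Gr C (?s \<otimes>\<^bsub>\<Gamma>\<^esub> ?t)" using wobj_in(3)[of "w @ v"] by simp
  have "g \<star>\<^sub>m wm (l # w) v \<cdot> ActMult C g ?t (wobj (l # w)) ?v \<cdot> (wb ?h (l # w) \<boxtimes>\<^sub>m wb g v)
    = g \<star>\<^sub>m (?I \<boxtimes>\<^sub>m wm w v) \<cdot> (g \<star>\<^sub>m Assoc C ?l ?w ?v \<cdot> ActMult C g ?t (?l \<boxtimes> ?w) ?v
        \<cdot> (ActMult C ?h ?s ?l ?w \<boxtimes>\<^sub>m Ident C (g \<star> ?v))) \<cdot> ((?c \<boxtimes>\<^sub>m wb ?h w) \<boxtimes>\<^sub>m wb g v)"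
    by (simp add: act_comp tensor_comp k)
  also have "\<dots> = g \<star>\<^sub>m (?I \<boxtimes>\<^sub>m wm w v) \<cdot> (ActMult C g (?s \<otimes>\<^bsub>\<Gamma>\<^esub> ?t) ?l (?w \<boxtimes> ?v)
        \<cdot> (?K \<boxtimes>\<^sub>m ActMult C g ?t ?w ?v) \<cdot> Assoc C (?k \<star> ?l) (?h \<star> ?w) (g \<star> ?v))
        \<cdot> ((?c \<boxtimes>\<^sub>m wb ?h w) \<boxtimes>\<^sub>m wb g v)"
    by (subst ActMult_assoc) auto
  also have "\<dots> = (g \<star>\<^sub>m (?I \<boxtimes>\<^sub>m wm w v) \<cdot> ActMult C g (?s \<otimes>\<^bsub>\<Gamma>\<^esub> ?t) ?l (?w \<boxtimes> ?v))
        \<cdot> (?K \<boxtimes>\<^sub>m ActMult C g ?t ?w ?v) \<cdot> (?c \<boxtimes>\<^sub>m (wb ?h w \<boxtimes>\<^sub>m wb g v))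
        \<cdot> ?\<alpha>"
    by (simp add: assoc_nat)
  also have "\<dots> = (?J \<cdot> (?K \<boxtimes>\<^sub>m g \<star>\<^sub>m wm w v))
        \<cdot> (?K \<boxtimes>\<^sub>m ActMult C g ?t ?w ?v) \<cdot> (?c \<boxtimes>\<^sub>m (wb ?h w \<boxtimes>\<^sub>m wb g v))
        \<cdot> ?\<alpha>"
    using ActMult_nat[of g "?s \<otimes>\<^bsub>\<Gamma>\<^esub> ?t" ?I "wm w v" "wobj (w @ v)" ?l] by simp
  also have "\<dots> = ?J
        \<cdot> (?c \<boxtimes>\<^sub>m (g \<star>\<^sub>m wm w v \<cdot> ActMult C g ?t ?w ?v \<cdot> (wb ?h w \<boxtimes>\<^sub>m wb g v)))
        \<cdot> ?\<alpha>"
    by (simp add: tensor_comp)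
  also have "\<dots> = ?J
        \<cdot> (?c \<boxtimes>\<^sub>m (wb g (w @ v) \<cdot> wm (wact ?h w) (wact g v)))
        \<cdot> ?\<alpha>"
    using Cons by simp
  also have "\<dots> = wb g ((l # w) @ v) \<cdot> wm (wact ?h (l # w)) (wact g v)"
    by (simp add: tensor_comp k wact_append)
  finally show ?case .
qed

end

section \<open>Products of formal sums of words\<close>

text \<open>Summands carry labels, so that the reindexing bijections of an iterated product can be
  compared; words violating N (those with zero realization) are dropped.\<close>

definition row :: "('w list \<Rightarrow> bool) \<Rightarrow> 'a \<Rightarrow> 'w list \<Rightarrow> ('b \<times> 'w list) list \<Rightarrow> (('a \<times> 'b) \<times> 'w list) list" where
  "row N a w Y = filter (N \<circ> snd) (map (\<lambda>(b, v). ((a, b), w @ v)) Y)"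

lemma row_simps [simp]:
  "row N a w [] = []"
  "row N a w ((b, v) # Y) = (if N (w @ v) then ((a, b), w @ v) # row N a w Y else row N a w Y)"
  "row N a w (Y @ Y') = row N a w Y @ row N a w Y'"
  by (simp_all add: row_def)

primrec ltens :: "('w list \<Rightarrow> bool) \<Rightarrow> ('a \<times> 'w list) list \<Rightarrow> ('b \<times> 'w list) list
    \<Rightarrow> (('a \<times> 'b) \<times> 'w list) list" where
  "ltens N [] Y = []"
| "ltens N (x # X) Y = row N (fst x) (snd x) Y @ ltens N X Y"

lemma ltens_append: "ltens N (X @ X') Y = ltens N X Y @ ltens N X' Y"
  by (induction X) auto

text \<open>Ensures that dropping early and dropping late agree: a word dropped from an inner
  product could only have contributed dropped words to the outer one.\<close>

definition factor_closed :: "('w list \<Rightarrow> bool) \<Rightarrow> bool" where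
  "factor_closed N \<longleftrightarrow> (\<forall>w v. N (w @ v) \<longrightarrow> N w \<and> N v)"

abbreviation reassoc :: "(('a \<times> 'b) \<times> 'c) \<times> 'w \<Rightarrow> ('a \<times> ('b \<times> 'c)) \<times> 'w" where
  "reassoc \<equiv> \<lambda>(((a, b), c), w). ((a, (b, c)), w)"

text \<open>If w @ v is dropped, then so is every w @ v @ u, which makes this row empty, in
  agreement with the other bracketing. Otherwise only the labels are bracketed differently.\<close>

lemma row_row:
  assumes "factor_closed N"
  shows "row N a w (row N b v Z) = (if N (w @ v) then map reassoc (row N (a, b) (w @ v) Z) else [])"
proof (induction Z)
  case (Cons z Z)
  obtain c u where z: "z = (c, u)" by (cases z)
  have "N (w @ v @ u) \<Longrightarrow> N (v @ u)" "N (w @ v @ u) \<Longrightarrow> N (w @ v)"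
    using assms unfolding factor_closed_def by (metis append.assoc)+
  then show ?case using Cons by (auto simp: z)
qed simp

lemma ltens_row:
  assumes "factor_closed N"
  shows "map reassoc (ltens N (row N a w Y) Z) = row N a w (ltens N Y Z)"
proof (induction Y)
  case (Cons y Y)
  obtain b v where y: "y = (b, v)" by (cases y)
  show ?case using Cons by (simp add: y row_row[OF assms])
qed simp

text \<open>Both bracketings list the triples of summands in lexicographic order and keep the same
  ones.\<close>

lemma ltens_assoc:
  assumes "factor_closed N"
  shows "map reassoc (ltens N (ltens N X Y) Z) = ltens N X (ltens N Y Z)"
  by (induction X) (auto simp: ltens_append ltens_row[OF assms])

lemma row_map:
  assumes "\<And>b v. (b, v) \<in> set Y \<Longrightarrow> f w @ f' v = g (w @ v) \<and> N (g (w @ v)) = N (w @ v)"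
  shows "row N (p a) (f w) (map (map_prod q f') Y) = map (map_prod (map_prod p q) g) (row N a w Y)"
  using assms
proof (induction Y)
  case (Cons y Y)
  obtain b v where y: "y = (b, v)" by (cases y)
  have h: "f w @ f' v = g (w @ v)" "N (g (w @ v)) = N (w @ v)" using Cons.prems[of b v] by (simp_all add: y)
  have "row N (p a) (f w) (map (map_prod q f') Y) = map (map_prod (map_prod p q) g) (row N a w Y)"
    by (rule Cons.IH) (use Cons.prems in auto)
  then show ?case by (simp add: y h)
qed simp

text \<open>Covers both a change of labels (p and q) and the group action on words, where f and f'
  differ because the left factor is acted on by a twisted element.\<close>

lemma ltens_map:
  assumes "\<And>a w b v. (a, w) \<in> set X \<Longrightarrow> (b, v) \<in> set Y \<Longrightarrow>
    f w @ f' v = g (w @ v) \<and> N (g (w @ v)) = N (w @ v)"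
  shows "ltens N (map (map_prod p f) X) (map (map_prod q f') Y)
    = map (map_prod (map_prod p q) g) (ltens N X Y)"
  using assms
proof (induction X)
  case (Cons x X)
  obtain a w where x: "x = (a, w)" by (cases x)
  have "row N (p a) (f w) (map (map_prod q f') Y) = map (map_prod (map_prod p q) g) (row N a w Y)"
    by (rule row_map) (use Cons.prems in \<open>auto simp: x\<close>)
  moreover have "ltens N (map (map_prod p f) X) (map (map_prod q f') Y)
    = map (map_prod (map_prod p q) g) (ltens N X Y)"
    by (rule Cons.IH) (use Cons.prems in auto)
  ultimately show ?case by (simp add: x)
qed simp

lemma set_ltens:
  "set (ltens N X Y) = {((a, b), w @ v) | a b w v. (a, w) \<in> set X \<and> (b, v) \<in> set Y \<and> N (w @ v)}"
  by (induction X) (fastforce simp: row_def)+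

text \<open>Makes the lookup of labels injective, as \<open>coproduct_matching\<close> requires of
  \<sigma>.\<close>

lemma distinct_ltens:
  assumes "distinct (map fst X)" "distinct (map fst Y)"
  shows "distinct (map fst (ltens N X Y))"
  using assms(1)
proof (induction X)
  case (Cons x X)
  obtain a w where x: "x = (a, w)" by (cases x)
  have f: "map fst (row N a w Y) = map (Pair a) (map fst (filter (\<lambda>(b, v). N (w @ v)) Y))" for Y
    by (induction Y) auto
  have "distinct (map fst (row N a w Y))"
    unfolding f distinct_map[of "Pair a"] using distinct_map_filter[OF assms(2)] by (simp add: inj_on_def)
  moreover have "fst ` set (row N a w Y) \<inter> fst ` set (ltens N X Y) = {}"
    using Cons.prems by (force simp: x row_def set_ltens)
  ultimately show ?case using Cons by (simp add: x)
qed simp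

text \<open>Aligned with \<open>tens\<close>, since both are projections of one labelled product:
  entry n gives the positions in x and y from which summand n of the product arises.\<close>

definition pairs :: "('w list \<Rightarrow> bool) \<Rightarrow> 'w list list \<Rightarrow> 'w list list \<Rightarrow> (nat \<times> nat) list" where
  "pairs N x y = map fst (ltens N (enumerate 0 x) (enumerate 0 y))"

definition tens :: "('w list \<Rightarrow> bool) \<Rightarrow> 'w list list \<Rightarrow> 'w list list \<Rightarrow> 'w list list" where
  "tens N x y = map snd (ltens N (enumerate 0 x) (enumerate 0 y))"

lemma length_pairs [simp]: "length (pairs N x y) = length (tens N x y)"
  by (simp add: pairs_def tens_def)

lemma distinct_pairs: "distinct (pairs N x y)"
  unfolding pairs_def by (rule distinct_ltens) simp_all

lemma pairs_nth:
  assumes "n < length (tens N x y)" "pairs N x y ! n = (j, k)"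
  shows "j < length x" "k < length y" "tens N x y ! n = x ! j @ y ! k" "N (x ! j @ y ! k)"
proof -
  let ?L = "ltens N (enumerate 0 x) (enumerate 0 y)"
  have n: "n < length ?L" using assms by (simp add: tens_def)
  have "?L ! n \<in> set ?L" using n by (rule nth_mem)
  moreover have "?L ! n = ((j, k), tens N x y ! n)"
    using assms n by (metis nth_map pairs_def prod.collapse tens_def)
  ultimately show "j < length x" "k < length y" "tens N x y ! n = x ! j @ y ! k" "N (x ! j @ y ! k)"
    by (auto simp: set_ltens in_set_enumerate_eq)
qed

lemma pairs_ex:
  assumes "j < length x" "k < length y" "N (x ! j @ y ! k)"
  obtains n where "n < length (tens N x y)" "pairs N x y ! n = (j, k)"
proof -
  have "((j, k), x ! j @ y ! k) \<in> set (ltens N (enumerate 0 x) (enumerate 0 y))"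
    using assms by (auto simp: set_ltens in_set_enumerate_eq)
  then have "(j, k) \<in> set (pairs N x y)" unfolding pairs_def by force
  then show thesis using that by (auto simp: in_set_conv_nth)
qed

lemma tens_in: "w \<in> set (tens N x y) \<Longrightarrow> N w"
  by (auto simp: tens_def set_ltens)

text \<open>An iterated product renumbers its intermediate list from 0; looking the numbers up in
  the list of labels restores the original ones.\<close>

lemma map_labels: "map (map_prod ((!) (map fst L)) id) (enumerate 0 (map snd L)) = L"
  by (rule nth_equalityI) (auto simp: nth_enumerate_eq)

lemma ltens_labels_left:
  "map (map_prod (map_prod ((!) (map fst L)) id) id) (ltens N (enumerate 0 (map snd L)) Y) = ltens N L Y"
  using ltens_map[of "enumerate 0 (map snd L)" Y id id id N "(!) (map fst L)" id]
  by (simp add: map_labels prod.map_id0)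

lemma ltens_labels_right:
  "map (map_prod (map_prod id ((!) (map fst L))) id) (ltens N X (enumerate 0 (map snd L))) = ltens N X L"
  using ltens_map[of X "enumerate 0 (map snd L)" id id id N id "(!) (map fst L)"]
  by (simp add: map_labels prod.map_id0)

lemma ltens_tens_assoc:
  assumes "factor_closed N"
  shows "map reassoc (map (map_prod (map_prod ((!) (pairs N x y)) id) id)
      (ltens N (enumerate 0 (tens N x y)) (enumerate 0 z)))
    = map (map_prod (map_prod id ((!) (pairs N y z))) id)
      (ltens N (enumerate 0 x) (enumerate 0 (tens N y z)))"
  unfolding pairs_def tens_def ltens_labels_left ltens_labels_right by (rule ltens_assoc[OF assms])

lemma tens_assoc:
  assumes "factor_closed N"
  shows "tens N (tens N x y) z = tens N x (tens N y z)"
proof -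
  have "map snd (map reassoc (map (map_prod (map_prod p id) id) L)) = map snd L" for p L
    by (auto simp: case_prod_unfold)
  moreover have "map snd (map (map_prod (map_prod id p) id) L) = map snd L" for p L
    by auto
  ultimately show ?thesis
    using arg_cong[OF ltens_tens_assoc[OF assms], of "map snd" x y z] 
    by (metis tens_def)
qed

text \<open>Compares the labels at position q in \<open>ltens_tens_assoc\<close>. The equality of
  the lists of words alone would not tell that the summand at q arises from the same triple (j, k,
  l), as equal words may occur repeatedly.\<close>

lemma pairs_assoc:
  assumes "factor_closed N" "q < length (tens N (tens N x y) z)"
    "pairs N (tens N x y) z ! q = (n, l)" "pairs N x y ! n = (j, k)"
  obtains n' where "pairs N x (tens N y z) ! q = (j, n')" "pairs N y z ! n' = (k, l)"
proof -
  let ?A = "ltens N (enumerate 0 (tens N x y)) (enumerate 0 z)"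
  let ?B = "ltens N (enumerate 0 x) (enumerate 0 (tens N y z))"
  have A: "q < length ?A" using assms(2) by (simp add: tens_def)
  have B: "q < length ?B" using assms(2) unfolding tens_assoc[OF assms(1)] by (simp add: tens_def)
  have a: "fst (?A ! q) = (n, l)" using assms(3) A by (simp add: pairs_def)
  obtain j' n' where b: "fst (?B ! q) = (j', n')" by (cases "fst (?B ! q)")
  then have b': "pairs N x (tens N y z) ! q = (j', n')" using B by (simp add: pairs_def)
  have "fst (reassoc (map_prod (map_prod ((!) (pairs N x y)) id) id (?A ! q)))
    = fst (map_prod (map_prod id ((!) (pairs N y z))) id (?B ! q))"
    using arg_cong[OF ltens_tens_assoc[OF assms(1), of x y z], of "\<lambda>L. fst (L ! q)"] A B by simp
  then have "(j, (k, l)) = (j', pairs N y z ! n')"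
    using a b assms(4) by (cases "?A ! q"; cases "?B ! q") auto
  then show thesis using that[of n'] b' by simp
qed

lemma pairs_tens_map:
  assumes "\<And>w v. w \<in> set x \<Longrightarrow> v \<in> set y \<Longrightarrow> f w @ f' v = g (w @ v) \<and> N (g (w @ v)) = N (w @ v)"
  shows "tens N (map f x) (map f' y) = map g (tens N x y)" "pairs N (map f x) (map f' y) = pairs N x y"
proof -
  have e: "enumerate 0 (map f x) = map (map_prod id f) (enumerate 0 x)" for f :: "'a list \<Rightarrow> 'b list" and x
    by (rule nth_equalityI) (auto simp: nth_enumerate_eq)
  have "ltens N (enumerate 0 (map f x)) (enumerate 0 (map f' y))
    = map (map_prod (map_prod id id) g) (ltens N (enumerate 0 x) (enumerate 0 y))"
    unfolding e by (rule ltens_map) (use assms in \<open>auto simp: in_set_enumerate_eq\<close>)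
  then show "tens N (map f x) (map f' y) = map g (tens N x y)" "pairs N (map f x) (map f' y) = pairs N x y"
    by (simp_all add: tens_def pairs_def prod.map_id0)
qed

lemma tens_unit_left:
  assumes "N []" "\<And>w. w \<in> set x \<Longrightarrow> N w"
  shows "tens N [[]] x = x" "n < length x \<Longrightarrow> pairs N [[]] x ! n = (0, n)"
proof -
  have r: "row N a [] Y = map (\<lambda>(b, v). ((a, b), v)) Y" if "\<And>w. w \<in> snd ` set Y \<Longrightarrow> N w" for a :: nat and Y :: "(nat \<times> _) list"
    using that by (induction Y) auto
  have "ltens N (enumerate 0 [[]]) (enumerate 0 x) = map (\<lambda>(b, v). ((0, b), v)) (enumerate 0 x)"
    using r[of "enumerate 0 x" 0] assms(2) by (force simp: in_set_enumerate_eq)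
  then have e: "ltens N (enumerate 0 [[]]) (enumerate 0 x) = map (\<lambda>(b, v). ((0, b), v)) (enumerate 0 x)" .
  show "tens N [[]] x = x" unfolding tens_def e
    by (rule nth_equalityI) (auto simp: nth_enumerate_eq)
  show "n < length x \<Longrightarrow> pairs N [[]] x ! n = (0, n)" unfolding pairs_def e
    by (simp add: nth_enumerate_eq)
qed

lemma tens_unit_right:
  assumes "N []" "\<And>w. w \<in> set x \<Longrightarrow> N w"
  shows "tens N x [[]] = x" "n < length x \<Longrightarrow> pairs N x [[]] ! n = (n, 0)"
proof -
  have e: "ltens N X (enumerate 0 [[]]) = map (\<lambda>(b, v). ((b, 0), v)) X"
    if "\<And>w. w \<in> snd ` set X \<Longrightarrow> N w" for X :: "(nat \<times> _) list"
    using that by (induction X) auto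
  have e: "ltens N (enumerate 0 x) (enumerate 0 [[]]) = map (\<lambda>(b, v). ((b, 0), v)) (enumerate 0 x)"
    by (rule e) (use assms(2) in \<open>auto simp: in_set_enumerate_eq\<close>)
  show "tens N x [[]] = x" unfolding tens_def e
    by (rule nth_equalityI) (auto simp: nth_enumerate_eq)
  show "n < length x \<Longrightarrow> pairs N x [[]] ! n = (n, 0)" unfolding pairs_def e
    by (simp add: nth_enumerate_eq)
qed

section \<open>Formal sums of nonzero words and their realizations in C\<close>

context crossed_monoidal_category
begin

definition nzw :: "('g \<times> 'o) list \<Rightarrow> bool" where
  "nzw w \<longleftrightarrow> word w \<and> \<not> zero_obj C (wobj w)"

definition sums :: "('o, 'g) strict_obj set" where
  "sums = {x. \<forall>w\<in>set x. nzw w}"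

abbreviation sten :: "('o, 'g) strict_obj \<Rightarrow> ('o, 'g) strict_obj \<Rightarrow> ('o, 'g) strict_obj" where
  "sten \<equiv> tens nzw"

text \<open>This is the sum with the empty word as its only summand, unless the unit of C is zero;
  then it is the empty sum.\<close>

definition sun :: "('o, 'g) strict_obj" where
  "sun = filter nzw [[]]"

abbreviation sact :: "'g \<Rightarrow> ('o, 'g) strict_obj \<Rightarrow> ('o, 'g) strict_obj" where
  "sact g \<equiv> map (wact g)"

definition bip :: "('o, 'g) strict_obj \<Rightarrow> 'o \<times> (nat \<Rightarrow> 'm) \<times> (nat \<Rightarrow> 'm)" where
  "bip x = (SOME t. biproduct C (length x) (\<lambda>k. wobj (x ! k)) (fst t) (fst (snd t)) (snd (snd t)))"

definition robj :: "('o, 'g) strict_obj \<Rightarrow> 'o" where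
  "robj x = fst (bip x)"

definition inc :: "('o, 'g) strict_obj \<Rightarrow> nat \<Rightarrow> 'm" where
  "inc x = fst (snd (bip x))"

definition prj :: "('o, 'g) strict_obj \<Rightarrow> nat \<Rightarrow> 'm" where
  "prj x = snd (snd (bip x))"

lemma nzw_word [simp]: "nzw w \<Longrightarrow> word w"
  by (simp add: nzw_def)

lemma sums_word [simp]: "x \<in> sums \<Longrightarrow> k < length x \<Longrightarrow> word (x ! k)"
  by (simp add: sums_def nzw_def)

lemma sums_nzw: "x \<in> sums \<Longrightarrow> k < length x \<Longrightarrow> nzw (x ! k)"
  by (simp add: sums_def)

text \<open>The isomorphism \<open>wm\<close> identifies the realization of w @ v with a tensor
  product, which is zero as soon as one factor is.\<close>

lemma nzw_closed: "factor_closed nzw"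
  unfolding factor_closed_def
proof (intro allI impI)
  fix w v assume *: "nzw (w @ v)"
  then have [simp]: "word w" "word v" by (auto simp: nzw_def)
  have "zero_obj C (wobj w \<boxtimes> wobj v) \<longleftrightarrow> zero_obj C (wobj (w @ v))"
    using zero_obj_iso[of "wm w v"] by simp
  then show "nzw w \<and> nzw v" using * zero_obj_tensor[of "wobj w" "wobj v"] by (auto simp: nzw_def)
qed

lemma zero_obj_wact:
  assumes "word w" "g \<in> carrier G" "zero_obj C (wobj w)"
  shows "zero_obj C (wobj (wact g w))"
  using zero_obj_iso[of "wb g w"] zero_obj_act[of g "wobj w"] assms by simp

text \<open>The action preserves zero realizations, and acting with the inverse element gives the
  converse.\<close>

lemma nzw_wact [simp]:
  assumes "word w" "g \<in> carrier G"
  shows "nzw (wact g w) \<longleftrightarrow> nzw w"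
proof -
  have "wact (inv\<^bsub>G\<^esub> g) (wact g w) = w" using assms by (simp add: wact_wact wact_one)
  then show ?thesis
    using zero_obj_wact[of w g] zero_obj_wact[of "wact g w" "inv\<^bsub>G\<^esub> g"] assms by (auto simp: nzw_def)
qed

lemma sten_in [simp]: "sten x y \<in> sums"
  by (auto simp: sums_def tens_in)

lemma sun_in [simp]: "sun \<in> sums"
  by (simp add: sums_def sun_def)

lemma sun_eq: "nzw [] \<Longrightarrow> sun = [[]]"
  by (simp add: sun_def)

lemma sact_in [simp]: "x \<in> sums \<Longrightarrow> g \<in> carrier G \<Longrightarrow> sact g x \<in> sums"
  by (auto simp: sums_def)

lemma biproduct_sums:
  assumes "x \<in> sums"
  shows "biproduct C (length x) (\<lambda>k. wobj (x ! k)) (robj x) (inc x) (prj x)"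
proof -
  obtain y where "direct_sum C (length x) (\<lambda>k. wobj (x ! k)) y"
    using direct_sum_exists[of "length x" "\<lambda>k. wobj (x ! k)"] assms by auto
  then have "\<exists>t. biproduct C (length x) (\<lambda>k. wobj (x ! k)) (fst t) (fst (snd t)) (snd (snd t))"
    by (auto simp: direct_sum_iff)
  from someI_ex[OF this] show ?thesis unfolding robj_def inc_def prj_def bip_def .
qed

lemma inc_Arr [simp]:
  assumes "x \<in> sums" "k < length x"
  shows "inc x k \<in> Arr C" "Dom C (inc x k) = wobj (x ! k)" "Cod C (inc x k) = robj x"
    "prj x k \<in> Arr C" "Dom C (prj x k) = robj x" "Cod C (prj x k) = wobj (x ! k)"
    "prj x k \<cdot> inc x k = Ident C (wobj (x ! k))"
  using biproduct_sums[OF assms(1)] assms(2) by (simp_all add: biproduct_def)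

lemma robj_in [simp]: "x \<in> sums \<Longrightarrow> robj x \<in> Obj C"
  using biproduct_sums[of x] by (simp add: biproduct_def)

lemma coproduct_sums:
  "x \<in> sums \<Longrightarrow> coproduct C {..<length x} (\<lambda>k. wobj (x ! k)) (robj x) (inc x)"
  by (rule biproduct_coproduct[OF biproduct_sums])

text \<open>Each word is a retract of the realization through \<open>inc\<close> and
  \<open>prj\<close>. A degree other than s would make it zero, which \<open>nzw\<close> excludes. A
  sum with zero realization is empty, so there the claim is vacuous for every s.\<close>

lemma wdeg_eq:
  assumes "x \<in> sums" "s \<in> carrier \<Gamma>" "robj x \<in> Gr C s" "k < length x"
  shows "wdeg (x ! k) = s"
proof (rule ccontr)
  assume "wdeg (x ! k) \<noteq> s"
  then have "zero_obj C (Dom C (inc x k))"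
    by (intro gr_retract_zero[of "wdeg (x ! k)" s _ "prj x k"]) (use assms in auto)
  then show False using assms sums_nzw[of x k] by (simp add: nzw_def)
qed

section \<open>Structure isomorphisms of sums, prescribed on the summands\<close>

definition sm :: "('o, 'g) strict_obj \<Rightarrow> ('o, 'g) strict_obj \<Rightarrow> 'm" where
  "sm x y = (SOME f. iso_arr C f \<and> Dom C f = robj x \<boxtimes> robj y \<and> Cod C f = robj (sten x y) \<and>
    (\<forall>n j k. n < length (sten x y) \<longrightarrow> pairs nzw x y ! n = (j, k) \<longrightarrow>
      f \<cdot> (inc x j \<boxtimes>\<^sub>m inc y k) = inc (sten x y) n \<cdot> wm (x ! j) (y ! k)))"

text \<open>When the empty word is dropped, unit and formal unit are realized by zero objects, and
  no condition on f remains to be imposed.\<close>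

definition su :: 'm where
  "su = (SOME f. iso_arr C f \<and> Dom C f = UnitObj C \<and> Cod C f = robj sun \<and> (nzw [] \<longrightarrow> f = inc sun 0))"

definition sb :: "'g \<Rightarrow> ('o, 'g) strict_obj \<Rightarrow> 'm" where
  "sb g x = (SOME f. iso_arr C f \<and> Dom C f = robj (sact g x) \<and> Cod C f = g \<star> robj x \<and>
    (\<forall>k<length x. f \<cdot> inc (sact g x) k = g \<star>\<^sub>m inc x k \<cdot> wb g (x ! k)))"

lemma zero_obj_not_nzw:
  assumes "word w" "word v" "\<not> nzw (w @ v)"
  shows "zero_obj C (wobj w \<boxtimes> wobj v)"
  using zero_obj_iso[of "wm w v"] assms by (simp add: nzw_def)

text \<open>An instance of \<open>coproduct_matching\<close> in which \<sigma> looks up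
  \<open>pairs\<close>: it is injective, and the pairs of positions that it misses have zero
  product.\<close>

lemma sm_props:
  assumes [simp]: "x \<in> sums" "y \<in> sums"
  shows "iso_arr C (sm x y)" "Dom C (sm x y) = robj x \<boxtimes> robj y" "Cod C (sm x y) = robj (sten x y)"
    "n < length (sten x y) \<Longrightarrow> pairs nzw x y ! n = (j, k) \<Longrightarrow>
      sm x y \<cdot> (inc x j \<boxtimes>\<^sub>m inc y k) = inc (sten x y) n \<cdot> wm (x ! j) (y ! k)"
proof -
  let ?I = "{..<length x} \<times> {..<length y}" and ?J = "{..<length (sten x y)}"
  let ?p = "pairs nzw x y"
  have c1: "coproduct C ?I (\<lambda>(j, k). wobj (x ! j) \<boxtimes> wobj (y ! k)) (robj x \<boxtimes> robj y)
    (\<lambda>(j, k). inc x j \<boxtimes>\<^sub>m inc y k)"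
    by (rule coproduct_tensor[OF biproduct_sums biproduct_sums]) auto
  have c2: "coproduct C ?J (\<lambda>n. wobj (sten x y ! n)) (robj (sten x y)) (inc (sten x y))"
    by (rule coproduct_sums) simp
  let ?\<theta> = "\<lambda>n. case ?p ! n of (j, k) \<Rightarrow> wm (x ! j) (y ! k)"
  obtain f where f: "iso_arr C f" "Dom C f = robj x \<boxtimes> robj y" "Cod C f = robj (sten x y)"
    "\<And>n. n \<in> ?J \<Longrightarrow> f \<cdot> (case ?p ! n of (j, k) \<Rightarrow> inc x j \<boxtimes>\<^sub>m inc y k) = inc (sten x y) n \<cdot> ?\<theta> n"
  proof (rule coproduct_matching[OF c1 c2, of "(!) ?p" ?\<theta>])
    show "(!) ?p ` ?J \<subseteq> ?I"
    proof
      fix q assume "q \<in> (!) ?p ` ?J"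
      then obtain n where "n < length (sten x y)" "q = ?p ! n" by auto
      then show "q \<in> ?I" using pairs_nth[of n nzw x y "fst q" "snd q"] by (simp add: mem_Times_iff)
    qed
    show "inj_on ((!) ?p) ?J" using inj_on_nth[OF distinct_pairs, of ?J nzw x y] by simp
    show "zero_obj C (case q of (j, k) \<Rightarrow> wobj (x ! j) \<boxtimes> wobj (y ! k))" if q: "q \<in> ?I - (!) ?p ` ?J" for q
    proof -
      obtain j k where jk: "q = (j, k)" "j < length x" "k < length y" using q by auto
      have "\<not> nzw (x ! j @ y ! k)"
      proof
        assume "nzw (x ! j @ y ! k)"
        then obtain n where "n < length (sten x y)" "?p ! n = (j, k)" using pairs_ex jk(2,3) by metis
        then have "q \<in> (!) ?p ` ?J" using jk(1) by (metis imageI lessThan_iff)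
        then show False using q by blast
      qed
      then show ?thesis using zero_obj_not_nzw[of "x ! j" "y ! k"] jk by simp
    qed
    show "iso_arr C (?\<theta> n) \<and> Dom C (?\<theta> n) = (case ?p ! n of (j, k) \<Rightarrow> wobj (x ! j) \<boxtimes> wobj (y ! k))
      \<and> Cod C (?\<theta> n) = wobj (sten x y ! n)" if "n \<in> ?J" for n
    proof -
      obtain j k where "?p ! n = (j, k)" by (cases "?p ! n")
      then show ?thesis using pairs_nth[of n nzw x y j k] that by simp
    qed
  qed (rule that)
  have "\<exists>f. iso_arr C f \<and> Dom C f = robj x \<boxtimes> robj y \<and> Cod C f = robj (sten x y) \<and>
    (\<forall>n j k. n < length (sten x y) \<longrightarrow> pairs nzw x y ! n = (j, k) \<longrightarrow>
      f \<cdot> (inc x j \<boxtimes>\<^sub>m inc y k) = inc (sten x y) n \<cdot> wm (x ! j) (y ! k))"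
    using f(1-3) f(4) by (intro exI[of _ f]) fastforce
  from someI_ex[OF this, folded sm_def]
  show "iso_arr C (sm x y)" "Dom C (sm x y) = robj x \<boxtimes> robj y" "Cod C (sm x y) = robj (sten x y)"
    "n < length (sten x y) \<Longrightarrow> pairs nzw x y ! n = (j, k) \<Longrightarrow>
      sm x y \<cdot> (inc x j \<boxtimes>\<^sub>m inc y k) = inc (sten x y) n \<cdot> wm (x ! j) (y ! k)" by blast+
qed

lemma su_props: "iso_arr C su" "Dom C su = UnitObj C" "Cod C su = robj sun" "nzw [] \<Longrightarrow> su = inc sun 0"
proof -
  have "\<exists>!h. h \<in> Hom C (UnitObj C) c \<and> (\<forall>k\<in>{0}. h \<cdot> Ident C (UnitObj C) = f k)"
    if "\<forall>k\<in>{0::nat}. f k \<in> Hom C (UnitObj C) c" for f c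
    by (rule ex1I[of _ "f 0"]) (use that in auto)
  \<comment> \<open>The unit is its own coproduct with one summand. It is matched with
    \<open>sun\<close>, which has one summand or none.\<close>
  then have c1: "coproduct C {0} (\<lambda>_. UnitObj C) (UnitObj C) (\<lambda>_::nat. Ident C (UnitObj C))"
    unfolding coproduct_def by (simp add: Ident_in del: Hom_iff)
  have c2: "coproduct C {..<length sun} (\<lambda>n. wobj (sun ! n)) (robj sun) (inc sun)"
    by (rule coproduct_sums) simp
  obtain f where f: "iso_arr C f" "Dom C f = UnitObj C" "Cod C f = robj sun"
    "\<And>n. n \<in> {..<length sun} \<Longrightarrow> f \<cdot> Ident C (UnitObj C) = inc sun n \<cdot> Ident C (UnitObj C)"
    by (rule coproduct_matching[OF c1 c2, of "\<lambda>_. 0" "\<lambda>_. Ident C (UnitObj C)"])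
      (auto simp: sun_def nzw_def inj_on_def split: if_splits)
  have "f = inc sun 0" if "nzw []"
  proof -
    have "0 < length sun" "sun ! 0 = []" using sun_eq[OF that] by simp_all
    then show ?thesis using f(4)[of 0] inc_Arr[of sun 0] f(2,3) iso_arr_in[OF f(1)] by simp
  qed
  then have "\<exists>f. iso_arr C f \<and> Dom C f = UnitObj C \<and> Cod C f = robj sun \<and> (nzw [] \<longrightarrow> f = inc sun 0)"
    using f by blast
  from someI_ex[OF this, folded su_def]
  show "iso_arr C su" "Dom C su = UnitObj C" "Cod C su = robj sun" "nzw [] \<Longrightarrow> su = inc sun 0"
    by blast+
qed

lemma coproduct_act:
  assumes "x \<in> sums" "g \<in> carrier G"
  shows "coproduct C {..<length x} (\<lambda>k. g \<star> wobj (x ! k)) (g \<star> robj x) (\<lambda>k. g \<star>\<^sub>m inc x k)"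
proof -
  interpret additive_functor C C "Act C g" using assms by (intro act_functor)
  show ?thesis by (rule biproduct_coproduct[OF fmor_biproduct[OF biproduct_sums[OF assms(1)]]])
qed

text \<open>The action drops no word and keeps positions, so summands are matched by the identity
  and compared by \<open>wb\<close>.\<close>

lemma sb_props:
  assumes [simp]: "x \<in> sums" "g \<in> carrier G"
  shows "iso_arr C (sb g x)" "Dom C (sb g x) = robj (sact g x)" "Cod C (sb g x) = g \<star> robj x"
    "k < length x \<Longrightarrow> sb g x \<cdot> inc (sact g x) k = g \<star>\<^sub>m inc x k \<cdot> wb g (x ! k)"
proof -
  have c1: "coproduct C {..<length x} (\<lambda>n. wobj (sact g x ! n)) (robj (sact g x)) (inc (sact g x))"
    using coproduct_sums[of "sact g x"] by simp
  obtain f where f: "iso_arr C f" "Dom C f = robj (sact g x)" "Cod C f = g \<star> robj x"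
    "\<And>n. n \<in> {..<length x} \<Longrightarrow> f \<cdot> inc (sact g x) n = g \<star>\<^sub>m inc x n \<cdot> wb g (x ! n)"
    by (rule coproduct_matching[OF c1 coproduct_act[OF assms], of "\<lambda>k. k" "\<lambda>k. wb g (x ! k)"]) auto
  then have "\<exists>f. iso_arr C f \<and> Dom C f = robj (sact g x) \<and> Cod C f = g \<star> robj x \<and>
    (\<forall>k<length x. f \<cdot> inc (sact g x) k = g \<star>\<^sub>m inc x k \<cdot> wb g (x ! k))" by blast
  from someI_ex[OF this, folded sb_def]
  show "iso_arr C (sb g x)" "Dom C (sb g x) = robj (sact g x)" "Cod C (sb g x) = g \<star> robj x"
    "k < length x \<Longrightarrow> sb g x \<cdot> inc (sact g x) k = g \<star>\<^sub>m inc x k \<cdot> wb g (x ! k)" by blast+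
qed

lemma sm_Arr [simp]:
  assumes "x \<in> sums" "y \<in> sums"
  shows "iso_arr C (sm x y)" "sm x y \<in> Arr C" "Dom C (sm x y) = robj x \<boxtimes> robj y"
    "Cod C (sm x y) = robj (sten x y)"
  using sm_props[OF assms] by (auto simp: iso_arr_in)

lemma su_Arr [simp]: "iso_arr C su" "su \<in> Arr C" "Dom C su = UnitObj C" "Cod C su = robj sun"
  using su_props iso_arr_in[OF su_props(1)] by auto

lemma sb_Arr [simp]:
  assumes "x \<in> sums" "g \<in> carrier G"
  shows "iso_arr C (sb g x)" "sb g x \<in> Arr C" "Dom C (sb g x) = robj (sact g x)"
    "Cod C (sb g x) = g \<star> robj x"
  using sb_props[OF assms] by (auto simp: iso_arr_in)

section \<open>Strict laws and coherence identities for sums\<close>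

lemma sten_sun [simp]:
  assumes "x \<in> sums"
  shows "sten sun x = x" "sten x sun = x"
    "nzw [] \<Longrightarrow> n < length x \<Longrightarrow> pairs nzw sun x ! n = (0, n)"
    "nzw [] \<Longrightarrow> n < length x \<Longrightarrow> pairs nzw x sun ! n = (n, 0)"
proof -
  have N: "\<And>w. w \<in> set x \<Longrightarrow> nzw w" using assms by (simp add: sums_def)
  show "nzw [] \<Longrightarrow> n < length x \<Longrightarrow> pairs nzw sun x ! n = (0, n)"
    "nzw [] \<Longrightarrow> n < length x \<Longrightarrow> pairs nzw x sun ! n = (n, 0)"
    using tens_unit_left[OF _ N] tens_unit_right[OF _ N] by (simp_all add: sun_def)
  \<comment> \<open>A summand w is nonzero and so is its empty prefix. Hence either the empty word
    is kept in \<open>sun\<close>, or x is empty and both products are trivially empty.\<close>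
  have "nzw []" if "w \<in> set x" for w
    using nzw_closed N[OF that] unfolding factor_closed_def by (metis append_Nil)
  then have "nzw [] \<or> x = []" by (cases x) auto
  then show "sten sun x = x" "sten x sun = x"
    using tens_unit_left(1)[OF _ N] tens_unit_right(1)[OF _ N] by (auto simp: tens_def sun_def)
qed

text \<open>All words of y have degree s by \<open>wdeg_eq\<close>, so \<open>wact_append\<close>
  twists every word of x by the same element. The action neither creates nor removes zero words, so
  the same positions are kept.\<close>

lemma sact_sten:
  assumes "g \<in> carrier G" "s \<in> carrier \<Gamma>" "x \<in> sums" "y \<in> sums" "robj y \<in> Gr C s"
  shows "sten (sact (s \<rhd>\<^sub>2 g) x) (sact g y) = sact g (sten x y)"
    "pairs nzw (sact (s \<rhd>\<^sub>2 g) x) (sact g y) = pairs nzw x y"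
proof -
  have "wact (s \<rhd>\<^sub>2 g) w @ wact g v = wact g (w @ v) \<and> nzw (wact g (w @ v)) = nzw (w @ v)"
    if w: "w \<in> set x" and v: "v \<in> set y" for w v
  proof -
    have "word w" "word v" using assms(3,4) w v by (simp_all add: sums_def)
    moreover have "wdeg v = s" using wdeg_eq[OF assms(4,2,5)] v by (metis in_set_conv_nth)
    ultimately show ?thesis using wact_append[of w v g] nzw_wact[of "w @ v" g] assms(1) by simp
  qed
  from pairs_tens_map[of x y, OF this]
  show "sten (sact (s \<rhd>\<^sub>2 g) x) (sact g y) = sact g (sten x y)"
    "pairs nzw (sact (s \<rhd>\<^sub>2 g) x) (sact g y) = pairs nzw x y" by blast+
qed

lemma sm_assoc:
  assumes [simp]: "x \<in> sums" "y \<in> sums" "z \<in> sums"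
  shows "sm x (sten y z) \<cdot> (Ident C (robj x) \<boxtimes>\<^sub>m sm y z) \<cdot> Assoc C (robj x) (robj y) (robj z)
    = sm (sten x y) z \<cdot> (sm x y \<boxtimes>\<^sub>m Ident C (robj z))" (is "?r = ?l")
proof -
  note ta [simp] = tens_assoc[OF nzw_closed, of x y z]
  show ?thesis
  proof (rule tensor3_eqI[OF biproduct_sums biproduct_sums biproduct_sums, of x y z])
    fix j k l assume jkl [simp]: "j < length x" "k < length y" "l < length z"
    let ?i = "(inc x j \<boxtimes>\<^sub>m inc y k) \<boxtimes>\<^sub>m inc z l"
    show "?r \<cdot> ?i = ?l \<cdot> ?i"
    \<comment> \<open>On a dropped triple both composites start at a zero object; on a kept one the
      claim becomes \<open>wm_assoc\<close>.\<close>
    proof (cases "nzw (x ! j @ y ! k @ z ! l)")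
      case False
      have "zero_obj C ((wobj (x ! j) \<boxtimes> wobj (y ! k)) \<boxtimes> wobj (z ! l))"
        using zero_obj_not_nzw[of "x ! j @ y ! k" "z ! l"]
          zero_obj_iso[of "wm (x ! j) (y ! k) \<boxtimes>\<^sub>m Ident C (wobj (z ! l))"] False by simp
      then show ?thesis by (rule zero_obj_arr_eq) auto
    next
      case True
      then have "nzw (x ! j @ y ! k)" using nzw_closed unfolding factor_closed_def by (metis append.assoc)
      then obtain n where n: "n < length (sten x y)" "pairs nzw x y ! n = (j, k)"
        using pairs_ex jkl by metis
      have xn: "sten x y ! n = x ! j @ y ! k" using pairs_nth[OF n] by simp
      obtain q where q: "q < length (sten (sten x y) z)" "pairs nzw (sten x y) z ! q = (n, l)"
        using pairs_ex[of n "sten x y" l z nzw] n True by (auto simp: xn)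
      \<comment> \<open>Summand q of the other bracketing stems from the same triple (j, k, l), so
        both sides end in the same inclusion.\<close>
      obtain n' where n': "pairs nzw x (sten y z) ! q = (j, n')" "pairs nzw y z ! n' = (k, l)"
        using pairs_assoc[OF nzw_closed q n(2)] by blast
      have q': "q < length (sten x (sten y z))" using q by simp
      have n'l: "n' < length (sten y z)" using pairs_nth[OF q' n'(1)] by simp
      have yn: "sten y z ! n' = y ! k @ z ! l" using pairs_nth[OF n'l n'(2)] by simp
      have xyz: "sten x (sten y z) ! q = x ! j @ y ! k @ z ! l" using pairs_nth[OF q' n'(1)] yn by simp
      note [simp] = n(1) n'l q' xn yn xyz
      note m1 = sm_props(4)[OF assms(1,2) n] and m2 = sm_props(4)[OF sten_in assms(3) q]
        and m3 = sm_props(4)[OF assms(2,3) n'l n'(2)] and m4 = sm_props(4)[OF assms(1) sten_in q' n'(1)]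
      let ?\<alpha> = "Assoc C (wobj (x ! j)) (wobj (y ! k)) (wobj (z ! l))" and ?q = "inc (sten x (sten y z)) q"
      let ?m = "wm (x ! j) (y ! k) \<boxtimes>\<^sub>m Ident C (wobj (z ! l))"
      let ?m' = "Ident C (wobj (x ! j)) \<boxtimes>\<^sub>m wm (y ! k) (z ! l)"
      have "?l \<cdot> ?i = (sm (sten x y) z \<cdot> (inc (sten x y) n \<boxtimes>\<^sub>m inc z l)) \<cdot>
          ?m"
        by (simp add: tensor_comp m1)
      also have "\<dots> = ?q \<cdot> (wm (x ! j @ y ! k) (z ! l) \<cdot>
          ?m)"
        unfolding m2 by simp
      also have "\<dots> = ?q \<cdot> (wm (x ! j) (y ! k @ z ! l) \<cdot>
          ?m' \<cdot> ?\<alpha>)"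
        by (subst wm_assoc) auto
      also have "\<dots> = (?q \<cdot> wm (x ! j) (sten y z ! n')) \<cdot>
          ?m' \<cdot> ?\<alpha>"
        by simp
      also have "\<dots> = sm x (sten y z) \<cdot> (inc x j \<boxtimes>\<^sub>m (inc (sten y z) n' \<cdot> wm (y ! k) (z ! l))) \<cdot>
          ?\<alpha>"
        unfolding m4[symmetric] by (simp add: tensor_comp)
      also have "\<dots> = ?r \<cdot> ?i"
        by (simp add: tensor_comp assoc_nat m3)
      finally show ?thesis by simp
    qed
  qed auto
qed

lemma nzw_Nil:
  assumes "x \<in> sums" "k < length x"
  shows "nzw []"
  using nzw_closed sums_nzw[OF assms] unfolding factor_closed_def by (metis append_Nil)

lemma sm_left:
  assumes [simp]: "x \<in> sums"
  shows "sm sun x \<cdot> (su \<boxtimes>\<^sub>m Ident C (robj x)) = LUnit C (robj x)"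
proof (rule coproduct_eqI[OF biproduct_coproduct[OF biproduct_tensor_right[OF biproduct_sums unit_Obj]]])
  show "x \<in> sums" by simp
  fix k assume "k \<in> {..<length x}"
  then have k [simp]: "k < length x" by simp
  \<comment> \<open>The existence of a summand forces the empty word to be nonzero, so
    \<open>su\<close> is the inclusion of the only summand of \<open>sun\<close>.\<close>
  have N: "nzw []" using nzw_Nil[OF assms k] .
  have "(sm sun x \<cdot> (su \<boxtimes>\<^sub>m Ident C (robj x))) \<cdot> (Ident C (UnitObj C) \<boxtimes>\<^sub>m inc x k)
      = sm sun x \<cdot> (su \<boxtimes>\<^sub>m inc x k)"
    by (simp add: tensor_comp)
  also have "\<dots> = sm sun x \<cdot> (inc sun 0 \<boxtimes>\<^sub>m inc x k)" by (simp only: su_props(4)[OF N])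
  also have "\<dots> = inc x k \<cdot> LUnit C (wobj (x ! k))"
    using sm_props(4)[of sun x k 0 k] N by (simp add: sun_eq[OF N, THEN arg_cong, of "\<lambda>x. x ! 0"])
  also have "\<dots> = LUnit C (robj x) \<cdot> (Ident C (UnitObj C) \<boxtimes>\<^sub>m inc x k)"
    by (simp add: LUnit_nat)
  finally show "(sm sun x \<cdot> (su \<boxtimes>\<^sub>m Ident C (robj x))) \<cdot> (Ident C (UnitObj C) \<boxtimes>\<^sub>m inc x k)
    = LUnit C (robj x) \<cdot> (Ident C (UnitObj C) \<boxtimes>\<^sub>m inc x k)" .
qed simp_all

lemma sm_right:
  assumes [simp]: "x \<in> sums"
  shows "sm x sun \<cdot> (Ident C (robj x) \<boxtimes>\<^sub>m su) = RUnit C (robj x)"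
proof (rule coproduct_eqI[OF biproduct_coproduct[OF biproduct_tensor_left[OF biproduct_sums unit_Obj]]])
  show "x \<in> sums" by simp
  fix k assume "k \<in> {..<length x}"
  then have k [simp]: "k < length x" by simp
  have N: "nzw []" using nzw_Nil[OF assms k] .
  have "(sm x sun \<cdot> (Ident C (robj x) \<boxtimes>\<^sub>m su)) \<cdot> (inc x k \<boxtimes>\<^sub>m Ident C (UnitObj C))
      = sm x sun \<cdot> (inc x k \<boxtimes>\<^sub>m su)"
    by (simp add: tensor_comp)
  also have "\<dots> = sm x sun \<cdot> (inc x k \<boxtimes>\<^sub>m inc sun 0)" by (simp only: su_props(4)[OF N])
  also have "\<dots> = inc x k \<cdot> RUnit C (wobj (x ! k))"
    using sm_props(4)[of x sun k k 0] N
    by (simp add: wm_Nil_right sun_eq[OF N, THEN arg_cong, of "\<lambda>x. x ! 0"])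
  also have "\<dots> = RUnit C (robj x) \<cdot> (inc x k \<boxtimes>\<^sub>m Ident C (UnitObj C))"
    by (simp add: RUnit_nat)
  finally show "(sm x sun \<cdot> (Ident C (robj x) \<boxtimes>\<^sub>m su)) \<cdot> (inc x k \<boxtimes>\<^sub>m Ident C (UnitObj C))
    = RUnit C (robj x) \<cdot> (inc x k \<boxtimes>\<^sub>m Ident C (UnitObj C))" .
qed simp_all

lemma sact_mult: "x \<in> sums \<Longrightarrow> g \<in> carrier G \<Longrightarrow> h \<in> carrier G \<Longrightarrow> sact g (sact h x) = sact (g \<otimes>\<^bsub>G\<^esub> h) x"
  by (auto simp: sums_def wact_wact)

lemma sb_mult:
  assumes [simp]: "x \<in> sums" "g \<in> carrier G" "h \<in> carrier G"
  shows "Chi C g h (robj x) \<cdot> g \<star>\<^sub>m sb h x \<cdot> sb g (sact h x) = sb (g \<otimes>\<^bsub>G\<^esub> h) x"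
proof (rule coproduct_eqI[OF coproduct_sums, of "sact (g \<otimes>\<^bsub>G\<^esub> h) x"])
  note sm [simp] = sact_mult[OF assms]
  note [simp del] = map_map list.map_comp
  fix k assume "k \<in> {..<length (sact (g \<otimes>\<^bsub>G\<^esub> h) x)}"
  then have k [simp]: "k < length x" by simp
  let ?k = "inc (sact (g \<otimes>\<^bsub>G\<^esub> h) x) k"
  have b1: "sb g (sact h x) \<cdot> ?k = g \<star>\<^sub>m inc (sact h x) k \<cdot> wb g (wact h (x ! k))"
    using sb_props(4)[of "sact h x" g k] by simp
  have b2: "sb h x \<cdot> inc (sact h x) k = h \<star>\<^sub>m inc x k \<cdot> wb h (x ! k)"
    using sb_props(4)[of x h k] by simp
  have "(Chi C g h (robj x) \<cdot> g \<star>\<^sub>m sb h x \<cdot> sb g (sact h x)) \<cdot> ?k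
    = Chi C g h (robj x) \<cdot> g \<star>\<^sub>m (sb h x \<cdot> inc (sact h x) k) \<cdot> wb g (wact h (x ! k))"
    by (simp add: b1 act_comp)
  also have "\<dots> = (Chi C g h (robj x) \<cdot> g \<star>\<^sub>m h \<star>\<^sub>m inc x k) \<cdot> g \<star>\<^sub>m wb h (x ! k) \<cdot> wb g (wact h (x ! k))"
    unfolding b2 by (simp add: act_comp)
  also have "\<dots> = (g \<otimes>\<^bsub>G\<^esub> h) \<star>\<^sub>m inc x k \<cdot>
      (Chi C g h (wobj (x ! k)) \<cdot> g \<star>\<^sub>m wb h (x ! k) \<cdot> wb g (wact h (x ! k)))"
    by (simp add: Chi_nat wact_wact)
  also have "\<dots> = (g \<otimes>\<^bsub>G\<^esub> h) \<star>\<^sub>m inc x k \<cdot> wb (g \<otimes>\<^bsub>G\<^esub> h) (x ! k)"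
    by (simp add: wb_mult)
  also have "\<dots> = sb (g \<otimes>\<^bsub>G\<^esub> h) x \<cdot> ?k" using sb_props(4)[of x "g \<otimes>\<^bsub>G\<^esub> h" k] by simp
  finally show "(Chi C g h (robj x) \<cdot> g \<star>\<^sub>m sb h x \<cdot> sb g (sact h x)) \<cdot> ?k = sb (g \<otimes>\<^bsub>G\<^esub> h) x \<cdot> ?k" .
qed (use sact_mult[OF assms] in \<open>simp_all del: map_map list.map_comp\<close>)

lemma sact_one [simp]: "x \<in> sums \<Longrightarrow> sact \<one>\<^bsub>G\<^esub> x = x"
  by (auto simp: sums_def wact_one map_idI)

lemma sb_one:
  assumes [simp]: "x \<in> sums"
  shows "sb \<one>\<^bsub>G\<^esub> x = Iota C (robj x)"
proof (rule coproduct_eqI[OF coproduct_sums, of x])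
  fix k assume "k \<in> {..<length x}"
  then have k [simp]: "k < length x" by simp
  show "sb \<one>\<^bsub>G\<^esub> x \<cdot> inc x k = Iota C (robj x) \<cdot> inc x k"
    using sb_props(4)[of x "\<one>\<^bsub>G\<^esub>" k] by (simp add: Iota_nat wb_one)
qed auto

lemma sact_sun [simp]: "sact g sun = sun"
  by (simp add: sun_def)

text \<open>Restricted to a pair of words the identity is \<open>wb_append\<close>, after naturality
  of \<open>ActMult\<close> has moved the inclusions outward.\<close>

lemma sb_sten:
  assumes g [simp]: "g \<in> carrier G" "s \<in> carrier \<Gamma>" "x \<in> sums" "y \<in> sums" "robj y \<in> Gr C s"
  shows "g \<star>\<^sub>m sm x y \<cdot> ActMult C g s (robj x) (robj y) \<cdot> (sb (s \<rhd>\<^sub>2 g) x \<boxtimes>\<^sub>m sb g y)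
    = sb g (sten x y) \<cdot> sm (sact (s \<rhd>\<^sub>2 g) x) (sact g y)" (is "?l = ?r")
proof (rule coproduct_eqI[OF coproduct_tensor[OF biproduct_sums biproduct_sums]])
  let ?h = "s \<rhd>\<^sub>2 g"
  note ss [simp] = sact_sten(1)[OF assms]
  fix q assume "q \<in> {..<length (sact ?h x)} \<times> {..<length (sact g y)}"
  then obtain j k where q: "q = (j, k)" and jk [simp]: "j < length x" "k < length y" by auto
  let ?i = "inc (sact ?h x) j \<boxtimes>\<^sub>m inc (sact g y) k"
  let ?u = "wact ?h (x ! j)" and ?v = "wact g (y ! k)" and ?w = "wb ?h (x ! j) \<boxtimes>\<^sub>m wb g (y ! k)"
  \<comment> \<open>The twist on words uses the degree of the word, the twist on sums uses s; here
    they are identified.\<close>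
  have s: "wdeg (y ! k) = s" by (rule wdeg_eq) auto
  have yGr [simp]: "wobj (y ! k) \<in> Gr C s" using wobj_in(3)[of "y ! k"] by (simp add: s)
  have "?l \<cdot> ?i = ?r \<cdot> ?i"
  proof (cases "nzw (x ! j @ y ! k)")
    case False
    then have "\<not> nzw (?u @ ?v)"
      using wact_append[of "x ! j" "y ! k" g] nzw_wact[of "x ! j @ y ! k" g] by (simp add: s)
    then have "zero_obj C (wobj (?u) \<boxtimes> wobj (?v))"
      by (intro zero_obj_not_nzw) auto
    then show ?thesis by (rule zero_obj_arr_eq) auto
  next
    case True
    then obtain n where n: "n < length (sten x y)" "pairs nzw x y ! n = (j, k)"
      using pairs_ex jk by metis
    have xn: "sten x y ! n = x ! j @ y ! k" using pairs_nth[OF n] by simp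
    note [simp] = n(1) xn
    have m1: "sm x y \<cdot> (inc x j \<boxtimes>\<^sub>m inc y k) = inc (sten x y) n \<cdot> wm (x ! j) (y ! k)"
      by (rule sm_props(4)[OF assms(3,4) n])
    \<comment> \<open>By \<open>sact_sten(2)\<close> the pair (j, k) occupies the same position n
      before and after the action.\<close>
    have m2: "sm (sact ?h x) (sact g y) \<cdot> ?i = inc (sact g (sten x y)) n \<cdot> wm (?u) (?v)"
      using sm_props(4)[of "sact ?h x" "sact g y" n j k] n by (simp add: sact_sten(2)[OF assms])
    have b1: "sb ?h x \<cdot> inc (sact ?h x) j = ?h \<star>\<^sub>m inc x j \<cdot> wb ?h (x ! j)"
      using sb_props(4)[of x ?h j] by simp
    have b2: "sb g y \<cdot> inc (sact g y) k = g \<star>\<^sub>m inc y k \<cdot> wb g (y ! k)"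
      using sb_props(4)[of y g k] by simp
    have b3: "sb g (sten x y) \<cdot> inc (sact g (sten x y)) n = g \<star>\<^sub>m inc (sten x y) n \<cdot> wb g (x ! j @ y ! k)"
      using sb_props(4)[of "sten x y" g n] by simp
    have wa: "wact g (x ! j @ y ! k) = ?u @ ?v"
      using wact_append[of "x ! j" "y ! k" g] by (simp add: s)
    have "?l \<cdot> ?i = g \<star>\<^sub>m sm x y \<cdot> (ActMult C g s (robj x) (robj y) \<cdot> (?h \<star>\<^sub>m inc x j \<boxtimes>\<^sub>m g \<star>\<^sub>m inc y k))
        \<cdot> (?w)"
      by (simp add: tensor_comp b1 b2)
    also have "\<dots> = g \<star>\<^sub>m (sm x y \<cdot> (inc x j \<boxtimes>\<^sub>m inc y k)) \<cdot> ActMult C g s (wobj (x ! j)) (wobj (y ! k))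
        \<cdot> (?w)"
      by (subst ActMult_nat) (auto simp: act_comp)
    also have "\<dots> = g \<star>\<^sub>m inc (sten x y) n \<cdot> (g \<star>\<^sub>m wm (x ! j) (y ! k) \<cdot> ActMult C g s (wobj (x ! j)) (wobj (y ! k))
        \<cdot> (?w))"
      unfolding m1 by (simp add: act_comp)
    also have "\<dots> = g \<star>\<^sub>m inc (sten x y) n \<cdot> (wb g (x ! j @ y ! k) \<cdot> wm (?u) (?v))"
      using wb_append[of "x ! j" "y ! k" g] by (simp add: s)
    also have "\<dots> = (sb g (sten x y) \<cdot> inc (sact g (sten x y)) n) \<cdot> wm (?u) (?v)"
      unfolding b3 by (simp add: wa)
    also have "\<dots> = ?r \<cdot> ?i" using m2 by (simp add: wa)
    finally show ?thesis .
  qed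
  then show "?l \<cdot> (case q of (j, k) \<Rightarrow> inc (sact ?h x) j \<boxtimes>\<^sub>m inc (sact g y) k) =
    ?r \<cdot> (case q of (j, k) \<Rightarrow> inc (sact ?h x) j \<boxtimes>\<^sub>m inc (sact g y) k)" by (simp add: q)
qed (use sact_sten(1)[OF assms] in auto)

lemma robj_surj:
  assumes a: "a \<in> Obj C"
  shows "\<exists>x\<in>sums. \<exists>f. iso_arr C f \<and> Dom C f = robj x \<and> Cod C f = a"
proof -
  obtain n c where c: "\<forall>k<n. \<exists>s\<in>carrier \<Gamma>. c k \<in> Gr C s" and ds: "direct_sum C n c a"
    using gr_decomposition[OF a] by blast
  obtain i p where b: "biproduct C n c a i p" using ds unfolding direct_sum_iff by blast
  have co [simp]: "k < n \<Longrightarrow> c k \<in> Obj C" for k using b by (simp add: biproduct_def)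
  \<comment> \<open>The positions of the nonzero summands; the others are omitted because a formal
    sum admits no zero word.\<close>
  define ks where "ks = filter (\<lambda>k. \<not> zero_obj C (c k)) [0..<n]"
  define x where "x = map (\<lambda>k. [(\<one>\<^bsub>G\<^esub>, c k)]) ks"
  \<comment> \<open>Each c k becomes the one-letter word with the neutral element, so \<theta> first
    applies \<open>Iota\<close> and then adds the trailing unit of \<open>wobj\<close>.\<close>
  define \<theta> where "\<theta> k = inv_arr C (RUnit C (\<one>\<^bsub>G\<^esub> \<star> c k)) \<cdot> Iota C (c k)" for k
  have \<theta>: "iso_arr C (\<theta> k)" "Dom C (\<theta> k) = c k" "Cod C (\<theta> k) = wobj [(\<one>\<^bsub>G\<^esub>, c k)]" if "k < n" for k
    using that by (simp_all add: \<theta>_def lobj_def)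
  have ks: "k \<in> set ks \<Longrightarrow> k < n \<and> \<not> zero_obj C (c k)" for k by (auto simp: ks_def)
  have x: "x \<in> sums"
  proof -
    have "nzw [(\<one>\<^bsub>G\<^esub>, c k)]" if "k \<in> set ks" for k
      using ks[OF that] c \<theta>[of k] zero_obj_iso[of "\<theta> k"] by (auto simp: nzw_def letter_def)
    then show ?thesis by (auto simp: sums_def x_def)
  qed
  have len [simp]: "length x = length ks" by (simp add: x_def)
  obtain f where "iso_arr C f" "Dom C f = a" "Cod C f = robj x"
  proof (rule coproduct_matching[OF biproduct_coproduct[OF b] coproduct_sums[OF x], of "(!) ks" "\<lambda>j. \<theta> (ks ! j)"])
    show "(!) ks ` {..<length x} \<subseteq> {..<n}" using ks nth_mem by fastforce
    show "inj_on ((!) ks) {..<length x}" using inj_on_nth[of ks] by (simp add: ks_def)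
    show "zero_obj C (c k)" if "k \<in> {..<n} - (!) ks ` {..<length x}" for k
    proof (rule ccontr)
      assume "\<not> zero_obj C (c k)"
      then have "k \<in> set ks" using that by (simp add: ks_def)
      then show False using that by (auto simp: in_set_conv_nth)
    qed
    show "iso_arr C (\<theta> (ks ! j)) \<and> Dom C (\<theta> (ks ! j)) = c (ks ! j) \<and> Cod C (\<theta> (ks ! j)) = wobj (x ! j)"
      if "j \<in> {..<length x}" for j
      using that ks[of "ks ! j"] \<theta>[of "ks ! j"] by (simp add: x_def)
  qed (rule that)
  then show ?thesis using x by (intro bexI[of _ x] exI[of _ "inv_arr C f"]) auto
qed

lemma strict_model_sums: "strict_model G \<Gamma> act1 act2 C sums robj sten sun sact sm su sb"
  apply (intro strict_model.intro strict_model_axioms.intro crossed_monoidal_category_axioms)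
  subgoal by simp
  subgoal by (rule robj_surj)
  subgoal by simp
  subgoal by (rule sun_in)
  subgoal by simp
  subgoal by (rule tens_assoc[OF nzw_closed])
  subgoal by (rule sten_sun)
  subgoal by (rule sten_sun)
  subgoal by simp
  subgoal by (rule sact_mult)
  subgoal by (rule sact_sun)
  subgoal by (rule sact_sten(1)[symmetric])
  subgoal by (simp add: Isos_iff)
  subgoal by (simp add: Isos_iff)
  subgoal by (simp add: Isos_iff)
  subgoal by (rule sm_assoc)
  subgoal by (rule sm_left)
  subgoal by (rule sm_right)
  subgoal by (rule sb_mult)
  subgoal by (rule sb_one)
  subgoal by (rule sb_sten)
  done

end

theorem theorem3p8:
  fixes G :: "('g, 'x) monoid_scheme" and \<Gamma> :: "('s, 'y) monoid_scheme"
    and act1 :: "'g \<Rightarrow> 's \<Rightarrow> 's" and act2 :: "'s \<Rightarrow> 'g \<Rightarrow> 'g"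
    and C :: "('o, 'm, 'g, 's) crossed_category"
  assumes "matched_pair G \<Gamma> act1 act2"
    and "crossed_monoidal_category G \<Gamma> act1 act2 C"
  shows "\<exists>(D :: ('o, 'm, 'g, 's) strict_category) F.
    crossed_monoidal_category G \<Gamma> act1 act2 D \<and>
    strictly_crossed G \<Gamma> D \<and> strict_monoidal D \<and>
    crossed_monoidal_equivalence G \<Gamma> act1 act2 C D F"
  \<comment> \<open>The witnesses are \<open>SC\<close> and \<open>SF\<close> for the model with
    formal objects \<open>sums\<close>, whose type of objects turns the type of \<open>SC\<close>
    into the prescribed one.\<close>
  using strict_model.equivalence_SC[OF crossed_monoidal_category.strict_model_sums[OF assms(2)]]
  by blast

end
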